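(* Let $n\ge2$, $\omega\in\mathbf{C}^n$, $R_\omega>0$, $x_0\in B(\omega,R_\omega)$ and $f=(f_1,\dots,f_n)\in(\mathbf{A}^2(\omega,R_\omega))^n$ with $Df(x_0)$ invertible. Let $\alpha=\alpha(f,x_0)$, $\gamma=\gamma(f,x_0)$, $\kappa=\kappa_{x_0}$ be the quantities defined in the context. Suppose that $$\alpha<2\gamma+1-\sqrt{(2\gamma+1)^2-1}.$$ Then for every $\theta>0$ such that $B(x_0,\theta)\subset B(\omega,R_\omega)$ and $$\frac{\alpha+1-\sqrt{(\alpha+1)^2-4\alpha(\gamma+1)}}{2(\gamma+1)}<\kappa\theta<\frac{1}{\gamma+1},$$ $f$ has a unique root in the ball $B(x_0,\theta)$.
   Context: Balls are open Euclidean balls in $\mathbf{C}^n$. $\mathbf{A}^2(\omega,R_\omega)$ is the Hilbert space of analytic square-integrable functions on $B(\omega,R_\omega)$ with inner product $\langle f,g\rangle=\frac{c_n}{R_\omega^{2n}}\int_{B(\omega,R_\omega)}f(z)\overline{g(z)}\,dz$, $c_n=n!/\pi^n$; on $(\mathbf{A}^2(\omega,R_\omega))^n$ the norm is $\|f\|=(\sum_i\|f_i\|^2)^{1/2}$. Matrix norms are operator norms for Euclidean norms. For $x\in B(\omega,R_\omega)$ put $\nu_x=\|x-\omega\|/R_\omega$ and - $\beta(f,x)=\|Df(x)^{-1}f(x)\|$, - $\lambda(f,x)=\|f\|/(1-\nu_x^2)^{\frac{n+1}{2}}$, - $\kappa_x=\max\Big(1,\frac{n+1}{R_\omega(1-\nu_x^2)}\Big)$,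 - $\mu(f,x)=\|Df(x)^{-1}\|$, - $\gamma(f,x)=\max\big(1,\lambda(f,x)\,\kappa_x\,\mu(f,x)\big)$, - $\alpha(f,x)=\beta(f,x)\,\kappa_x$. *)

theory Defs
  imports "HOL-Analysis.Analysis"
begin

text \<open>
  \<open>\<complex>\<^sup>n\<close> is \<^typ>\<open>complex^'n\<close> with \<open>n = CARD('n)\<close>; its norm is the Hermitian norm, and Lebesgue
  measure on \<open>\<complex>\<^sup>n = \<real>\<^sup>2\<^sup>n\<close> is \<^const>\<open>lborel\<close>.
\<close>

text \<open>
  Local expandability into power series indexed by multi-indices \<open>k\<close>. As \<^const>\<open>has_sum\<close> is
  unconditional summation, convergence is absolute.
\<close>

definition analytic_in :: "(complex^'n \<Rightarrow> complex) \<Rightarrow> (complex^'n) set \<Rightarrow> bool"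
  where "analytic_in f S \<longleftrightarrow>
    (\<forall>a\<in>S. \<exists>r>0. \<exists>c :: ('n \<Rightarrow> nat) \<Rightarrow> complex. \<forall>z\<in>ball a r.
       ((\<lambda>k. c k * (\<Prod>i\<in>UNIV. (z $ i - a $ i) ^ k i)) has_sum f z) UNIV)"

text \<open>
  Functions are total; only their values on the ball are constrained.
\<close>

definition A2 :: "complex^'n \<Rightarrow> real \<Rightarrow> (complex^'n \<Rightarrow> complex) set"
  where "A2 \<omega> R = {f. analytic_in f (ball \<omega> R) \<and>
    set_integrable lborel (ball \<omega> R) (\<lambda>z. (cmod (f z))\<^sup>2)}"

definition A2_inner ::
    "complex^'n \<Rightarrow> real \<Rightarrow> (complex^'n \<Rightarrow> complex) \<Rightarrow> (complex^'n \<Rightarrow> complex) \<Rightarrow> complex"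
  where "A2_inner \<omega> R f g =
    complex_of_real ((fact CARD('n) / pi ^ CARD('n)) / R ^ (2 * CARD('n))) *
      (LINT z:ball \<omega> R|lborel. f z * cnj (g z))"

definition A2_norm :: "complex^'n \<Rightarrow> real \<Rightarrow> (complex^'n \<Rightarrow> complex) \<Rightarrow> real"
  where "A2_norm \<omega> R f = sqrt (Re (A2_inner \<omega> R f f))"

definition A2_system :: "complex^'n \<Rightarrow> real \<Rightarrow> (complex^'n \<Rightarrow> complex^'n) set"
  where "A2_system \<omega> R = {f. \<forall>i. (\<lambda>z. f z $ i) \<in> A2 \<omega> R}"

definition A2_system_norm :: "complex^'n \<Rightarrow> real \<Rightarrow> (complex^'n \<Rightarrow> complex^'n) \<Rightarrow> real"
  where "A2_system_norm \<omega> R f = sqrt (\<Sum>i\<in>UNIV. (A2_norm \<omega> R (\<lambda>z. f z $ i))\<^sup>2)"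

text \<open>
  \<^const>\<open>frechet_derivative\<close> is the real derivative, which is complex linear where \<open>f\<close> is analytic,
  so that this is then the complex Jacobian matrix.
\<close>

definition D :: "(complex^'n \<Rightarrow> complex^'n) \<Rightarrow> complex^'n \<Rightarrow> complex^'n^'n"
  where "D f x = matrix (frechet_derivative f (at x))"

definition op_norm :: "complex^'n^'n \<Rightarrow> real"
  where "op_norm A = onorm ((*v) A)"

definition nu :: "complex^'n \<Rightarrow> real \<Rightarrow> complex^'n \<Rightarrow> real"
  where "nu \<omega> R x = norm (x - \<omega>) / R"

definition beta :: "(complex^'n \<Rightarrow> complex^'n) \<Rightarrow> complex^'n \<Rightarrow> real"
  where "beta f x = norm (matrix_inv (D f x) *v f x)"

definition lambda ::
    "complex^'n \<Rightarrow> real \<Rightarrow> (complex^'n \<Rightarrow> complex^'n) \<Rightarrow> complex^'n \<Rightarrow> real"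
  where "lambda \<omega> R f x =
    A2_system_norm \<omega> R f / (1 - (nu \<omega> R x)\<^sup>2) powr ((real CARD('n) + 1) / 2)"

definition kappa :: "complex^'n \<Rightarrow> real \<Rightarrow> complex^'n \<Rightarrow> real"
  where "kappa \<omega> R x = max 1 ((real CARD('n) + 1) / (R * (1 - (nu \<omega> R x)\<^sup>2)))"

definition mu :: "(complex^'n \<Rightarrow> complex^'n) \<Rightarrow> complex^'n \<Rightarrow> real"
  where "mu f x = op_norm (matrix_inv (D f x))"

definition gamma ::
    "complex^'n \<Rightarrow> real \<Rightarrow> (complex^'n \<Rightarrow> complex^'n) \<Rightarrow> complex^'n \<Rightarrow> real"
  where "gamma \<omega> R f x = max 1 (lambda \<omega> R f x * kappa \<omega> R x * mu f x)"

definition alpha ::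
    "complex^'n \<Rightarrow> real \<Rightarrow> (complex^'n \<Rightarrow> complex^'n) \<Rightarrow> complex^'n \<Rightarrow> real"
  where "alpha \<omega> R f x = beta f x * kappa \<omega> R x"

end

theory Submission
  imports Defs "HOL-Complex_Analysis.Cauchy_Integral_Formula"
begin

text \<open>
  Scale the ball to the unit ball and put \<open>x = (x\<^sub>0 - \<omega>)/R\<close>, \<open>s = 1 - \<parallel>x\<parallel>\<^sup>2\<close>, \<open>N = n + 1\<close>. By the reproducing
  property of the Bergman kernel, the norm of a finite combination of point evaluations is
  given by the values of \<open>(1 - \<langle>z,z'\<rangle>)\<^sup>-\<^sup>N\<close>. In the projective coordinates \<open>y\<close> with
  \<open>z = x + y/(1 + \<langle>y,x\<rangle>/s)\<close>, and after multiplying \<open>f\<close> by \<open>(1 + \<langle>y,x\<rangle>/s)\<^sup>-\<^sup>N\<close>, the kernel becomes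
  \<open>s\<^sup>-\<^sup>N(1 - Q(y,y'))\<^sup>-\<^sup>N\<close> for a Hermitian form \<open>Q\<close>; these are the automorphism of the ball that moves
  \<open>x\<close> to the centre, up to a linear map. Hence the terms of order at least two of the transformed system
  are controlled by \<open>\<Sum>\<^sub>k\<^sub>\<ge>\<^sub>2 binom(n+k, k) Q\<^sup>k\<close>, which is much smaller than the geometric series
  behind \<open>\<gamma>\<close>.

  This gain is needed: the geometric series alone gives uniqueness only up to the larger root of
  \<open>(\<gamma> + 1)u\<^sup>2 - (\<alpha> + 1)u + \<alpha>\<close>, which is at most \<open>1/(\<gamma> + 1)\<close>. The terms created by the change of coordinates are
  absorbed by \<open>\<gamma>\<^sup>2 s \<ge> N\<close>, which follows by testing the derivative on a vector orthogonal to \<open>x\<close>;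
  it exists because \<open>n \<ge> 2\<close>. Existence follows from Brouwer's theorem for the Newton-like map
  \<open>y \<mapsto> y - G(y)/R\<close> of the transformed system \<open>G\<close>, uniqueness because \<open>G\<close> is injective near \<open>0\<close>.
\<close>

section \<open>Isometries, dilations and the Gaussian layer cake\<close>

text \<open>Expanded about x in the original coordinates, (1 - <z,z'>)^-N mixes different orders in
  the two variables, so discarding value and derivative leaves no clean remainder. In the
  coordinates y the kernel is a power series in Q(y,y') alone: Taylor terms of different orders
  decouple, and the subtraction removes exactly k = 0 and k = 1. The hypothesis on \<theta> enters
  through M = \<kappa>Rs >= N: if \<kappa>|z - x_0| < 1/(\<gamma>+1), the rescaled point moves by
  less than s/(N(\<gamma>+1)). This 1/N compensates the growth N^k of binom(n+k,k). The price is
  that the multiplier adds to the derivative a rank-one term along b = Df(x_0)^-1 f(x_0). Uniqueness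
  tolerates it because \<alpha> < 1/5, existence because |x| <= 0.29 \<gamma>. Derivatives enter the
  kernel estimates only as limits of difference quotients, that is, of finite combinations of point
  values.\<close>

lemma nn_integral_lborel_translate:
  fixes f :: "'a::euclidean_space \<Rightarrow> ennreal"
  assumes [measurable]: "f \<in> borel_measurable borel"
  shows "(\<integral>\<^sup>+x. f (x + t) \<partial>lborel) = (\<integral>\<^sup>+x. f x \<partial>lborel)"
proof -
  have "(\<integral>\<^sup>+x. f x \<partial>lborel) = (\<integral>\<^sup>+x. f x \<partial>distr lborel borel ((+) t))"
    by (simp add: lborel_distr_plus)
  also have "\<dots> = (\<integral>\<^sup>+x. f (t + x) \<partial>lborel)"
    by (rule nn_integral_distr) auto
  finally show ?thesis by (simp add: add.commute)
qed

lemma nn_integral_lborel_scale: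
  fixes f :: "'a::euclidean_space \<Rightarrow> ennreal"
  assumes [measurable]: "f \<in> borel_measurable borel" and "c \<noteq> 0"
  shows "(\<integral>\<^sup>+x. f x \<partial>lborel) = ennreal (\<bar>c\<bar> ^ DIM('a)) * (\<integral>\<^sup>+x. f (t + c *\<^sub>R x) \<partial>lborel)"
  by (subst lborel_affine[OF assms(2), of t]) (simp add: nn_integral_density nn_integral_distr nn_integral_cmult)

text \<open>Double counting instead of determinants. With \<open>B\<close> the unit ball, the
  integral of 1_A(Tx) 1_B(Tx + y) over x and y is computed in both orders; surjectivity of T lets
  the shift by y be absorbed into x. If \<mu> is the image measure, this gives \<mu>(A) vol(B) =
  vol(A) \<mu>(B), while \<mu>(B) = vol(B) is positive and finite.\<close>

lemma lborel_distr_isometry: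
  fixes T :: "'a::euclidean_space \<Rightarrow> 'a"
  assumes lin: "linear T" and iso: "\<And>x. norm (T x) = norm x"
  shows "distr lborel borel T = lborel"
proof (rule measure_eqI)
  show "sets (distr lborel borel T) = sets lborel" by simp
  fix A assume "A \<in> sets (distr lborel borel T)"
  then have A[measurable]: "A \<in> sets borel" by simp
  have [measurable]: "T \<in> borel_measurable borel"
    by (intro borel_measurable_continuous_onI linear_continuous_on linear_linear[THEN iffD2] lin)
  define B :: "'a set" where "B = ball 0 1"
  have [measurable]: "B \<in> sets borel" by (simp add: B_def)
  have inj: "inj T" using iso linear_injective_0[OF lin] by (metis norm_eq_zero)
  then have sur: "surj T" using linear_injective_imp_surjective[OF lin] by simp
  let ?I = "\<lambda>A x. indicator A x :: ennreal"
  have "(\<integral>\<^sup>+x. \<integral>\<^sup>+y. ?I A (T x) * ?I B (T x + y) \<partial>lborel \<partial>lborel) 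
      = (\<integral>\<^sup>+x. ?I A (T x) * emeasure lborel B \<partial>lborel)"
  proof (rule nn_integral_cong)
    fix x
    have "(\<integral>\<^sup>+y. ?I B (T x + y) \<partial>lborel) = emeasure lborel B"
      using nn_integral_lborel_translate[of "?I B" "T x"] by (simp add: add.commute)
    then show "(\<integral>\<^sup>+y. ?I A (T x) * ?I B (T x + y) \<partial>lborel) = ?I A (T x) * emeasure lborel B"
      by (subst nn_integral_cmult) auto
  qed
  also have "\<dots> = (\<integral>\<^sup>+x. ?I A x \<partial>distr lborel borel T) * emeasure lborel B"
    by (simp add: nn_integral_multc nn_integral_distr del: nn_integral_indicator)
  finally have 1: "(\<integral>\<^sup>+x. \<integral>\<^sup>+y. ?I A (T x) * ?I B (T x + y) \<partial>lborel \<partial>lborel)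
     = emeasure (distr lborel borel T) A * emeasure lborel B" by simp
  have "(\<integral>\<^sup>+x. \<integral>\<^sup>+y. ?I A (T x) * ?I B (T x + y) \<partial>lborel \<partial>lborel)
     = (\<integral>\<^sup>+y. \<integral>\<^sup>+x. ?I A (T x) * ?I B (T x + y) \<partial>lborel \<partial>lborel)"
    by (rule lborel_pair.Fubini') measurable
  also have "\<dots> = (\<integral>\<^sup>+y. \<integral>\<^sup>+x. ?I A (T x - y) * ?I B (T x) \<partial>lborel \<partial>lborel)"
  proof (rule nn_integral_cong)
    fix y
    obtain u where u: "T u = y" using sur by (metis surjD)
    have "(\<integral>\<^sup>+x. ?I A (T x - y) * ?I B (T x) \<partial>lborel) = (\<integral>\<^sup>+x. ?I A (T (x + u) - y) * ?I B (T (x + u)) \<partial>lborel)"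
      by (rule nn_integral_lborel_translate[symmetric, where f = "\<lambda>x. ?I A (T x - y) * ?I B (T x)"]) measurable
    then show "(\<integral>\<^sup>+x. ?I A (T x) * ?I B (T x + y) \<partial>lborel) = (\<integral>\<^sup>+x. ?I A (T x - y) * ?I B (T x) \<partial>lborel)"
      by (simp add: linear_add[OF lin] u)
  qed
  also have "\<dots> = (\<integral>\<^sup>+x. \<integral>\<^sup>+y. ?I A (T x - y) * ?I B (T x) \<partial>lborel \<partial>lborel)"
    by (rule lborel_pair.Fubini'[symmetric]) measurable
  also have "\<dots> = (\<integral>\<^sup>+x. emeasure lborel A * ?I B (T x) \<partial>lborel)"
  proof (rule nn_integral_cong)
    fix x
    have "(\<integral>\<^sup>+y. ?I A y \<partial>lborel) = (\<integral>\<^sup>+y. ?I A (T x + (-1) *\<^sub>R y) \<partial>lborel)"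
      by (subst nn_integral_lborel_scale[of _ "-1" "T x"]) auto
    then show "(\<integral>\<^sup>+y. ?I A (T x - y) * ?I B (T x) \<partial>lborel) = emeasure lborel A * ?I B (T x)"
      by (simp add: nn_integral_multc)
  qed
  also have "\<dots> = emeasure lborel A * (\<integral>\<^sup>+x. ?I B x \<partial>distr lborel borel T)"
    by (simp add: nn_integral_cmult nn_integral_distr del: nn_integral_indicator)
  finally have 2: "emeasure (distr lborel borel T) A * emeasure lborel B
     = emeasure lborel A * emeasure (distr lborel borel T) B" using 1 by simp
  have "T -` B = B" by (auto simp: B_def iso)
  then have 3: "emeasure (distr lborel borel T) B = emeasure lborel B"
    by (simp add: emeasure_distr)
  have "emeasure lborel B \<noteq> 0" "emeasure lborel B \<noteq> \<infinity>"
    using emeasure_lborel_ball_finite[of "0::'a" 1]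
    by (auto simp: B_def emeasure_ball unit_ball_vol_def Gamma_eq_zero_iff)
  then show "emeasure (distr lborel borel T) A = emeasure lborel A"
    using 2 3 by (metis ennreal_mult_cancel_left mult.commute ennreal_mult_strict_right_mono infinity_ennreal_def)
qed

lemma nn_integral_lborel_isometry:
  fixes T :: "'a::euclidean_space \<Rightarrow> 'a"
  assumes "linear T" "\<And>x. norm (T x) = norm x" and [measurable]: "f \<in> borel_measurable borel"
  shows "(\<integral>\<^sup>+x. f (T x) \<partial>lborel) = (\<integral>\<^sup>+x. f x \<partial>lborel)"
proof -
  have [measurable]: "T \<in> borel_measurable borel"
    by (intro borel_measurable_continuous_onI linear_continuous_on linear_linear[THEN iffD2] assms)
  show ?thesis
    by (subst lborel_distr_isometry[OF assms(1,2), symmetric]) (simp add: nn_integral_distr)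
qed

lemma integral_lborel_isometry:
  fixes T :: "'a::euclidean_space \<Rightarrow> 'a" and f :: "'a \<Rightarrow> 'b::{banach, second_countable_topology}"
  assumes "linear T" "\<And>x. norm (T x) = norm x" and [measurable]: "f \<in> borel_measurable borel"
  shows "(\<integral>x. f (T x) \<partial>lborel) = (\<integral>x. f x \<partial>lborel)"
proof -
  have [measurable]: "T \<in> borel_measurable borel"
    by (intro borel_measurable_continuous_onI linear_continuous_on linear_linear[THEN iffD2] assms)
  show ?thesis
    by (subst (2) lborel_distr_isometry[OF assms(1,2), symmetric]) (simp add: integral_distr)
qed

text \<open>exp(-|z|^2) is the integral of exp(-t) over t > |z|^2. After exchanging the integrals,
  the ball of radius sqrt t contributes t^(n+k) times the unit-ball integral by homogeneity, and
  Gamma(n+k+1) is left. This trades moments of the ball for Gaussian ones, which are computed by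
  stretching a coordinate.\<close>

lemma nn_integral_gaussian_layer_cake:
  fixes Q :: "'a::euclidean_space \<Rightarrow> ennreal"
  assumes [measurable]: "Q \<in> borel_measurable borel" and dim: "DIM('a) = 2 * n"
    and hom: "\<And>t z. t > 0 \<Longrightarrow> Q (t *\<^sub>R z) = ennreal (t ^ (2 * k)) * Q z"
  shows "(\<integral>\<^sup>+z. Q z * ennreal (exp (- (norm z)\<^sup>2)) \<partial>lborel)
       = ennreal (fact (n + k)) * (\<integral>\<^sup>+z. Q z * indicator (ball 0 1) z \<partial>lborel)"
proof -
  define M where "M = (\<integral>\<^sup>+z. Q z * indicator (ball 0 1) z \<partial>lborel)"
  have Qm: "(\<lambda>z. Q z * indicator (ball 0 1) z) \<in> borel_measurable borel"
    by (intro borel_measurable_times_ennreal borel_measurable_indicator assms) simp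
  have gam: "(\<integral>\<^sup>+t. ennreal (indicator {0..} t * t powr (real (n+k+1) - 1) / exp t) \<partial>lborel) = ennreal (fact (n + k))"
    using Gamma_conv_nn_integral_real[of "real (n+k+1)"] Gamma_fact[of "n + k", where ?'a = real]
    by (simp add: add_ac)
  have e: "(\<integral>\<^sup>+t. ennreal (exp (- t)) * indicator {a<..} t \<partial>lborel) = ennreal (exp (- a))" for a :: real
  proof -
    have "(\<integral>\<^sup>+t. ennreal (exp (- t)) * indicator {a<..} t \<partial>lborel) = (\<integral>\<^sup>+t. ennreal (exp (- t)) * indicator {a..} t \<partial>lborel)"
      using AE_lborel_singleton[of a]
      by (intro nn_integral_cong_AE) (auto elim!: eventually_mono split: split_indicator)
    also have "\<dots> = ennreal (0 - - exp (- a))"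
      by (rule nn_integral_FTC_atLeast[where F = "\<lambda>t. - exp (- t)"]) 
         (auto intro!: derivative_eq_intros tendsto_minus_cancel_left[THEN iffD1] exp_at_bot[THEN filterlim_compose] filterlim_uminus_at_bot_at_top)
    finally show ?thesis by simp
  qed
  have "(\<integral>\<^sup>+z. Q z * ennreal (exp (- (norm z)\<^sup>2)) \<partial>lborel)
     = (\<integral>\<^sup>+z. \<integral>\<^sup>+t. Q z * (ennreal (exp (- t)) * indicator {(norm z)\<^sup>2<..} t) \<partial>lborel \<partial>lborel)"
    by (simp add: nn_integral_cmult e)
  also have "\<dots> = (\<integral>\<^sup>+z. \<integral>\<^sup>+t. Q z * (ennreal (exp (- t)) * (if (norm z)\<^sup>2 < t then 1 else 0)) \<partial>lborel \<partial>lborel)"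
    by (intro nn_integral_cong) (simp add: indicator_def)
  also have "\<dots> = (\<integral>\<^sup>+t. \<integral>\<^sup>+z. Q z * (ennreal (exp (- t)) * (if (norm z)\<^sup>2 < t then 1 else 0)) \<partial>lborel \<partial>lborel)"
    by (rule lborel_pair.Fubini') measurable
  also have "\<dots> = (\<integral>\<^sup>+t. ennreal (indicator {0..} t * t powr (real (n+k+1) - 1) / exp t) * M \<partial>lborel)"
  proof (intro nn_integral_cong_AE, use AE_lborel_singleton[of "0::real"] in eventually_elim)
    fix t :: real assume "t \<noteq> 0"
    show "(\<integral>\<^sup>+z. Q z * (ennreal (exp (- t)) * (if (norm z)\<^sup>2 < t then 1 else 0)) \<partial>lborel)
        = ennreal (indicator {0..} t * t powr (real (n+k+1) - 1) / exp t) * M"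
    proof (cases "t > 0")
      case False
      then have "\<not> (norm (z::'a))\<^sup>2 < t" for z using zero_le_power2[of "norm z"] by linarith
      then show ?thesis using False \<open>t \<noteq> 0\<close> by simp
    next
      case True
      have pt: "(norm (sqrt t *\<^sub>R z))\<^sup>2 < t \<longleftrightarrow> z \<in> ball 0 1" for z :: 'a
        using True by (simp add: power_mult_distrib abs_square_less_1)
      have sq: "sqrt t ^ (2 * k) = t ^ k" using True by (simp add: power_mult)
      have "(\<integral>\<^sup>+z. Q z * (ennreal (exp (- t)) * (if (norm z)\<^sup>2 < t then 1 else 0)) \<partial>lborel)
         = ennreal (\<bar>sqrt t\<bar> ^ DIM('a)) * (\<integral>\<^sup>+z. Q (0 + sqrt t *\<^sub>R z) * (ennreal (exp (- t)) * (if (norm (0 + sqrt t *\<^sub>R z))\<^sup>2 < t then 1 else 0)) \<partial>lborel)"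
        using True by (intro nn_integral_lborel_scale) auto
      also have "\<dots> = ennreal (\<bar>sqrt t\<bar> ^ DIM('a)) * (\<integral>\<^sup>+z. ennreal (t ^ k * exp (- t)) * (Q z * indicator (ball 0 1) z) \<partial>lborel)"
        unfolding add_0_left pt using True sq
        by (intro arg_cong[where f = "\<lambda>x. ennreal (\<bar>sqrt t\<bar> ^ DIM('a)) * x"] nn_integral_cong)
           (simp add: hom indicator_def ennreal_mult' mult_ac)
      also have "\<dots> = ennreal (\<bar>sqrt t\<bar> ^ DIM('a)) * ennreal (t ^ k * exp (- t)) * M"
        unfolding M_def mult.assoc by (subst nn_integral_cmult) (simp_all add: Qm)
      also have "\<bar>sqrt t\<bar> ^ DIM('a) = t ^ n" using True by (simp add: dim power_mult)
      also have "ennreal (t ^ n) * ennreal (t ^ k * exp (- t)) = ennreal (indicator {0..} t * t powr (real (n+k+1) - 1) / exp t)"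
        using True by (simp add: ennreal_mult'[symmetric] powr_realpow[symmetric] powr_add exp_minus field_simps)
      finally show ?thesis .
    qed
  qed
  also have "\<dots> = ennreal (fact (n + k)) * M"
    by (subst nn_integral_multc) (auto simp: gam[simplified])
  finally show ?thesis by (simp add: M_def)
qed

section \<open>The Hermitian form and moments of the unit ball\<close>

definition herm :: "complex^'n \<Rightarrow> complex^'n \<Rightarrow> complex"
  where "herm z x = (\<Sum>i\<in>UNIV. z $ i * cnj (x $ i))"

lemma herm_add_left: "herm (y + z) x = herm y x + herm z x"
  and herm_diff_left: "herm (y - z) x = herm y x - herm z x"
  and herm_scale_left: "herm (c *s z) x = c * herm z x"
  and herm_scaleR_left: "herm (r *\<^sub>R z) x = r *\<^sub>R herm z x"
  and herm_zero_left [simp]: "herm 0 x = 0"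
  and herm_zero_right [simp]: "herm z 0 = 0"
  by (simp_all add: herm_def sum.distrib sum_subtractf sum_distrib_left scaleR_right.sum algebra_simps)

lemma cnj_herm: "cnj (herm z x) = herm x z"
  by (simp add: herm_def mult.commute)

lemma herm_add_right: "herm x (y + z) = herm x y + herm x z"
  and herm_diff_right: "herm x (y - z) = herm x y - herm x z"
  and herm_scale_right: "herm x (c *s z) = cnj c * herm x z"
  and herm_scaleR_right: "herm x (r *\<^sub>R z) = r *\<^sub>R herm x z"
  by (simp_all add: herm_def sum.distrib sum_subtractf sum_distrib_left scaleR_right.sum algebra_simps)

lemma Re_herm: "Re (herm z x) = z \<bullet> x"
  by (simp add: herm_def inner_vec_def inner_complex_def)

lemma herm_self: "herm z z = complex_of_real ((norm z)\<^sup>2)"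
  by (simp add: herm_def norm_vec_def L2_set_def sum_nonneg complex_norm_square[symmetric] del: of_real_power)

lemma norm_vector_scalar_mult: "norm (c *s z) = cmod c * norm (z :: complex^'n)"
  by (simp add: norm_vec_def L2_set_def norm_mult power_mult_distrib sum_distrib_left[symmetric] real_sqrt_mult)

lemma norm_herm_le: "cmod (herm z x) \<le> norm z * norm x"
proof (cases "herm z x = 0")
  case False
  define c where "c = cnj (herm z x) / cmod (herm z x)"
  have "cmod c = 1" using False by (simp add: c_def norm_divide)
  have "cmod (herm z x) = Re (herm (c *s z) x)"
    using False by (simp add: herm_scale_left c_def mult.commute[of "cnj _"] complex_norm_square[symmetric] power2_eq_square)
  also have "\<dots> \<le> norm (c *s z) * norm x" unfolding Re_herm by (rule norm_cauchy_schwarz)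
  finally show ?thesis using \<open>cmod c = 1\<close> by (simp add: norm_vector_scalar_mult)
qed simp

lemma continuous_on_herm [continuous_intros]:
  "continuous_on S f \<Longrightarrow> continuous_on S g \<Longrightarrow> continuous_on S (\<lambda>x. herm (f x) (g x))"
  unfolding herm_def by (intro continuous_intros)

lemma measurable_herm [measurable]: "(\<lambda>z. herm z x) \<in> borel_measurable borel"
  by (intro borel_measurable_continuous_onI continuous_intros)

lemma measurable_vec_nth_complex [measurable]: "(\<lambda>z::complex^'n. z $ i) \<in> borel_measurable borel"
  by (intro borel_measurable_continuous_onI continuous_intros)

lemma measurable_ball [measurable]: "ball (x :: 'a::metric_space) r \<in> sets borel"
  by simp

lemma linear_vector_scalar_mult: "linear (\<lambda>z::complex^'n. c *s z)"
  by (rule linearI) (auto simp: vec_eq_iff algebra_simps)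

lemma norm_add_square_herm:
  "(norm (x + y :: complex^'n))\<^sup>2 = (norm x)\<^sup>2 + (norm y)\<^sup>2 + 2 * Re (herm x y)"
  unfolding Re_herm power2_norm_eq_inner by (simp add: inner_add inner_commute)

lemma norm_diff_square_herm:
  "(norm (x - y :: complex^'n))\<^sup>2 = (norm x)\<^sup>2 + (norm y)\<^sup>2 - 2 * Re (herm x y)"
  unfolding Re_herm power2_norm_eq_inner by (simp add: inner_diff inner_commute)

text \<open>A complex Householder reflection along e - f. It exchanges the unit vectors e and f only
  if <e,f> is real, so f is the coordinate vector multiplied by the phase \<open>c\<close> of the
  i-th coordinate of e. Only moduli are claimed, so this phase is harmless.\<close>

lemma ex_isometry_to_coordinate:
  fixes e :: "complex^'n" and i :: 'n
  assumes "norm e = 1"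
  shows "\<exists>U. linear U \<and> (\<forall>z. norm (U z) = norm z) \<and> (\<forall>z. cmod (herm z e) = cmod (U z $ i))"
proof -
  define c where "c = (if e $ i = 0 then 1 else sgn (e $ i))"
  have c: "cmod c = 1" "e $ i * cnj c = of_real (cmod (e $ i))"
    by (auto simp: c_def norm_sgn) (auto simp: sgn_eq complex_norm_square[symmetric] power2_eq_square)
  define f where "f = c *s axis i 1"
  have hf: "herm z f = z $ i * cnj c" for z
    by (simp add: f_def herm_scale_right) (simp add: herm_def axis_def if_distrib cong: if_cong)
  have nf: "norm f = 1" by (simp add: f_def norm_vector_scalar_mult c)
  define u where "u = e - f"
  have nu: "(norm u)\<^sup>2 = 2 - 2 * cmod (e $ i)"
    unfolding u_def norm_diff_square_herm by (simp add: assms nf hf c)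
  have hu: "herm u f = of_real (cmod (e $ i) - 1)"
    by (simp add: u_def herm_diff_left herm_self nf) (simp add: hf c)
  show ?thesis
  proof (cases "u = 0")
    case True
    then have "e = f" by (simp add: u_def)
    show ?thesis
      by (rule exI[of _ "\<lambda>z. z"]) (auto simp: \<open>e = f\<close> hf norm_mult c linear_iff)
  next
    case False
    define U where "U z = z - (2 * herm z u / of_real ((norm u)\<^sup>2)) *s u" for z
    have "linear U" unfolding U_def
      by (rule linearI) (auto simp: vec_eq_iff herm_add_left herm_scaleR_left add_divide_distrib scaleR_conv_of_real[where 'a = complex] algebra_simps)
    moreover have "norm (U z) = norm z" for z
    proof -
      have "(norm (U z))\<^sup>2 = (norm z)\<^sup>2"
      proof -
        have h: "herm z u * cnj (herm z u) = of_real ((cmod (herm z u))\<^sup>2)"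
          by (simp add: complex_norm_square[symmetric])
        have "herm z ((2 * herm z u / of_real ((norm u)\<^sup>2)) *s u) = of_real (2 * (cmod (herm z u))\<^sup>2 / (norm u)\<^sup>2)"
          unfolding herm_scale_right using h by (simp add: mult.commute)
        then have r: "Re (herm z ((2 * herm z u / of_real ((norm u)\<^sup>2)) *s u)) = 2 * (cmod (herm z u))\<^sup>2 / (norm u)\<^sup>2"
          by (metis Re_complex_of_real)
        have "norm u > 0" using False by simp
        then show ?thesis
          unfolding U_def norm_diff_square_herm r norm_vector_scalar_mult
          by (simp add: norm_mult norm_divide power_mult_distrib power_divide field_simps power2_eq_square)
      qed
      then show ?thesis by (simp add: power2_eq_iff_nonneg)
    qed
    moreover have "cmod (herm z e) = cmod (U z $ i)" for z
    proof -
      have n0: "2 - 2 * cmod (e $ i) \<noteq> 0" using False nu by (metis norm_eq_zero power_eq_0_iff)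
      have "herm (U z) f = herm z f - (2 * herm z u / of_real ((norm u)\<^sup>2)) * herm u f"
        by (simp add: U_def herm_diff_left herm_scale_left)
      also have "(2 * herm z u / of_real ((norm u)\<^sup>2)) * herm u f 
          = herm z u * of_real (2 * (cmod (e $ i) - 1) / (2 - 2 * cmod (e $ i)))"
        unfolding nu hu by simp
      also have "2 * (cmod (e $ i) - 1) / (2 - 2 * cmod (e $ i)) = -1"
        using n0 by (simp add: field_simps)
      finally have "herm (U z) f = herm z e" by (simp add: u_def herm_diff_right)
      then show ?thesis using hf[of "U z"] by (metis c(1) complex_mod_cnj mult.right_neutral norm_mult)
    qed
    ultimately show ?thesis by blast
  qed
qed

section \<open>Even moments of a linear coordinate over the unit ball\<close>

lemma DIM_complex_vec: "DIM(complex^'n) = 2 * CARD('n)"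
  by simp

lemma nn_integral_gaussian_stretched:
  fixes s :: real and i :: "'n::finite"
  assumes "0 \<le> s" "s < 1"
  shows "(\<integral>\<^sup>+z. ennreal (exp (s * (cmod (z $ i))\<^sup>2 - (norm z)\<^sup>2)) \<partial>(lborel :: (complex^'n) measure))
       = ennreal (1 / (1 - s)) * (\<integral>\<^sup>+z. ennreal (exp (- (norm z)\<^sup>2)) \<partial>(lborel :: (complex^'n) measure))"
proof -
  define b where "b = 1 / sqrt (1 - s)"
  have b: "b > 0" "b\<^sup>2 = 1 / (1 - s)" using assms by (auto simp: b_def power_divide)
  \<comment> \<open>Stretching one complex coordinate by \<open>b\<close> stretches two real
    directions, so the Jacobian is b^2 = 1/(1 - s). The value of \<open>b\<close> is the one that
    turns s|z_i|^2 - |z|^2 into -|z|^2.\<close>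
  define c :: "complex^'n \<Rightarrow> real" where "c v = (if v = axis i 1 \<or> v = axis i \<i> then b else 1)" for v
  define T :: "complex^'n \<Rightarrow> complex^'n" where "T x = (\<chi> j. if j = i then of_real b * x $ j else x $ j)" for x
  have cne: "c v \<noteq> 0" for v using b by (auto simp: c_def)
  have Basis: "(Basis :: (complex^'n) set) = (\<lambda>j. axis j 1) ` UNIV \<union> (\<lambda>j. axis j \<i>) ` UNIV"
    by (auto simp: Basis_vec_def Basis_complex_def)
  have "linear T" unfolding T_def by (rule linearI) (auto simp: vec_eq_iff algebra_simps)
  have Tb: "T v = c v *\<^sub>R v" if v0: "v \<in> Basis" for v
  proof -
    obtain j u where v: "v = axis j u" "u = 1 \<or> u = \<i>" using v0 unfolding Basis by blast
    have cv: "c v = (if j = i then b else 1)" using v by (auto simp: c_def axis_eq_axis)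
    show ?thesis
      unfolding cv unfolding v(1) by (auto simp: T_def vec_eq_iff axis_def scaleR_conv_of_real[where 'a = complex])
  qed
  have T: "0 + (\<Sum>j\<in>Basis. (c j * (x \<bullet> j)) *\<^sub>R j) = T x" for x
  proof -
    have "T x = T (\<Sum>j\<in>Basis. (x \<bullet> j) *\<^sub>R j)" by (simp add: euclidean_representation)
    also have "\<dots> = (\<Sum>j\<in>Basis. (x \<bullet> j) *\<^sub>R T j)" 
      using \<open>linear T\<close> by (simp add: linear_sum linear_cmul)
    also have "\<dots> = (\<Sum>j\<in>Basis. (c j * (x \<bullet> j)) *\<^sub>R j)"
      by (intro sum.cong refl) (simp add: Tb mult.commute)
    finally show ?thesis by simp
  qed
  have [measurable]: "T \<in> borel_measurable borel"
    by (intro borel_measurable_continuous_onI linear_continuous_on linear_linear[THEN iffD2] \<open>linear T\<close>)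
  have ne: "axis i 1 \<noteq> (axis i \<i> :: complex^'n)" by (simp add: axis_eq_axis)
  have "(\<Prod>j\<in>Basis. \<bar>c j\<bar>) = (\<Prod>j\<in>{axis i 1, axis i \<i> :: complex^'n}. \<bar>c j\<bar>)"
    by (rule prod.mono_neutral_right) (auto simp: Basis c_def)
  also have "\<dots> = 1 / (1 - s)" using b ne by (simp add: c_def power2_eq_square)
  finally have pr: "(\<Prod>j\<in>Basis. \<bar>c j\<bar>) = 1 / (1 - s)" .
  have norm: "s * (cmod (T z $ i))\<^sup>2 - (norm (T z))\<^sup>2 = - (norm z)\<^sup>2" for z
  proof -
    have n: "(norm y)\<^sup>2 = (cmod (y $ i))\<^sup>2 + (\<Sum>j\<in>UNIV - {i}. (cmod (y $ j))\<^sup>2)" for y :: "complex^'n"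
      by (simp add: norm_vec_def L2_set_def sum_nonneg sum.remove[of UNIV i])
    have "(\<Sum>j\<in>UNIV - {i}. (cmod (T z $ j))\<^sup>2) = (\<Sum>j\<in>UNIV - {i}. (cmod (z $ j))\<^sup>2)"
      by (intro sum.cong) (auto simp: T_def)
    moreover have "(cmod (T z $ i))\<^sup>2 = (cmod (z $ i))\<^sup>2 / (1 - s)"
      using b by (simp add: T_def norm_mult power_mult_distrib)
    ultimately show ?thesis unfolding n[of "T z"] n[of z] using assms by (simp add: field_simps)
  qed
  show ?thesis
    by (subst lborel_affine_euclidean[where c = c and t = 0, OF cne], subst T)
       (simp add: pr nn_integral_density nn_integral_distr norm nn_integral_cmult)
qed

text \<open>A generating function: expanding exp(s|z_i|^2) in the stretched Gaussian and applying
  the layer cake to each term gives the sum of (n+k)!/k! m_k s^k as pi^n/(1 - s) on [0,1). Hence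
  every coefficient equals pi^n; the volume of the ball supplies n! m_0 = pi^n.\<close>

lemma nn_integral_coordinate_moment:
  fixes i :: "'n::finite"
  shows "(\<integral>\<^sup>+z. ennreal (cmod (z $ i) ^ (2 * k)) * indicator (ball 0 1) z \<partial>(lborel :: (complex^'n) measure))
       = ennreal (pi ^ CARD('n) * fact k / fact (CARD('n) + k))"
proof -
  let ?n = "CARD('n)"
  define M where "M k = (\<integral>\<^sup>+z. ennreal (cmod (z $ i) ^ (2 * k)) * indicator (ball 0 1) z \<partial>(lborel :: (complex^'n) measure))" for k
  have coord: "cmod (z $ i) \<le> norm z" for z :: "complex^'n" by (rule Finite_Cartesian_Product.norm_nth_le)
  have M_le: "M k \<le> emeasure lborel (ball (0::complex^'n) 1)" for k
  proof -
    have "M k \<le> (\<integral>\<^sup>+z. indicator (ball 0 1) z \<partial>(lborel :: (complex^'n) measure))"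
      unfolding M_def
      by (intro nn_integral_mono) (auto simp: indicator_def intro!: power_le_one order_trans[OF coord])
    then show ?thesis by simp
  qed
  then have "M k \<noteq> \<infinity>" for k
    using emeasure_lborel_ball_finite[of "0::complex^'n" 1] by (metis infinity_ennreal_def leD)
  define m where "m k = enn2real (M k)" for k
  have m: "M k = ennreal (m k)" "m k \<ge> 0" for k
    using \<open>M k \<noteq> \<infinity>\<close> by (simp_all add: m_def ennreal_enn2real_if)
  have m0: "m 0 = pi ^ ?n / fact ?n"
    using unit_ball_vol_even[of ?n]
    by (simp add: m_def M_def emeasure_ball DIM_complex_vec unit_ball_vol_nonneg mult.commute)
  have G: "(\<integral>\<^sup>+z. ennreal (cmod (z $ i) ^ (2 * k)) * ennreal (exp (- (norm z)\<^sup>2)) \<partial>(lborel :: (complex^'n) measure))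
        = ennreal (fact (?n + k) * m k)" for k
  proof -
    have "(\<integral>\<^sup>+z. ennreal (cmod (z $ i) ^ (2 * k)) * ennreal (exp (- (norm z)\<^sup>2)) \<partial>(lborel :: (complex^'n) measure))
        = ennreal (fact (?n + k)) * M k"
      unfolding M_def
      by (rule nn_integral_gaussian_layer_cake)
         (auto simp: power_mult_distrib ennreal_mult DIM_complex_vec)
    then show ?thesis by (simp add: m ennreal_mult)
  qed
  have ser: "(\<lambda>k. fact (?n + k) / fact k * m k * s ^ k) sums (pi ^ ?n / (1 - s))" if s: "0 \<le> s" "s < 1" for s
  proof -
    have "ennreal (pi ^ ?n / (1 - s)) = (\<integral>\<^sup>+z. ennreal (exp (s * (cmod (z $ i))\<^sup>2 - (norm z)\<^sup>2)) \<partial>(lborel :: (complex^'n) measure))"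
      using s G[of 0] by (simp add: nn_integral_gaussian_stretched m0 ennreal_mult'[symmetric])
    also have "\<dots> = (\<integral>\<^sup>+z. (\<Sum>k. ennreal (s ^ k / fact k) * (ennreal (cmod (z $ i) ^ (2 * k)) * ennreal (exp (- (norm z)\<^sup>2)))) \<partial>(lborel :: (complex^'n) measure))"
    proof (rule nn_integral_cong)
      fix z :: "complex^'n"
      have "(\<lambda>k. (s * (cmod (z $ i))\<^sup>2) ^ k /\<^sub>R fact k) sums exp (s * (cmod (z $ i))\<^sup>2)"
        by (rule exp_converges)
      then have "(\<lambda>k. (s * (cmod (z $ i))\<^sup>2) ^ k / fact k * exp (- (norm z)\<^sup>2)) sums (exp (s * (cmod (z $ i))\<^sup>2) * exp (- (norm z)\<^sup>2))"
        by (intro sums_mult2) (simp add: divide_inverse mult.commute)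
      moreover have "cmod (z $ i) ^ (2 * k) = ((cmod (z $ i))\<^sup>2) ^ k" for k by (rule power_mult)
      ultimately have "(\<lambda>k. s ^ k / fact k * (cmod (z $ i) ^ (2 * k) * exp (- (norm z)\<^sup>2))) sums exp (s * (cmod (z $ i))\<^sup>2 - (norm z)\<^sup>2)"
        by (simp add: exp_diff exp_minus divide_inverse power_mult_distrib mult_ac)
      then have "(\<Sum>k. ennreal (s ^ k / fact k * (cmod (z $ i) ^ (2 * k) * exp (- (norm z)\<^sup>2)))) = ennreal (exp (s * (cmod (z $ i))\<^sup>2 - (norm z)\<^sup>2))"
        using s by (intro suminf_ennreal_eq) auto
      then show "ennreal (exp (s * (cmod (z $ i))\<^sup>2 - (norm z)\<^sup>2)) = (\<Sum>k. ennreal (s ^ k / fact k) * (ennreal (cmod (z $ i) ^ (2 * k)) * ennreal (exp (- (norm z)\<^sup>2))))"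
        using s by (simp add: ennreal_mult'[symmetric] mult.assoc)
    qed
    also have "\<dots> = (\<Sum>k. ennreal (fact (?n + k) / fact k * m k * s ^ k))"
    proof (subst nn_integral_suminf)
      have "(\<integral>\<^sup>+z. ennreal (s ^ k / fact k) * (ennreal (cmod (z $ i) ^ (2 * k)) * ennreal (exp (- (norm z)\<^sup>2))) \<partial>(lborel :: (complex^'n) measure))
          = ennreal (s ^ k / fact k) * ennreal (fact (?n + k) * m k)" for k
        unfolding G[symmetric] by (rule nn_integral_cmult) measurable
      moreover have "ennreal (s ^ k / fact k) * ennreal (fact (?n + k) * m k) = ennreal (fact (?n + k) / fact k * m k * s ^ k)" for k
        using s by (simp add: ennreal_mult'[symmetric] m mult_ac)
      ultimately show "(\<Sum>k. \<integral>\<^sup>+z. ennreal (s ^ k / fact k) * (ennreal (cmod (z $ i) ^ (2 * k)) * ennreal (exp (- (norm z)\<^sup>2))) \<partial>(lborel :: (complex^'n) measure))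
          = (\<Sum>k. ennreal (fact (?n + k) / fact k * m k * s ^ k))" by simp
    qed measurable
    finally have eq: "(\<Sum>k. ennreal (fact (?n + k) / fact k * m k * s ^ k)) = ennreal (pi ^ ?n / (1 - s))" by simp
    have nn: "0 \<le> fact (?n + k) / fact k * m k * s ^ k" for k using s m by simp
    have sm: "summable (\<lambda>k. fact (?n + k) / fact k * m k * s ^ k)"
      by (rule summable_suminf_not_top[OF nn]) (simp only: eq ennreal_neq_top not_False_eq_True)
    have "(\<Sum>k. fact (?n + k) / fact k * m k * s ^ k) = pi ^ ?n / (1 - s)"
      using eq suminf_ennreal2[OF nn sm] s suminf_nonneg[OF sm nn] by simp
    then show ?thesis using summable_sums[OF sm] by simp
  qed
  \<comment> \<open>Comparison of coefficients: the difference of the two series vanishes on a real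
    interval starting at 0, whereas a power series with a nonzero coefficient has at most an
    isolated zero there.\<close>
  have "fact (?n + k) / fact k * m k = pi ^ ?n" for k
  proof (rule ccontr)
    assume ne: "fact (?n + k) / fact k * m k \<noteq> pi ^ ?n"
    define a where "a k = complex_of_real (fact (?n + k) / fact k * m k - pi ^ ?n)" for k
    define f where "f z = (\<Sum>k. a k * z ^ k)" for z
    have a_ne: "a k \<noteq> 0" using ne by (simp add: a_def del: of_real_diff)
    have a0: "a 0 = 0" by (simp add: a_def m0)
    have z: "(\<lambda>k. a k * of_real s ^ k) sums 0" if "0 \<le> s" "s < 1" for s
    proof -
      have "(\<lambda>k. pi ^ ?n * s ^ k) sums (pi ^ ?n * (1 / (1 - s)))"
        using that by (intro sums_mult geometric_sums) auto
      from sums_diff[OF ser[OF that] this] 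
      have "(\<lambda>k. complex_of_real ((fact (?n + k) / fact k * m k - pi ^ ?n) * s ^ k)) sums of_real 0"
        unfolding sums_of_real_iff by (simp add: algebra_simps)
      then show ?thesis by (simp add: a_def)
    qed
    have conv: "(\<lambda>k. a k * (z - 0) ^ k) sums f z" if "norm z < 1/2" for z
    proof -
      have "summable (\<lambda>k. a k * z ^ k)"
        by (rule powser_inside[of _ "of_real (1/2)"]) (use z[of "1/2"] that in \<open>auto simp: sums_iff norm_divide\<close>)
      then show ?thesis by (simp add: f_def summable_sums)
    qed
    have "k > 0" using a_ne a0 by (cases k) auto
    obtain s where s: "s > 0" "\<And>z. z \<in> cball 0 s - {0} \<Longrightarrow> f z \<noteq> 0"
      using powser_0_nonzero[of "1/2" 0 a f k, OF _ conv _ a_ne \<open>k > 0\<close>] a0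
      by (auto simp: dist_norm f_def)
    define t where "t = min s (1/2)"
    have "0 \<le> t" "t < 1" using s by (auto simp: t_def)
    then have "f (of_real t) = 0" using z[of t] by (simp add: f_def sums_iff)
    moreover have "of_real t \<in> cball 0 s - {0::complex}" using s by (auto simp: t_def)
    ultimately show False using s(2) by blast
  qed
  from this[of k] have "m k = pi ^ ?n * fact k / fact (?n + k)"
    by (simp add: field_simps)
  then show ?thesis using m(1)[of k] by (simp add: M_def)
qed

lemma nn_integral_direction_moment:
  fixes e :: "complex^'n"
  assumes "norm e = 1"
  shows "(\<integral>\<^sup>+z. ennreal (cmod (herm z e) ^ (2 * k)) * indicator (ball 0 1) z \<partial>lborel)
       = ennreal (pi ^ CARD('n) * fact k / fact (CARD('n) + k))"
proof -
  fix i :: 'n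
  obtain U where U: "linear U" "\<And>z. norm (U z) = norm z" "\<And>z. cmod (herm z e) = cmod (U z $ i)"
    using ex_isometry_to_coordinate[OF assms, of i] by blast
  have "(\<integral>\<^sup>+z. ennreal (cmod (herm z e) ^ (2 * k)) * indicator (ball 0 1) z \<partial>lborel)
      = (\<integral>\<^sup>+z. ennreal (cmod (U z $ i) ^ (2 * k)) * indicator (ball 0 1) (U z) \<partial>lborel)"
    by (simp add: U indicator_def)
  also have "\<dots> = (\<integral>\<^sup>+z. ennreal (cmod (z $ i) ^ (2 * k)) * indicator (ball 0 1) z \<partial>(lborel :: (complex^'n) measure))"
    by (rule nn_integral_lborel_isometry[OF U(1,2), of "\<lambda>z. ennreal (cmod (z $ i) ^ (2 * k)) * indicator (ball 0 1) z"]) measurable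
  finally show ?thesis by (simp add: nn_integral_coordinate_moment)
qed

section \<open>Holomorphic functions of several variables\<close>

text \<open>Differentiability with a complex linear derivative. It follows from the power series of
  \<open>analytic_in\<close>, survives sums, affine substitutions and restriction to complex lines
  without handling multi-indices, and on lines the one-variable theory takes over.\<close>

definition holo_on :: "(complex^'n \<Rightarrow> complex) \<Rightarrow> (complex^'n) set \<Rightarrow> bool"
  where "holo_on f S \<longleftrightarrow> (\<forall>a\<in>S. \<exists>l. (f has_derivative (\<lambda>v. \<Sum>i\<in>UNIV. l i * v $ i)) (at a))"

lemma finite_exponents_of_degree_le_1: "{k :: 'n::finite \<Rightarrow> nat. sum k UNIV \<le> 1} = insert (\<lambda>_. 0) (range (\<lambda>i j. if j = i then 1 else 0))"
proof (intro equalityI subsetI)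
  fix k :: "'n \<Rightarrow> nat" assume "k \<in> {k. sum k UNIV \<le> 1}"
  then consider "sum k UNIV = 0" | "sum k UNIV = Suc 0" by (metis One_nat_def le_SucE le_zero_eq mem_Collect_eq)
  then show "k \<in> insert (\<lambda>_. 0) (range (\<lambda>i j. if j = i then 1 else 0))"
  proof cases
    case 1 then show ?thesis by (auto simp: fun_eq_iff)
  next
    case 2
    then obtain i where "k i = 1" "\<forall>j. i \<noteq> j \<longrightarrow> k j = 0" by (auto simp: sum_eq_Suc0_iff)
    then have "k = (\<lambda>j. if j = i then 1 else 0)" by (auto simp: fun_eq_iff)
    then show ?thesis by blast
  qed
qed auto

text \<open>Absolute convergence at the point \<open>p\<close> with all coordinates
  \<open>\<rho>\<close> yields a summable majorant \<open>w\<close>. For |v| < \<rho> a term of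
  degree at least 2 is bounded by (|v|/\<rho>)^2 times its majorant, so the remainder after the
  finitely many terms of degree at most 1 is quadratic in |v|.\<close>

lemma analytic_in_imp_holo_on:
  fixes f :: "complex^'n \<Rightarrow> complex"
  assumes "analytic_in f S"
  shows "holo_on f S"
  unfolding holo_on_def
proof
  fix a assume "a \<in> S"
  then obtain r c where r: "r > 0" and
    c: "\<And>z. z \<in> ball a r \<Longrightarrow> ((\<lambda>k. c k * (\<Prod>i\<in>UNIV. (z $ i - a $ i) ^ k i)) has_sum f z) UNIV"
    using assms unfolding analytic_in_def by metis
  define t where "t v k = c k * (\<Prod>i\<in>UNIV. (v $ i) ^ k i)" for v :: "complex^'n" and k
  have hs: "(t v has_sum f (a + v)) UNIV" if "norm v < r" for v
    using c[of "a + v"] that by (simp add: t_def[abs_def] dist_norm)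
  \<comment> \<open>The divisor n + 1, not n: |p| is estimated by the sum of its n coordinates, and
    n\<rho> < r must be strict.\<close>
  define \<rho> where "\<rho> = r / (CARD('n) + 1)"
  have \<rho>: "\<rho> > 0" "\<rho> \<le> r" using r by (auto simp: \<rho>_def field_simps)
  define p :: "complex^'n" where "p = (\<chi> i. of_real \<rho>)"
  have "norm p \<le> (\<Sum>i\<in>UNIV. cmod (p $ i))" 
    unfolding norm_vec_def by (rule L2_set_le_sum) simp
  also have "\<dots> < r" using r \<rho> by (simp add: p_def) (simp add: \<rho>_def field_simps)
  finally have "(t p) summable_on UNIV" using hs by (auto simp: summable_on_def)
  then have "(\<lambda>k. norm (t p k)) summable_on UNIV"
    by (rule summable_on_iff_abs_summable_on_complex[THEN iffD1])
  define w where "w k = cmod (c k) * \<rho> ^ sum k UNIV" for k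
  have tp: "norm (t p k) = w k" for k
    using \<rho> by (simp add: t_def w_def p_def norm_mult prod_norm[symmetric] norm_power power_sum)
  have w: "w summable_on UNIV" using \<open>(\<lambda>k. norm (t p k)) summable_on UNIV\<close> by (simp add: tp)
  have w0: "w k \<ge> 0" for k using \<rho> by (simp add: w_def)
  define L where "L = {k :: 'n \<Rightarrow> nat. sum k UNIV \<le> 1}"
  have fin: "finite L" unfolding L_def finite_exponents_of_degree_le_1 by simp
  define l where "l i = c (\<lambda>j. if j = i then 1 else 0)" for i
  have inj: "inj (\<lambda>i j. if j = i then 1 else 0 :: nat)"
    by (rule injI) (metis zero_neq_one)
  have lin: "sum (t v) L = c (\<lambda>_. 0) + (\<Sum>i\<in>UNIV. l i * v $ i)" for v
  proof -
    have "(\<lambda>_. 0) \<notin> range (\<lambda>(i::'n) j. if j = i then 1 else 0 :: nat)"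
    proof
      assume "(\<lambda>_. 0) \<in> range (\<lambda>(i::'n) j. if j = i then 1 else 0 :: nat)"
      then obtain i :: 'n where "(\<lambda>_. 0) = (\<lambda>j. if j = i then 1 else 0 :: nat)" by blast
      from fun_cong[OF this, of i] show False by simp
    qed
    then have "sum (t v) L = t v (\<lambda>_. 0) + sum (t v) (range (\<lambda>i j. if j = i then 1 else 0))"
      unfolding L_def finite_exponents_of_degree_le_1 by (subst sum.insert) auto
    also have "sum (t v) (range (\<lambda>i j. if j = i then 1 else 0)) = (\<Sum>i\<in>UNIV. l i * v $ i)"
      unfolding sum.reindex[OF inj] o_def t_def l_def
      by (intro sum.cong refl arg_cong2[where f = "(*)"]) (simp add: if_distrib cong: if_cong)
    finally show ?thesis by (simp add: t_def)
  qed
  define Z where "Z = infsum w UNIV"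
  have rem: "norm (f (a + v) - (c (\<lambda>_. 0) + (\<Sum>i\<in>UNIV. l i * v $ i))) \<le> Z / \<rho>\<^sup>2 * (norm v)\<^sup>2" if v: "norm v < \<rho>" for v
  proof -
    have "(t v has_sum (f (a + v) - sum (t v) L)) (UNIV - L)"
      using hs[of v] v \<rho> fin by (intro has_sum_Diff) (auto simp: has_sum_finite_iff)
    then have eq: "f (a + v) - sum (t v) L = infsum (t v) (UNIV - L)" and sm: "t v summable_on (UNIV - L)"
      by (auto simp: infsumI has_sum_imp_summable)
    define q where "q = norm v / \<rho>"
    have q: "0 \<le> q" "q \<le> 1" using v \<rho> by (auto simp: q_def)
    have b: "norm (t v k) \<le> q\<^sup>2 * w k" if "k \<in> UNIV - L" for k
    proof -
      have k2: "2 \<le> sum k UNIV" using that by (auto simp: L_def)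
      have "norm (t v k) = cmod (c k) * (\<Prod>i\<in>UNIV. cmod (v $ i) ^ k i)"
        by (simp add: t_def norm_mult prod_norm[symmetric] norm_power)
      also have "\<dots> \<le> cmod (c k) * (\<Prod>i\<in>UNIV. norm v ^ k i)"
        by (intro mult_left_mono prod_mono conjI power_mono Finite_Cartesian_Product.norm_nth_le) auto
      also have "\<dots> = q ^ sum k UNIV * w k"
        using \<rho> by (simp add: power_sum[symmetric] q_def w_def power_divide)
      also have "\<dots> \<le> q\<^sup>2 * w k"
        by (intro mult_right_mono power_decreasing w0 q k2)
      finally show ?thesis .
    qed
    have ws: "w summable_on (UNIV - L)" by (rule summable_on_subset_banach[OF w]) simp
    have "norm (infsum (t v) (UNIV - L)) \<le> infsum (\<lambda>k. norm (t v k)) (UNIV - L)"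
      by (rule norm_infsum_bound[OF summable_on_iff_abs_summable_on_complex[THEN iffD1, OF sm]])
    also have "\<dots> \<le> infsum (\<lambda>k. q\<^sup>2 * w k) (UNIV - L)"
      by (intro infsum_mono summable_on_iff_abs_summable_on_complex[THEN iffD1, OF sm] summable_on_cmult_right ws b)
    also have "\<dots> = q\<^sup>2 * infsum w (UNIV - L)" by (rule infsum_cmult_right') 
    also have "\<dots> \<le> q\<^sup>2 * Z" unfolding Z_def
      by (intro mult_left_mono infsum_mono_neutral ws w) (auto simp: w0)
    finally show ?thesis unfolding eq[symmetric] lin by (simp add: q_def power_divide mult_ac)
  qed
  have f0: "f a = c (\<lambda>_. 0)" using rem[of 0] \<rho> by simp
  have "(f has_derivative (\<lambda>v. \<Sum>i\<in>UNIV. l i * v $ i)) (at a)"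
    unfolding has_derivative_at
  proof
    show "bounded_linear (\<lambda>v. \<Sum>i\<in>UNIV. l i * v $ i)"
      by (intro bounded_linear_sum bounded_linear_compose[OF bounded_linear_mult_right] bounded_linear_vec_nth)
    show "(\<lambda>v. norm (f (a + v) - f a - (\<Sum>i\<in>UNIV. l i * v $ i)) / norm v) \<midarrow>0\<rightarrow> 0"
    proof (rule Lim_null_comparison)
      show "((\<lambda>v. Z / \<rho>\<^sup>2 * norm v) \<longlongrightarrow> 0) (at (0 :: complex^'n))"
        by (rule tendsto_mult_right_zero) (rule tendsto_norm_zero[OF tendsto_ident_at])
      show "\<forall>\<^sub>F v in at 0. norm (norm (f (a + v) - f a - (\<Sum>i\<in>UNIV. l i * v $ i)) / norm v) \<le> Z / \<rho>\<^sup>2 * norm v"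
        unfolding eventually_at
      proof (intro exI[of _ \<rho>] conjI ballI impI)
        fix v :: "complex^'n" assume v: "v \<noteq> 0 \<and> dist v 0 < \<rho>"
        then have "norm (f (a + v) - f a - (\<Sum>i\<in>UNIV. l i * v $ i)) \<le> (Z / \<rho>\<^sup>2 * norm v) * norm v"
          using rem[of v] by (simp add: f0 diff_diff_eq power2_eq_square)
        then show "norm (norm (f (a + v) - f a - (\<Sum>i\<in>UNIV. l i * v $ i)) / norm v) \<le> Z / \<rho>\<^sup>2 * norm v"
          using v by (simp add: divide_le_eq)
      qed (use \<rho> in auto)
    qed
  qed
  then show "\<exists>l. (f has_derivative (\<lambda>v. \<Sum>i\<in>UNIV. l i * v $ i)) (at a)" by blast
qed

lemma holo_on_imp_continuous_on: "holo_on f S \<Longrightarrow> continuous_on S f"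
  unfolding holo_on_def
  by (meson continuous_at_imp_continuous_on has_derivative_continuous)

lemma holo_on_slice:
  fixes f :: "complex^'n \<Rightarrow> complex"
  assumes "holo_on f S" and "\<And>t. t \<in> A \<Longrightarrow> u + t *s v \<in> S"
  shows "(\<lambda>t. f (u + t *s v)) holomorphic_on A"
  unfolding holomorphic_on_def
proof
  fix t assume "t \<in> A"
  then obtain l where l: "(f has_derivative (\<lambda>v. \<Sum>i\<in>UNIV. l i * v $ i)) (at (u + t *s v))"
    using assms unfolding holo_on_def by blast
  have "linear (\<lambda>t. t *s v)" by (rule linearI) (auto simp: vec_eq_iff algebra_simps)
  then have "((\<lambda>t. u + t *s v) has_derivative (\<lambda>t. t *s v)) (at t)"
    using has_derivative_add[OF has_derivative_const linear_imp_has_derivative, of "\<lambda>t. t *s v" u "at t"] by simp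
  from diff_chain_at[OF this l]
  have "((\<lambda>t. f (u + t *s v)) has_derivative (\<lambda>t. (\<Sum>i\<in>UNIV. l i * v $ i) * t)) (at t)"
    by (simp add: o_def sum_distrib_left mult_ac)
  then have "((\<lambda>t. f (u + t *s v)) has_field_derivative (\<Sum>i\<in>UNIV. l i * v $ i)) (at t)"
    by (simp add: has_field_derivative_def)
  then show "(\<lambda>t. f (u + t *s v)) field_differentiable (at t within A)"
    by (meson field_differentiable_at_within field_differentiable_def)
qed

lemma holo_on_subset: "holo_on f S \<Longrightarrow> T \<subseteq> S \<Longrightarrow> holo_on f T"
  by (auto simp: holo_on_def)

lemma holo_on_affine:
  fixes f :: "complex^'n \<Rightarrow> complex"
  assumes "holo_on f S" and "\<And>z. z \<in> T \<Longrightarrow> w + r *\<^sub>R z \<in> S"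
  shows "holo_on (\<lambda>z. f (w + r *\<^sub>R z)) T"
  unfolding holo_on_def
proof
  fix z assume "z \<in> T"
  then obtain l where l: "(f has_derivative (\<lambda>v. \<Sum>i\<in>UNIV. l i * v $ i)) (at (w + r *\<^sub>R z))"
    using assms unfolding holo_on_def by blast
  have "((\<lambda>z. w + r *\<^sub>R z) has_derivative (\<lambda>z. r *\<^sub>R z)) (at z)"
    by (auto intro!: derivative_eq_intros)
  from diff_chain_at[OF this l]
  have "((\<lambda>z. f (w + r *\<^sub>R z)) has_derivative (\<lambda>v. \<Sum>i\<in>UNIV. (l i * of_real r) * v $ i)) (at z)"
    by (simp add: o_def scaleR_conv_of_real[where 'a = complex] mult.assoc)
  then show "\<exists>l. ((\<lambda>z. f (w + r *\<^sub>R z)) has_derivative (\<lambda>v. \<Sum>i\<in>UNIV. l i * v $ i)) (at z)"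
    by (rule exI[where x = "\<lambda>i. l i * of_real r"])
qed

lemma holo_on_herm_compose:
  assumes "\<And>z. z \<in> S \<Longrightarrow> h field_differentiable at (herm z x)"
  shows "holo_on (\<lambda>z. h (herm z x)) S"
  unfolding holo_on_def
proof
  fix z assume "z \<in> S"
  then obtain d where d: "(h has_field_derivative d) (at (herm z x))"
    using assms by (auto simp: field_differentiable_def)
  have "linear (\<lambda>z. herm z x)" by (rule linearI) (auto simp: herm_add_left herm_scaleR_left)
  then have "((\<lambda>z. herm z x) has_derivative (\<lambda>z. herm z x)) (at z)" by (rule linear_imp_has_derivative)
  from diff_chain_at[OF this d[unfolded has_field_derivative_def]]
  have "((\<lambda>z. h (herm z x)) has_derivative (\<lambda>v. \<Sum>i\<in>UNIV. (d * cnj (x $ i)) * v $ i)) (at z)"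
    by (simp add: o_def herm_def sum_distrib_left mult_ac)
  then show "\<exists>l. ((\<lambda>z. h (herm z x)) has_derivative (\<lambda>v. \<Sum>i\<in>UNIV. l i * v $ i)) (at z)"
    by (rule exI[where x = "\<lambda>i. d * cnj (x $ i)"])
qed

lemma holo_on_cmult: 
  assumes "holo_on f S" shows "holo_on (\<lambda>z. c * f z) S"
  unfolding holo_on_def
proof
  fix z assume "z \<in> S"
  then obtain l where "(f has_derivative (\<lambda>v. \<Sum>i\<in>UNIV. l i * v $ i)) (at z)"
    using assms unfolding holo_on_def by blast
  then have "((\<lambda>z. c * f z) has_derivative (\<lambda>v. \<Sum>i\<in>UNIV. (c * l i) * v $ i)) (at z)"
    using has_derivative_mult_right by (fastforce simp: sum_distrib_left mult.assoc)
  then show "\<exists>l. ((\<lambda>z. c * f z) has_derivative (\<lambda>v. \<Sum>i\<in>UNIV. l i * v $ i)) (at z)"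
    by (rule exI[where x = "\<lambda>i. c * l i"])
qed

lemma holo_on_add: 
  assumes "holo_on f S" "holo_on g S" shows "holo_on (\<lambda>z. f z + g z) S"
  unfolding holo_on_def
proof
  fix z assume "z \<in> S"
  then obtain l m where "(f has_derivative (\<lambda>v. \<Sum>i\<in>UNIV. l i * v $ i)) (at z)"
      "(g has_derivative (\<lambda>v. \<Sum>i\<in>UNIV. m i * v $ i)) (at z)"
    using assms unfolding holo_on_def by blast
  then have "((\<lambda>z. f z + g z) has_derivative (\<lambda>v. \<Sum>i\<in>UNIV. (l i + m i) * v $ i)) (at z)"
    using has_derivative_add by (fastforce simp: sum.distrib distrib_right)
  then show "\<exists>l. ((\<lambda>z. f z + g z) has_derivative (\<lambda>v. \<Sum>i\<in>UNIV. l i * v $ i)) (at z)"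
    by (rule exI[where x = "\<lambda>i. l i + m i"])
qed

lemma holo_on_sum:
  assumes "finite I" "\<And>i. i \<in> I \<Longrightarrow> holo_on (f i) S" shows "holo_on (\<lambda>z. \<Sum>i\<in>I. f i z) S"
  using assms
proof (induction I)
  case empty
  show ?case unfolding holo_on_def by (intro ballI exI[of _ "\<lambda>_. 0"]) simp
next
  case (insert i I)
  then show ?case by (simp add: holo_on_add)
qed

section \<open>Projecting integrals onto a complex line\<close>

text \<open>The radius must exceed 1 so that the coefficients themselves are absolutely summable;
  they then serve as a majorant on the whole closed unit disc.\<close>

lemma power_series_coefficients:
  assumes "h holomorphic_on ball 0 \<rho>" "\<rho> > 1"
  obtains a :: "nat \<Rightarrow> complex" where "\<And>z. norm z < \<rho> \<Longrightarrow> (\<lambda>j. a j * z ^ j) sums h z" "summable (\<lambda>j. norm (a j))"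
proof
  show s: "(\<lambda>j. ((deriv ^^ j) h 0 / fact j) * z ^ j) sums h z" if "norm z < \<rho>" for z
    using holomorphic_power_series[OF assms(1), of z] that by simp
  define t where "t = complex_of_real ((1 + \<rho>) / 2)"
  have "norm t = (1 + \<rho>) / 2" unfolding t_def norm_of_real using assms by simp
  then have t: "norm t < \<rho>" "norm (1::complex) < norm t" using assms by auto
  show "summable (\<lambda>j. norm ((deriv ^^ j) h 0 / fact j))"
    using powser_insidea[OF sums_summable[OF s[OF t(1)]] t(2)] by simp
qed

text \<open>Averaging over the \<open>M\<close>-th roots of unity retains only the coefficients whose index is a multiple of \<open>M\<close>.\<close>

lemma roots_of_unity_average_tendsto:
  assumes "h holomorphic_on ball 0 \<rho>" "\<rho> > 1"
  shows "(\<lambda>M. (\<Sum>m<Suc M. h (cis (2 * pi * real m / real (Suc M)))) / of_nat (Suc M)) \<longlonglongrightarrow> h 0"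
proof -
  obtain a where a: "\<And>z. norm z < \<rho> \<Longrightarrow> (\<lambda>j. a j * z ^ j) sums h z" "summable (\<lambda>j. norm (a j))"
    using power_series_coefficients[OF assms] by blast
  define w where "w M j = (\<Sum>m<M. cis (2 * pi * real m / real M) ^ j) / of_nat M" for M j :: nat
  have w1: "norm (w M j) \<le> 1" if "M > 0" for M j
  proof -
    have "norm (\<Sum>m<M. cis (2 * pi * real m / real M) ^ j) \<le> of_nat (card {..<M}) * 1"
      by (rule sum_norm_bound) (simp add: norm_power)
    then show ?thesis using that by (simp add: w_def norm_divide divide_le_eq)
  qed
  have w0: "w M j = 0" if "0 < j" "j < M" for M j
  proof -
    define z where "z = cis (2 * pi * j / M)"
    have M: "M > 0" using that by simp
    have "cis (2 * pi * real j / real M) \<noteq> cis (2 * pi * real 0 / real M)"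
      using Complex.bij_betw_roots_unity[OF M] that unfolding bij_betw_def inj_on_def by (metis M lessThan_iff less_numeral_extra(3))
    then have "z \<noteq> 1" by (simp add: z_def)
    have "z ^ M = cis (2 * pi * real j)" unfolding z_def Complex.DeMoivre using M by simp
    then have zM: "z ^ M = 1" by (simp add: cis_multiple_2pi)
    have "cis (2 * pi * real m / real M) ^ j = z ^ m" for m
      unfolding z_def Complex.DeMoivre by (rule arg_cong[of _ _ cis]) simp
    then have "w M j = (\<Sum>m<M. z ^ m) / of_nat M" by (simp add: w_def)
    also have "(1 - z) * (\<Sum>m<M. z ^ m) = 1 - z ^ M" by (rule one_diff_power_eq[symmetric])
    then have "(\<Sum>m<M. z ^ m) = 0" using \<open>z \<noteq> 1\<close> zM by simp
    finally show ?thesis by simp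
  qed
  \<comment> \<open>The indices strictly between 0 and M average out and index 0 gives h(0), so only
    the coefficients from index M on contribute to the error.\<close>
  define tl where "tl M = (\<Sum>i. norm (a (i + M)))" for M
  have tl: "tl \<longlonglongrightarrow> 0" unfolding tl_def by (rule suminf_exist_split2[OF a(2)])
  have bound: "norm ((\<Sum>m<M. h (cis (2 * pi * real m / real M))) / of_nat M - h 0) \<le> tl M" if M: "M > 0" for M
  proof -
    have "(\<lambda>j. (\<Sum>m<M. a j * cis (2 * pi * real m / real M) ^ j) / of_nat M) sums ((\<Sum>m<M. h (cis (2 * pi * real m / real M))) / of_nat M)"
      by (intro sums_divide sums_sum a) (use assms in simp)
    then have "(\<lambda>j. a j * w M j) sums ((\<Sum>m<M. h (cis (2 * pi * real m / real M))) / of_nat M)"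
      by (simp add: w_def sum_distrib_left)
    then have "(\<lambda>j. a (j + M) * w M (j + M)) sums ((\<Sum>m<M. h (cis (2 * pi * real m / real M))) / of_nat M - (\<Sum>j<M. a j * w M j))"
      by (rule sums_split_initial_segment)
    moreover have "(\<Sum>j<M. a j * w M j) = h 0"
    proof -
      have "(\<Sum>j<M. a j * w M j) = (\<Sum>j\<in>{0}. a j * w M j)"
        by (rule sum.mono_neutral_right) (use M w0 in auto)
      also have "\<dots> = a 0" using M by (simp add: w_def)
      also have "\<dots> = h 0" using sums_unique2[OF powser_sums_zero a(1)[of 0]] assms by simp
      finally show ?thesis .
    qed
    ultimately have s: "(\<lambda>j. a (j + M) * w M (j + M)) sums ((\<Sum>m<M. h (cis (2 * pi * real m / real M))) / of_nat M - h 0)"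
      by simp
    have "norm (\<Sum>j. a (j + M) * w M (j + M)) \<le> tl M"
      unfolding tl_def
    proof (rule norm_suminf_le)
      show "norm (a (j + M) * w M (j + M)) \<le> norm (a (j + M))" for j
        using w1[OF M, of "j + M"] by (simp add: norm_mult mult_left_le)
      show "summable (\<lambda>j. norm (a (j + M)))" using a(2) by (rule summable_ignore_initial_segment)
    qed
    then show ?thesis using s by (simp add: sums_iff)
  qed
  have "(\<lambda>M. (\<Sum>m<Suc M. h (cis (2 * pi * real m / real (Suc M)))) / of_nat (Suc M) - h 0) \<longlonglongrightarrow> 0"
    by (rule Lim_null_comparison[OF _ LIMSEQ_Suc[OF tl]]) (intro always_eventually allI bound, simp)
  then show ?thesis by (simp add: LIM_zero_iff)
qed

section \<open>Integrability and termwise integration over the unit ball\<close>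

lemma integrable_on_unit_ball:
  fixes F :: "complex^'n \<Rightarrow> complex"
  assumes [measurable]: "(\<lambda>z. indicator (ball 0 1) z *\<^sub>R F z) \<in> borel_measurable borel"
    and "\<And>z. z \<in> ball 0 1 \<Longrightarrow> norm (F z) \<le> B"
  shows "set_integrable lborel (ball 0 1) F"
  unfolding set_integrable_def
proof (rule Bochner_Integration.integrable_bound)
  show "integrable lborel (\<lambda>z::complex^'n. indicator (ball 0 1) z *\<^sub>R B :: real)"
    using emeasure_lborel_ball_finite[of "0::complex^'n" 1]
    by (intro integrable_scaleR_left integrable_real_indicator) auto
  show "AE z in lborel. norm (indicator (ball 0 1) z *\<^sub>R F z) \<le> norm (indicator (ball 0 1) z *\<^sub>R B :: real)"
    by (intro always_eventually allI) (auto simp: indicator_def intro: order_trans[OF assms(2) abs_ge_self])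
qed simp

lemma set_measurable_on_unit_ball:
  fixes F :: "complex^'n \<Rightarrow> complex"
  shows "continuous_on (ball 0 1) F \<Longrightarrow> (\<lambda>z. indicator (ball 0 1) z *\<^sub>R F z) \<in> borel_measurable borel"
  by (rule borel_measurable_continuous_on_indicator) auto

lemma norm_integral_unit_ball_le:
  fixes F :: "complex^'n \<Rightarrow> complex"
  assumes "(\<lambda>z. indicator (ball 0 1) z *\<^sub>R F z) \<in> borel_measurable borel"
    and "\<And>z. z \<in> ball 0 1 \<Longrightarrow> norm (F z) \<le> B" "B \<ge> 0"
  shows "(LINT z:ball 0 1|lborel. norm (F z)) \<le> B * measure lborel (ball (0::complex^'n) 1)"
proof -
  have "(LINT z:ball 0 1|lborel. norm (F z)) \<le> (LINT z:ball (0::complex^'n) 1|lborel. B)"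
    using set_integrable_norm[OF integrable_on_unit_ball[OF assms(1,2)]] assms(2) emeasure_lborel_ball_finite[of "0::complex^'n" 1]
    by (intro set_integral_mono) (auto simp: set_integrable_def intro!: integrable_mult_left integrable_real_indicator)
  then show ?thesis by (simp add: set_lebesgue_integral_def mult.commute)
qed

lemma sums_integral_unit_ball:
  fixes G :: "nat \<Rightarrow> complex^'n \<Rightarrow> complex"
  assumes c: "\<And>j. continuous_on (ball 0 1) (G j)"
    and b: "\<And>j z. z \<in> ball 0 1 \<Longrightarrow> norm (G j z) \<le> w j"
    and w: "summable w"
    and s: "\<And>z. z \<in> ball 0 1 \<Longrightarrow> (\<lambda>j. G j z) sums H z"
  shows "(\<lambda>j. LINT z:ball 0 1|lborel. G j z) sums (LINT z:ball 0 1|lborel. H z)"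
proof -
  note m = set_measurable_on_unit_ball[OF c]
  have w0: "0 \<le> w j" for j using b[of 0 j] norm_ge_zero order_trans by (metis centre_in_ball zero_less_one)
  have "(\<lambda>j. LINT z|lborel. indicator (ball 0 1) z *\<^sub>R G j z) sums (LINT z|lborel. (\<Sum>j. indicator (ball 0 1) z *\<^sub>R G j z))"
  proof (rule sums_integral)
    show "integrable lborel (\<lambda>z. indicator (ball 0 1) z *\<^sub>R G j z)" for j
      using integrable_on_unit_ball[OF m b] by (simp add: set_integrable_def)
    show "AE z in lborel. summable (\<lambda>j. norm (indicator (ball 0 1) z *\<^sub>R G j z))"
    proof (intro always_eventually allI)
      fix z :: "complex^'n"
      show "summable (\<lambda>j. norm (indicator (ball 0 1) z *\<^sub>R G j z))"
        by (rule summable_comparison_test'[OF w, of 0]) (auto simp: indicator_def w0 intro: b)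
    qed
    show "summable (\<lambda>j. LINT z|lborel. norm (indicator (ball 0 1) z *\<^sub>R G j z))"
    proof (rule summable_comparison_test'[OF summable_mult2[OF w], of 0])
      fix j
      show "norm (LINT z|lborel. norm (indicator (ball 0 1) z *\<^sub>R G j z)) \<le> w j * measure lborel (ball (0::complex^'n) 1)"
        using norm_integral_unit_ball_le[OF m b w0, of j] by (simp add: set_lebesgue_integral_def)
    qed
  qed
  moreover have "(\<Sum>j. indicator (ball 0 1) z *\<^sub>R G j z) = indicator (ball 0 1) z *\<^sub>R H z" for z
    using s[of z] by (auto simp: indicator_def sums_iff)
  ultimately show ?thesis by (simp add: set_lebesgue_integral_def)
qed

text \<open>The rotations \<open>z \<mapsto> \<langle>z,e\<rangle>e + c(z - \<langle>z,e\<rangle>e)\<close> preserve the ball and \<open>\<langle>z,e\<rangle>\<close>; averaging over \<open>c\<close>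
  replaces \<open>f\<close> by its restriction to the complex line through \<open>e\<close>.\<close>

lemma integral_unit_ball_project:
  fixes f :: "complex^'n \<Rightarrow> complex" and g :: "complex \<Rightarrow> complex"
  assumes f: "holo_on f (ball 0 \<rho>)" "\<rho> > 1" and e: "norm e = 1" and g: "continuous_on (cball 0 1) g"
  shows "(LINT z:ball 0 1|lborel. f z * g (herm z e)) = (LINT z:ball 0 1|lborel. f (herm z e *s e) * g (herm z e))"
proof -
  define U where "U c z = herm z e *s e + c *s (z - herm z e *s e)" for c z
  have he: "herm e e = 1" using e by (simp add: herm_self)
  have hU: "herm (U c z) e = herm z e" for c z
    by (simp add: U_def herm_add_left herm_scale_left herm_diff_left he)
  have orth: "herm (herm z e *s e) (z - herm z e *s e) = 0" for z
    by (simp add: herm_diff_right herm_scale_left herm_scale_right he cnj_herm)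
  have nU2: "(norm (U c z))\<^sup>2 = (cmod (herm z e))\<^sup>2 + (cmod c)\<^sup>2 * (norm (z - herm z e *s e))\<^sup>2" for c z
    unfolding U_def norm_add_square_herm herm_scale_right orth norm_vector_scalar_mult by (simp add: e power_mult_distrib)
  have U1: "U 1 z = z" for z by (simp add: U_def)
  have nU: "norm (U c z) = norm z" if "cmod c = 1" for c z
  proof -
    have "(norm (U c z))\<^sup>2 = (norm (U 1 z))\<^sup>2" unfolding nU2 that by simp
    then show ?thesis unfolding U1 by (rule power2_eq_imp_eq) auto
  qed
  \<comment> \<open>Parameters with |c| > 1 matter too: this bound makes f(U c z) holomorphic in c
    on the disc of radius \<open>\<rho>\<close> > 1, as averaging over roots of unity
    requires.\<close>
  have nU_le: "norm (U c z) \<le> max 1 (cmod c) * norm z" for c z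
  proof -
    have "(norm (U c z))\<^sup>2 \<le> (max 1 (cmod c))\<^sup>2 * (norm (U 1 z))\<^sup>2"
    proof -
      have m: "1 \<le> (max 1 (cmod c))\<^sup>2" "(cmod c)\<^sup>2 \<le> (max 1 (cmod c))\<^sup>2"
        by (auto intro: power_mono one_le_power)
      show ?thesis
        unfolding nU2 distrib_left norm_one one_power2 mult_1_left
        using mult_right_mono[OF m(1), of "(cmod (herm z e))\<^sup>2"]
          mult_right_mono[OF m(2), of "(norm (z - herm z e *s e))\<^sup>2"] by simp
    qed
    then show ?thesis by (simp add: U1 power_mult_distrib[symmetric] power2_le_iff_abs_le abs_mult)
  qed
  have lin: "linear (U c)" for c
    unfolding U_def
    by (rule linearI) (auto simp: vec_eq_iff herm_add_left herm_scaleR_left scaleR_conv_of_real[where 'a = complex] algebra_simps)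
  have cf: "continuous_on (cball 0 1) f"
    by (rule continuous_on_subset[OF holo_on_imp_continuous_on[OF f(1)]]) (use f in auto)
  obtain Bf where "\<forall>z\<in>cball 0 1. norm (f z) \<le> Bf"
    using compact_imp_bounded[OF compact_continuous_image[OF cf compact_cball]] unfolding bounded_iff by blast
  then have Bf: "\<And>z. z \<in> cball 0 1 \<Longrightarrow> norm (f z) \<le> Bf" by blast
  obtain Bg where "\<forall>z\<in>cball 0 1. norm (g z) \<le> Bg"
    using compact_imp_bounded[OF compact_continuous_image[OF g compact_cball]] unfolding bounded_iff by blast
  then have Bg: "\<And>z. z \<in> cball 0 1 \<Longrightarrow> norm (g z) \<le> Bg" by blast
  have h1: "cmod (herm z e) \<le> norm z" for z using norm_herm_le[of z e] e by simp
  have h2: "cmod (herm z e) \<le> 1" if "norm z < 1" for z using h1[of z] that by linarith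
  have nU1: "norm (U c z) \<le> 1" if "cmod c \<le> 1" "norm z < 1" for c z
    using nU_le[of c z] that by (simp add: max_def split: if_splits)
  have Bf0: "0 \<le> Bf" by (rule order_trans[OF norm_ge_zero Bf[of 0]]) simp
  have Bg0: "0 \<le> Bg" by (rule order_trans[OF norm_ge_zero Bg[of 0]]) simp
  have cg: "continuous_on (ball 0 1) (\<lambda>z. g (herm z e))"
    by (rule continuous_on_compose2[OF g]) (auto intro!: continuous_intros h2)
  have cfU: "continuous_on (ball 0 1) (\<lambda>z. f (U c z))" if "cmod c \<le> 1" for c
    by (rule continuous_on_compose2[OF cf linear_continuous_on]) 
       (use lin nU1[OF that] in \<open>auto simp: linear_linear\<close>)
  define F where "F c z = indicator (ball 0 1) z *\<^sub>R (f (U c z) * g (herm z e))" for c z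
  have mF: "F c \<in> borel_measurable lborel" if "cmod c \<le> 1" for c
    using set_measurable_on_unit_ball[OF continuous_on_mult[OF cfU[OF that] cg]] by (simp add: F_def[abs_def])
  have FB: "norm (F c z) \<le> indicator (ball 0 1) z * (Bf * Bg)" if "cmod c \<le> 1" for c z
  proof (cases "z \<in> ball 0 1")
    case True
    then have "U c z \<in> cball 0 1" "herm z e \<in> cball 0 1"
      using nU1[OF that] h2 by auto
    then show ?thesis using Bf Bg Bf0 by (auto simp: F_def norm_mult True intro!: mult_mono)
  qed (simp add: F_def)
  have intw: "integrable lborel (\<lambda>z::complex^'n. indicator (ball 0 1) z * (Bf * Bg))"
    using emeasure_lborel_ball_finite[of "0::complex^'n" 1]
    by (intro integrable_mult_left integrable_real_indicator) auto
  have intF: "integrable lborel (F c)" if "cmod c \<le> 1" for c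
    by (rule Bochner_Integration.integrable_bound[OF intw mF[OF that]])
       (use FB[OF that] Bf0 Bg0 in \<open>auto simp: abs_mult\<close>)
  have inv: "integral\<^sup>L lborel (F c) = integral\<^sup>L lborel (F 1)" if "cmod c = 1" for c
  proof -
    have "F c = (\<lambda>z. F 1 (U c z))"
      using nU[OF that] by (auto simp: F_def U1 hU indicator_def)
    moreover have "integral\<^sup>L lborel (\<lambda>z. F 1 (U c z)) = integral\<^sup>L lborel (F 1)"
      by (rule integral_lborel_isometry) (use lin nU that mF[of 1] in auto)
    ultimately show ?thesis by simp
  qed
  \<comment> \<open>Each rotation with |c| = 1 is an isometry, so all the averages have the integral
    of \<open>F 1\<close>. Pointwise they tend to \<open>F 0\<close>, the value at the centre c = 0,
    where U is the projection onto the line. The factor g(<z,e>) does not see the rotation, so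
    continuity of g suffices and g may be antiholomorphic.\<close>
  define A where "A M z = (\<Sum>m<Suc M. F (cis (2 * pi * real m / real (Suc M))) z) / of_nat (Suc M)" for M z
  have intA: "integral\<^sup>L lborel (A M) = integral\<^sup>L lborel (F 1)" for M
  proof -
    have "integral\<^sup>L lborel (A M) = integral\<^sup>L lborel (\<lambda>z. \<Sum>m<Suc M. F (cis (2 * pi * real m / real (Suc M))) z) / of_nat (Suc M)"
      unfolding A_def[abs_def] by (rule integral_divide_zero)
    also have "integral\<^sup>L lborel (\<lambda>z. \<Sum>m<Suc M. F (cis (2 * pi * real m / real (Suc M))) z)
       = (\<Sum>m<Suc M. integral\<^sup>L lborel (F (cis (2 * pi * real m / real (Suc M)))))"
      by (rule Bochner_Integration.integral_sum) (rule intF, simp only: norm_cis order_refl)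
    also have "\<dots> = (\<Sum>m<Suc M. integral\<^sup>L lborel (F 1))"
      by (intro sum.cong inv refl norm_cis)
    also have "\<dots> = of_nat (Suc M) * integral\<^sup>L lborel (F 1)"
      by (simp only: sum_constant card_lessThan)
    finally show ?thesis by (simp only: nonzero_mult_div_cancel_left of_nat_eq_0_iff nat.distinct not_False_eq_True)
  qed
  have "(\<lambda>M. integral\<^sup>L lborel (A M)) \<longlonglongrightarrow> integral\<^sup>L lborel (F 0)"
  proof (rule integral_dominated_convergence[OF _ _ intw])
    show "F 0 \<in> borel_measurable lborel" by (rule mF) simp
    show "A M \<in> borel_measurable lborel" for M
      unfolding A_def[abs_def] by (intro borel_measurable_divide borel_measurable_sum mF) auto
    show "AE z in lborel. norm (A M z) \<le> indicator (ball 0 1) z * (Bf * Bg)" for M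
    proof (intro always_eventually allI)
      fix z
      have "norm (\<Sum>m<Suc M. F (cis (2 * pi * real m / real (Suc M))) z) \<le> of_nat (card {..<Suc M}) * (indicator (ball 0 1) z * (Bf * Bg))"
        by (rule sum_norm_bound) (rule FB, simp)
      then show "norm (A M z) \<le> indicator (ball 0 1) z * (Bf * Bg)"
        unfolding A_def norm_divide by (simp add: divide_le_eq mult.commute del: sum.lessThan_Suc of_nat_Suc)
    qed
    show "AE z in lborel. (\<lambda>M. A M z) \<longlonglongrightarrow> F 0 z"
    proof (intro always_eventually allI)
      fix z
      show "(\<lambda>M. A M z) \<longlonglongrightarrow> F 0 z"
      proof (cases "z \<in> ball 0 1")
        case True
        have "(\<lambda>c. f (herm z e *s e + c *s (z - herm z e *s e))) holomorphic_on ball 0 \<rho>"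
        proof (rule holo_on_slice[OF f(1)])
          fix c :: complex assume c: "c \<in> ball 0 \<rho>"
          have "norm (U c z) \<le> max 1 (cmod c) * norm z" by (rule nU_le)
          also have "\<dots> \<le> max 1 (cmod c) * 1" using True by (intro mult_left_mono) auto
          also have "\<dots> < \<rho>" using c f by auto
          finally show "herm z e *s e + c *s (z - herm z e *s e) \<in> ball 0 \<rho>" by (simp add: U_def)
        qed
        from roots_of_unity_average_tendsto[OF this f(2)]
        have "(\<lambda>M. (\<Sum>m<Suc M. f (U (cis (2 * pi * real m / real (Suc M))) z)) / of_nat (Suc M)) \<longlonglongrightarrow> f (U 0 z)"
          by (simp add: U_def del: sum.lessThan_Suc of_nat_Suc)
        from tendsto_mult[OF this tendsto_const, of "g (herm z e)"]
        show ?thesis using True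
          unfolding A_def F_def by (simp add: sum_distrib_right del: sum.lessThan_Suc of_nat_Suc)
      qed (simp add: A_def F_def)
    qed
  qed
  then have "integral\<^sup>L lborel (F 1) = integral\<^sup>L lborel (F 0)" unfolding intA using LIMSEQ_unique tendsto_const by blast
  moreover have "U 0 z = herm z e *s e" for z by (simp add: U_def)
  ultimately show ?thesis by (simp add: F_def[abs_def] U1 set_lebesgue_integral_def)
qed

section \<open>The reproducing property of the Bergman kernel\<close>

lemma negative_binomial_sums:
  fixes z :: complex
  assumes "norm z < 1"
  shows "(\<lambda>k. of_nat ((n + k) choose k) * z ^ k) sums inverse ((1 - z) ^ Suc n)"
proof -
  have "(\<lambda>k. ((- of_nat (Suc n)) gchoose k) * (- z) ^ k) sums (1 + - z) powr (- of_nat (Suc n))"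
    using gen_binomial_complex[of "- z" "- of_nat (Suc n)"] assms by simp
  moreover have "((- of_nat (Suc n) :: complex) gchoose k) * (- z) ^ k = of_nat ((n + k) choose k) * z ^ k" for k
  proof -
    have "(- of_nat (Suc n) :: complex) gchoose k = (-1) ^ k * ((of_nat k - (- of_nat (Suc n)) - 1) gchoose k)"
      by (rule gbinomial_negated_upper)
    also have "of_nat k - (- of_nat (Suc n)) - 1 = (of_nat (n + k) :: complex)" by simp
    also have "(of_nat (n + k) :: complex) gchoose k = of_nat ((n + k) choose k)"
      by (simp only: binomial_gbinomial)
    finally show ?thesis by (simp add: power_minus[of z])
  qed
  moreover have "(1 + - z) powr (- of_nat (Suc n)) = inverse ((1 - z) ^ Suc n)"
  proof -
    have "1 - z \<noteq> 0" using assms by auto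
    then show ?thesis by (simp only: powr_minus powr_nat' diff_conv_add_uminus simp_thms)
  qed
  ultimately show ?thesis by simp
qed

lemma integral_unit_ball_power:
  fixes e :: "complex^'n"
  assumes e: "norm e = 1"
  shows "(LINT z:ball 0 1|lborel. herm z e ^ j * cnj (herm z e) ^ k)
       = (if j = k then of_real (pi ^ CARD('n) * fact k / fact (CARD('n) + k)) else 0)"
proof (cases "j = k")
  case False
  \<comment> \<open>Chosen so that c^j cnj(c)^k = exp(i pi) = -1: the substitution z -> cz then
    shows that the integral is its own negative.\<close>
  define c where "c = cis (pi / (real j - real k))"
  have c: "cmod c = 1" by (simp add: c_def)
  have "c ^ j * cnj c ^ k = cis (real j * (pi / (real j - real k)) + real k * (- (pi / (real j - real k))))"
    by (simp only: c_def cis_cnj Complex.DeMoivre cis_mult)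
  also have "real j * (pi / (real j - real k)) + real k * (- (pi / (real j - real k))) = pi"
  proof -
    have "(real j - real k) * (pi / (real j - real k)) = pi" using False by simp
    then show ?thesis by (metis left_diff_distrib mult_minus_right uminus_add_conv_diff add.commute)
  qed
  finally have cc: "c ^ j * cnj c ^ k = -1" by simp
  define F where "F z = indicator (ball 0 1) z *\<^sub>R (herm z e ^ j * cnj (herm z e) ^ k)" for z
  have [measurable]: "F \<in> borel_measurable borel"
    unfolding F_def by (intro set_measurable_on_unit_ball continuous_intros)
  have "integral\<^sup>L lborel F = integral\<^sup>L lborel (\<lambda>z. F (c *s z))"
    by (rule integral_lborel_isometry[symmetric]) (auto simp: linear_vector_scalar_mult norm_vector_scalar_mult c)
  also have "(\<lambda>z. F (c *s z)) = (\<lambda>z. (c ^ j * cnj c ^ k) * F z)"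
    by (auto simp: F_def indicator_def norm_vector_scalar_mult c herm_scale_left power_mult_distrib)
  finally have "integral\<^sup>L lborel F = - integral\<^sup>L lborel F" unfolding cc by simp
  then show ?thesis using False by (simp add: F_def[abs_def] set_lebesgue_integral_def)
next
  case True
  have "(LINT z:ball 0 1|lborel. herm z e ^ j * cnj (herm z e) ^ k) 
      = (LINT z|lborel. of_real (cmod (herm z e) ^ (2 * k) * indicator (ball 0 1) z))"
    unfolding set_lebesgue_integral_def
  proof (intro Bochner_Integration.integral_cong refl)
    fix z :: "complex^'n"
    have "herm z e ^ j * cnj (herm z e) ^ k = of_real (cmod (herm z e) ^ (2 * k))"
      unfolding True power_mult_distrib[symmetric] complex_norm_square[symmetric] by (simp add: power_mult)
    then show "indicator (ball 0 1) z *\<^sub>R (herm z e ^ j * cnj (herm z e) ^ k) = of_real (cmod (herm z e) ^ (2 * k) * indicator (ball 0 1) z)"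
      by (simp add: indicator_def)
  qed
  also have "\<dots> = of_real (LINT z|lborel. cmod (herm z e) ^ (2 * k) * indicator (ball 0 1) z)"
    by (rule integral_complex_of_real)
  also have "(LINT z|lborel. cmod (herm z e) ^ (2 * k) * indicator (ball 0 1) z) 
     = enn2real (\<integral>\<^sup>+z. ennreal (cmod (herm z e) ^ (2 * k) * indicator (ball 0 1) z) \<partial>lborel)"
    by (rule integral_eq_nn_integral) auto
  also have "(\<lambda>z. ennreal (cmod (herm z e) ^ (2 * k) * indicator (ball 0 1) z)) = (\<lambda>z. ennreal (cmod (herm z e) ^ (2 * k)) * indicator (ball 0 1) z)"
    by (auto simp: indicator_def)
  finally show ?thesis using True by (simp add: nn_integral_direction_moment[OF e])
qed

text \<open>Parseval's formula: the powers of <z,e> are orthogonal on the ball, with squared norms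
  given by the moments. First \<phi> is expanded against a fixed power, then \<psi>; the absolutely
  summable coefficients justify both exchanges.\<close>

lemma integral_unit_ball_power_series:
  fixes e :: "complex^'n"
  assumes e: "norm e = 1" and \<phi>: "continuous_on (ball 0 1) \<phi>"
    and a: "\<And>z. norm z < 1 \<Longrightarrow> (\<lambda>j. a j * z ^ j) sums \<phi> z" "summable (\<lambda>j. norm (a j))"
    and b: "\<And>z. norm z < 1 \<Longrightarrow> (\<lambda>j. b j * z ^ j) sums \<psi> z" "summable (\<lambda>j. norm (b j))"
  shows "(\<lambda>k. of_real (pi ^ CARD('n) * fact k / fact (CARD('n) + k)) * a k * cnj (b k)) sums
    (LINT z:ball 0 1|lborel. \<phi> (herm z e) * cnj (\<psi> (herm z e)))"
proof -
  let ?m = "\<lambda>k. complex_of_real (pi ^ CARD('n) * fact k / fact (CARD('n) + k))"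
  have h1: "cmod (herm z e) < 1" if "z \<in> ball 0 1" for z
    using norm_herm_le[of z e] e that by simp
  have ca: "continuous_on (ball 0 1) (\<lambda>z. \<phi> (herm z e))"
    by (rule continuous_on_compose2[OF \<phi>]) (auto intro!: continuous_intros h1)
  have pw: "norm (x ^ j) \<le> 1" if "norm x < 1" for x :: complex and j
    using that by (simp add: norm_power power_le_one)
  have \<phi>B: "norm (\<phi> z) \<le> (\<Sum>j. norm (a j))" if "norm z < 1" for z
  proof -
    have "norm (\<Sum>j. a j * z ^ j) \<le> (\<Sum>j. norm (a j))"
      by (rule norm_suminf_le[OF _ a(2)]) (use pw[OF that] in \<open>simp add: norm_mult mult_left_le\<close>)
    then show ?thesis using a(1)[OF that] by (simp add: sums_iff)
  qed
  have 1: "(LINT z:ball 0 1|lborel. \<phi> (herm z e) * cnj (herm z e) ^ k) = ?m k * a k" for k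
  proof -
    have "(\<lambda>j. LINT z:ball 0 1|lborel. a j * (herm z e ^ j * cnj (herm z e) ^ k)) sums 
        (LINT z:ball 0 1|lborel. \<phi> (herm z e) * cnj (herm z e) ^ k)"
    proof (rule sums_integral_unit_ball[OF _ _ a(2)])
      show "continuous_on (ball 0 1) (\<lambda>z. a j * (herm z e ^ j * cnj (herm z e) ^ k))" for j
        by (intro continuous_intros)
      show "norm (a j * (herm z e ^ j * cnj (herm z e) ^ k)) \<le> norm (a j)" if "z \<in> ball 0 1" for j z
        using pw[OF h1[OF that], of j] pw[OF h1[OF that], of k] mult_mono[of "norm (herm z e ^ j)" 1 "norm (herm z e ^ k)" 1]
        by (simp add: norm_mult norm_power mult_left_le)
      show "(\<lambda>j. a j * (herm z e ^ j * cnj (herm z e) ^ k)) sums (\<phi> (herm z e) * cnj (herm z e) ^ k)" if "z \<in> ball 0 1" for z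
        using sums_mult2[OF a(1)[OF h1[OF that]], of "cnj (herm z e) ^ k"] by (simp add: mult.assoc)
    qed
    moreover have "(LINT z:ball 0 1|lborel. a j * (herm z e ^ j * cnj (herm z e) ^ k)) = (if j = k then a k * ?m k else 0)" for j
      using integral_unit_ball_power[OF e, of j k] by simp
    ultimately have "(\<lambda>j. if j = k then a k * ?m k else 0) sums (LINT z:ball 0 1|lborel. \<phi> (herm z e) * cnj (herm z e) ^ k)"
      by simp
    from sums_unique2[OF this sums_single[of k "\<lambda>_. a k * ?m k"]] show ?thesis by (simp only: mult.commute)
  qed
  have "(\<lambda>k. LINT z:ball 0 1|lborel. cnj (b k) * (\<phi> (herm z e) * cnj (herm z e) ^ k)) sums
      (LINT z:ball 0 1|lborel. \<phi> (herm z e) * cnj (\<psi> (herm z e)))"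
  proof (rule sums_integral_unit_ball[OF _ _ summable_mult2[OF b(2)]])
    show "continuous_on (ball 0 1) (\<lambda>z. cnj (b k) * (\<phi> (herm z e) * cnj (herm z e) ^ k))" for k
      by (intro continuous_intros ca)
    show "norm (cnj (b k) * (\<phi> (herm z e) * cnj (herm z e) ^ k)) \<le> norm (b k) * (\<Sum>j. norm (a j))" if "z \<in> ball 0 1" for k z
    proof -
      have "norm (\<phi> (herm z e)) * norm (cnj (herm z e) ^ k) \<le> (\<Sum>j. norm (a j)) * 1"
        using pw[OF h1[OF that], of k] \<phi>B[OF h1[OF that]] order_trans[OF norm_ge_zero \<phi>B[OF h1[OF that]]]
        by (intro mult_mono) (auto simp: norm_power)
      then show ?thesis by (simp add: norm_mult mult_left_mono)
    qed
    show "(\<lambda>k. cnj (b k) * (\<phi> (herm z e) * cnj (herm z e) ^ k)) sums (\<phi> (herm z e) * cnj (\<psi> (herm z e)))" if "z \<in> ball 0 1" for z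
      using sums_mult[OF sums_cnj[THEN iffD2, OF b(1)[OF h1[OF that]]], of "\<phi> (herm z e)"]
      by (simp add: mult_ac)
  qed
  then show ?thesis using 1 by (simp add: mult_ac)
qed

text \<open>Holomorphic in \<open>z\<close>, antiholomorphic in \<open>x\<close>. It belongs to the
  inner product normalised by the volume, in which the constant 1 has norm 1; hence no factor
  n!/pi^n.\<close>

definition bergman_kernel :: "complex^'n \<Rightarrow> complex^'n \<Rightarrow> complex"
  where "bergman_kernel x z = inverse ((1 - herm z x) ^ Suc CARD('n))"

text \<open>The kernel depends on z only through <z,e> with e a unit vector in the direction of x,
  so f can be replaced by its restriction to that line. There the kernel coefficient
  binom(n+k,k)|x|^k times the moment pi^n k!/(n+k)! is (pi^n/n!)|x|^k, and the series of f at x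
  remains. Holomorphy beyond the closed ball secures absolute convergence; a dilation removes this
  assumption later.\<close>

lemma bergman_reproducing:
  fixes f :: "complex^'n \<Rightarrow> complex"
  assumes f: "holo_on f (ball 0 \<rho>)" "\<rho> > 1" and x: "norm x < 1"
  shows "f x = of_real (fact CARD('n) / pi ^ CARD('n)) * (LINT z:ball 0 1|lborel. f z * cnj (bergman_kernel x z))"
proof -
  let ?n = "CARD('n)"
  let ?m = "\<lambda>k. complex_of_real (pi ^ ?n * fact k / fact (?n + k))"
  obtain e where e: "norm e = 1" "x = of_real (norm x) *s e"
  proof (cases "x = 0")
    case True
    show ?thesis by (rule that[of "axis undefined 1"]) (auto simp: True)
  next
    case False
    show ?thesis
      by (rule that[of "(1 / norm x) *\<^sub>R x"]) (use False in \<open>auto simp: vec_eq_iff scaleR_conv_of_real[where 'a = complex]\<close>)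
  qed
  define \<nu> where "\<nu> = norm x"
  have \<nu>: "0 \<le> \<nu>" "\<nu> < 1" "x = of_real \<nu> *s e" using x e by (auto simp: \<nu>_def)
  define \<psi> where "\<psi> \<zeta> = inverse ((1 - of_real \<nu> * \<zeta>) ^ Suc ?n)" for \<zeta> :: complex
  have K: "bergman_kernel x z = \<psi> (herm z e)" for z
    by (simp only: bergman_kernel_def \<psi>_def \<nu>(3) herm_scale_right complex_cnj_complex_of_real)
  define b where "b k = of_nat ((?n + k) choose k) * complex_of_real \<nu> ^ k" for k :: nat
  have nz: "norm (of_real \<nu> * z) < 1" if "norm z \<le> 1" for z :: complex
    using \<nu> that mult_left_le[of "norm z" \<nu>] by (simp add: norm_mult)
  have b1: "(\<lambda>j. b j * z ^ j) sums \<psi> z" if "norm z \<le> 1" for z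
    using negative_binomial_sums[OF nz[OF that], of ?n] by (simp add: b_def \<psi>_def power_mult_distrib mult.assoc)
  have b2: "summable (\<lambda>j. norm (b j))"
  proof -
    have "norm (b j) = Re (b j * 1 ^ j)" for j using \<nu> by (simp add: b_def norm_mult norm_power flip: of_real_power)
    then show ?thesis using sums_Re[OF b1[of 1]] by (simp add: sums_iff)
  qed
  have c\<psi>: "continuous_on (cball 0 1) (\<lambda>\<zeta>. cnj (\<psi> \<zeta>))"
    unfolding \<psi>_def using nz by (intro continuous_intros) force
  define \<phi> where "\<phi> \<zeta> = f (0 + \<zeta> *s e)" for \<zeta>
  have \<phi>h: "\<phi> holomorphic_on ball 0 \<rho>"
    unfolding \<phi>_def[abs_def] by (rule holo_on_slice[OF f(1)]) (auto simp: norm_vector_scalar_mult e)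
  obtain a where a: "\<And>z. norm z < \<rho> \<Longrightarrow> (\<lambda>j. a j * z ^ j) sums \<phi> z" "summable (\<lambda>j. norm (a j))"
    using power_series_coefficients[OF \<phi>h f(2)] by blast
  have "(LINT z:ball 0 1|lborel. f z * cnj (bergman_kernel x z)) = (LINT z:ball 0 1|lborel. \<phi> (herm z e) * cnj (\<psi> (herm z e)))"
    unfolding K \<phi>_def using integral_unit_ball_project[OF f e(1) c\<psi>] by simp
  moreover have "(\<lambda>k. ?m k * a k * cnj (b k)) sums (LINT z:ball 0 1|lborel. \<phi> (herm z e) * cnj (\<psi> (herm z e)))"
  proof (rule integral_unit_ball_power_series[OF e(1) _ _ a(2) _ b2])
    show "continuous_on (ball 0 1) \<phi>"
      using holomorphic_on_imp_continuous_on[OF \<phi>h] by (rule continuous_on_subset) (use f in auto)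
  qed (use a b1 f in auto)
  moreover have "?m k * a k * cnj (b k) = of_real (pi ^ ?n / fact ?n) * (a k * of_real \<nu> ^ k)" for k
  proof -
    have "real ((?n + k) choose k) * fact k * fact ?n = fact (?n + k)"
      using binomial_fact[of k "?n + k", where ?'a = real] by simp
    then have "pi ^ ?n * fact k / fact (?n + k) * real ((?n + k) choose k) = pi ^ ?n / fact ?n"
      by (simp add: field_simps)
    then have m: "?m k * of_nat ((?n + k) choose k) = of_real (pi ^ ?n / fact ?n)"
      by (metis of_real_mult of_real_of_nat_eq)
    have "cnj (b k) = of_nat ((?n + k) choose k) * of_real \<nu> ^ k" by (simp add: b_def)
    then have "?m k * a k * cnj (b k) = (?m k * of_nat ((?n + k) choose k)) * (a k * of_real \<nu> ^ k)"
      by (simp only: mult_ac)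
    then show ?thesis unfolding m .
  qed
  moreover have "(\<lambda>k. of_real (pi ^ ?n / fact ?n) * (a k * of_real \<nu> ^ k)) sums (of_real (pi ^ ?n / fact ?n) * \<phi> (of_real \<nu>))"
    by (intro sums_mult a(1)) (use \<nu> f in auto)
  moreover have "\<phi> (of_real \<nu>) = f x" by (simp add: \<phi>_def \<nu>(3)[symmetric])
  ultimately have "(LINT z:ball 0 1|lborel. f z * cnj (bergman_kernel x z)) = of_real (pi ^ ?n / fact ?n) * f x"
    by (simp add: sums_unique2)
  then show ?thesis by (simp add: field_simps)
qed

section \<open>Bounds for point functionals\<close>

lemma one_minus_herm_nonzero: "norm x < 1 \<Longrightarrow> norm z * norm x < 1 \<Longrightarrow> 1 - herm z x \<noteq> 0"
  using norm_herm_le[of z x] by (metis eq_iff_diff_eq_0 leD norm_one)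

text \<open>The radius exceeds 1, which makes kernels admissible as f in the reproducing formula,
  and for x nonzero it stays below 1/|x|, so that <z,x> cannot reach 1.\<close>

lemma holo_on_bergman_kernel:
  fixes x :: "complex^'n"
  assumes "norm x < 1"
  shows "holo_on (bergman_kernel x) (ball 0 (2 / (1 + norm x)))"
  unfolding bergman_kernel_def[abs_def]
proof (rule holo_on_herm_compose)
  fix z :: "complex^'n" assume z: "z \<in> ball 0 (2 / (1 + norm x))"
  have "norm z * norm x \<le> 2 / (1 + norm x) * norm x" using z by (intro mult_right_mono) auto
  also have "\<dots> < 1" using assms by (simp add: divide_less_eq add_pos_nonneg)
  finally have "1 - herm z x \<noteq> 0" using assms one_minus_herm_nonzero by blast
  then show "(\<lambda>\<zeta>. inverse ((1 - \<zeta>) ^ Suc CARD('n))) field_differentiable at (herm z x)"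
    by (intro derivative_intros field_differentiable_inverse field_differentiable_power field_differentiable_diff) auto
qed

lemma set_integrable_unit_ball_continuous:
  fixes F :: "complex^'n \<Rightarrow> complex"
  assumes "continuous_on (cball 0 1) F"
  shows "set_integrable lborel (ball 0 1) F"
proof -
  obtain B where "\<forall>z\<in>cball 0 1. norm (F z) \<le> B"
    using compact_imp_bounded[OF compact_continuous_image[OF assms compact_cball]] unfolding bounded_iff by blast
  then show ?thesis
    by (intro integrable_on_unit_ball[of _ B] set_measurable_on_unit_ball continuous_on_subset[OF assms]) auto
qed

lemma set_integral_mult_cnj:
  fixes u :: "'a \<Rightarrow> complex"
  shows "(LINT z:A|M. u z * cnj (u z)) = of_real (LINT z:A|M. (cmod (u z))\<^sup>2)"
proof -
  have "indicator A z *\<^sub>R (u z * cnj (u z)) = of_real (indicator A z *\<^sub>R (cmod (u z))\<^sup>2)" for z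
    by (cases "z \<in> A") (simp_all add: complex_norm_square del: of_real_power)
  then show ?thesis by (simp only: set_lebesgue_integral_def integral_complex_of_real)
qed

lemma unit_ball_Cauchy_Schwarz:
  fixes f g :: "complex^'n \<Rightarrow> complex"
  assumes f: "continuous_on (cball 0 1) f" and g: "continuous_on (cball 0 1) g"
  shows "(cmod (LINT z:ball 0 1|lborel. f z * cnj (g z)))\<^sup>2
    \<le> Re (LINT z:ball 0 1|lborel. f z * cnj (f z)) * Re (LINT z:ball 0 1|lborel. g z * cnj (g z))"
proof -
  define ip where "ip u v = (LINT z:ball 0 1|lborel. u z * cnj (v z))" for u v :: "complex^'n \<Rightarrow> complex"
  have int: "set_integrable lborel (ball 0 1) (\<lambda>z. c * (u z * cnj (v z)))"
    if "continuous_on (cball 0 1) u" "continuous_on (cball 0 1) v" for u v :: "complex^'n \<Rightarrow> complex" and c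
    using that by (intro set_integrable_unit_ball_continuous continuous_intros)
  have nn: "0 \<le> Re (ip u u)" for u
  proof -
    have "ip u u = of_real (LINT z:ball 0 1|lborel. (cmod (u z))\<^sup>2)"
      unfolding ip_def by (rule set_integral_mult_cnj)
    then show ?thesis by (auto simp: set_lebesgue_integral_def intro!: Bochner_Integration.integral_nonneg)
  qed
  have q: "0 \<le> Re (ip f f) - 2 * Re (cnj t * ip f g) + (cmod t)\<^sup>2 * Re (ip g g)" for t
  proof -
    have "ip (\<lambda>z. f z - t * g z) (\<lambda>z. f z - t * g z) 
      = (LINT z:ball 0 1|lborel. 1 * (f z * cnj (f z)) - cnj t * (f z * cnj (g z)) - (t * (g z * cnj (f z)) - (t * cnj t) * (g z * cnj (g z))))"
      unfolding ip_def by (intro arg_cong[where f = "set_lebesgue_integral lborel (ball 0 1)"] ext) (simp add: algebra_simps)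
    also have "\<dots> = ip f f - cnj t * ip f g - (t * ip g f - (t * cnj t) * ip g g)"
      unfolding ip_def
        set_integral_diff(2)[OF set_integral_diff(1)[OF int[OF f f] int[OF f g]] set_integral_diff(1)[OF int[OF g f] int[OF g g]]]
        set_integral_diff(2)[OF int[OF f f] int[OF f g]] set_integral_diff(2)[OF int[OF g f] int[OF g g]]
      by simp
    also have "ip g f = cnj (ip f g)"
      unfolding ip_def set_lebesgue_integral_def Bochner_Integration.integral_cnj[symmetric] by (simp add: mult.commute)
    finally have eq: "ip (\<lambda>z. f z - t * g z) (\<lambda>z. f z - t * g z) = ip f f - cnj t * ip f g - (t * cnj (ip f g) - (t * cnj t) * ip g g)" .
    have "t * cnj t = of_real ((cmod t)\<^sup>2)" by (simp add: complex_norm_square[symmetric])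
    then show ?thesis using nn[of "\<lambda>z. f z - t * g z"] unfolding eq by simp
  qed
  define P Q b where "P = Re (ip f f)" and "Q = Re (ip g g)" and "b = ip f g"
  \<comment> \<open>Taking t = rb aligns the phases and leaves a real quadratic in r. Its minimum is
    at r = 1/Q; for Q = 0 a large r would contradict nonnegativity unless b = 0.\<close>
  have r: "0 \<le> P - 2 * r * (cmod b)\<^sup>2 + r\<^sup>2 * (cmod b)\<^sup>2 * Q" for r
  proof -
    have "cnj (of_real r * b) * b = of_real (r * (cmod b)\<^sup>2)" 
      unfolding complex_cnj_mult by (simp add: mult.assoc complex_norm_square[symmetric] mult.commute[of "cnj b"])
    then have "Re (cnj (of_real r * b) * b) = r * (cmod b)\<^sup>2" by (metis Re_complex_of_real)
    then show ?thesis using q[of "of_real r * b"] by (simp add: P_def Q_def b_def norm_mult power_mult_distrib)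
  qed
  have "(cmod b)\<^sup>2 \<le> P * Q"
  proof (cases "Q = 0")
    case True
    have "b = 0"
    proof (rule ccontr)
      assume "b \<noteq> 0"
      then have "(cmod b)\<^sup>2 > 0" by simp
      then show False using r[of "(P + 1) / (cmod b)\<^sup>2"] nn[of f] True by (simp add: P_def)
    qed
    then show ?thesis using True by simp
  next
    case False
    then have "Q > 0" using nn[of g] by (simp add: Q_def)
    then show ?thesis using r[of "1 / Q"] by (simp add: field_simps power2_eq_square)
  qed
  then show ?thesis by (simp add: P_def Q_def b_def ip_def)
qed

text \<open>By the reproducing property the functional is the inner product with \<open>S\<close>, a
  combination of kernels, so Cauchy-Schwarz leaves the norm of S. That norm is the functional
  evaluated at S itself, which is the kernel quadratic form. Finitely many kernels share a radius
  \<open>\<sigma>\<close> > 1, so S is admissible.\<close>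

lemma bergman_functional_bound:
  fixes f :: "complex^'n \<Rightarrow> complex" and x :: "'i \<Rightarrow> complex^'n"
  assumes f: "holo_on f (ball 0 \<rho>)" "\<rho> > 1" and I: "finite I" and x: "\<And>i. i \<in> I \<Longrightarrow> norm (x i) < 1"
  shows "(cmod (\<Sum>i\<in>I. c i * f (x i)))\<^sup>2
    \<le> fact CARD('n) / pi ^ CARD('n) * Re (LINT z:ball 0 1|lborel. f z * cnj (f z))
       * Re (\<Sum>i\<in>I. \<Sum>j\<in>I. c i * cnj (c j) * bergman_kernel (x j) (x i))"
proof (cases "I = {}")
  case False
  define C where "C = fact CARD('n) / pi ^ CARD('n)"
  define S where "S z = (\<Sum>j\<in>I. cnj (c j) * bergman_kernel (x j) z)" for z
  define \<sigma> where "\<sigma> = Min ((\<lambda>j. 2 / (1 + norm (x j))) ` I)"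
  have \<sigma>: "\<sigma> > 1" unfolding \<sigma>_def using I False x by (subst Min_gr_iff) (auto simp: less_divide_eq add_pos_nonneg)
  have Sh: "holo_on S (ball 0 \<sigma>)"
    unfolding S_def[abs_def]
  proof (intro holo_on_sum I holo_on_cmult)
    fix j assume "j \<in> I"
    then have "\<sigma> \<le> 2 / (1 + norm (x j))" unfolding \<sigma>_def using I by (intro Min_le) auto
    then show "holo_on (bergman_kernel (x j)) (ball 0 \<sigma>)"
      by (intro holo_on_subset[OF holo_on_bergman_kernel[OF x[OF \<open>j \<in> I\<close>]]]) auto
  qed
  have cont: "continuous_on (cball 0 1) g" if "holo_on g (ball 0 r)" "r > 1" for g :: "complex^'n \<Rightarrow> complex" and r
    by (rule continuous_on_subset[OF holo_on_imp_continuous_on[OF that(1)]]) (use that in auto)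
  have cK: "continuous_on (cball 0 1) (bergman_kernel (x j))" if "j \<in> I" for j
    by (rule cont[OF holo_on_bergman_kernel[OF x[OF that]]]) (use x[OF that] in \<open>simp add: less_divide_eq add_pos_nonneg\<close>)
  have l: "(\<Sum>i\<in>I. c i * g (x i)) = of_real C * (LINT z:ball 0 1|lborel. g z * cnj (S z))"
    if g: "holo_on g (ball 0 r)" "r > 1" for g r
  proof -
    have "(LINT z:ball 0 1|lborel. g z * cnj (S z)) = (LINT z:ball 0 1|lborel. (\<Sum>j\<in>I. c j * (g z * cnj (bergman_kernel (x j) z))))"
      by (simp add: S_def sum_distrib_left mult_ac)
    also have "\<dots> = (\<Sum>j\<in>I. LINT z:ball 0 1|lborel. c j * (g z * cnj (bergman_kernel (x j) z)))"
      unfolding set_lebesgue_integral_def scaleR_sum_right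
      by (rule Bochner_Integration.integral_sum)
         (intro set_integrable_unit_ball_continuous[unfolded set_integrable_def] continuous_intros cK cont[OF g])
    also have "of_real C * \<dots> = (\<Sum>j\<in>I. c j * g (x j))"
      unfolding sum_distrib_left
      by (intro sum.cong refl) (simp add: bergman_reproducing[OF g x] C_def)
    finally show ?thesis by simp
  qed
  have q: "(\<Sum>i\<in>I. \<Sum>j\<in>I. c i * cnj (c j) * bergman_kernel (x j) (x i)) = of_real C * (LINT z:ball 0 1|lborel. S z * cnj (S z))"
    unfolding l[OF Sh \<sigma>, symmetric] by (simp add: S_def sum_distrib_left mult_ac)
  have C: "C > 0" by (simp add: C_def)
  have "(cmod (\<Sum>i\<in>I. c i * f (x i)))\<^sup>2 = C\<^sup>2 * (cmod (LINT z:ball 0 1|lborel. f z * cnj (S z)))\<^sup>2"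
    unfolding l[OF f] norm_mult by (simp add: power_mult_distrib)
  also have "\<dots> \<le> C\<^sup>2 * (Re (LINT z:ball 0 1|lborel. f z * cnj (f z)) * Re (LINT z:ball 0 1|lborel. S z * cnj (S z)))"
    by (intro mult_left_mono unit_ball_Cauchy_Schwarz cont[OF f] cont[OF Sh \<sigma>]) simp
  also have "\<dots> = C * Re (LINT z:ball 0 1|lborel. f z * cnj (f z)) * Re (of_real C * (LINT z:ball 0 1|lborel. S z * cnj (S z)))"
    by (simp add: power2_eq_square)
  finally show ?thesis unfolding q C_def .
qed simp

section \<open>Passage to the ball of radius R, to square-integrable functions and to
  systems\<close>

lemma integral_lborel_affine:
  fixes h :: "'a::euclidean_space \<Rightarrow> real"
  assumes [measurable]: "h \<in> borel_measurable borel" and "c > 0"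
  shows "(LINT z|lborel. h z) = c ^ DIM('a) * (LINT z|lborel. h (t + c *\<^sub>R z))"
  using assms(2)
  by (subst lborel_affine[of c t]) (simp_all add: integral_density integral_distr)

lemma A2_norm_square:
  fixes f :: "complex^'n \<Rightarrow> complex"
  assumes "R > 0"
  shows "(A2_norm \<omega> R f)\<^sup>2 = fact CARD('n) / pi ^ CARD('n) / R ^ (2 * CARD('n)) * (LINT z:ball \<omega> R|lborel. (cmod (f z))\<^sup>2)"
proof -
  note set_integral_mult_cnj[of lborel "ball \<omega> R" f]
  then have "Re (A2_inner \<omega> R f f) = fact CARD('n) / pi ^ CARD('n) / R ^ (2 * CARD('n)) * (LINT z:ball \<omega> R|lborel. (cmod (f z))\<^sup>2)"
    unfolding A2_inner_def by (simp only: of_real_mult[symmetric] Re_complex_of_real)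
  moreover have "0 \<le> (LINT z:ball \<omega> R|lborel. (cmod (f z))\<^sup>2)"
    unfolding set_lebesgue_integral_def by (rule Bochner_Integration.integral_nonneg) auto
  ultimately show ?thesis unfolding A2_norm_def using assms by simp
qed

lemma A2_functional_bound:
  fixes f :: "complex^'n \<Rightarrow> complex" and x :: "'i \<Rightarrow> complex^'n"
  assumes f: "f \<in> A2 \<omega> R" and R: "R > 0" and I: "finite I" and x: "\<And>i. i \<in> I \<Longrightarrow> norm (x i) < 1"
  shows "(cmod (\<Sum>i\<in>I. c i * f (\<omega> + R *\<^sub>R x i)))\<^sup>2
    \<le> (A2_norm \<omega> R f)\<^sup>2 * Re (\<Sum>i\<in>I. \<Sum>j\<in>I. c i * cnj (c j) * bergman_kernel (x j) (x i))"
proof -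
  let ?n = "CARD('n)"
  define q where "q = Re (\<Sum>i\<in>I. \<Sum>j\<in>I. c i * cnj (c j) * bergman_kernel (x j) (x i))"
  have h: "holo_on f (ball \<omega> R)" and int: "set_integrable lborel (ball \<omega> R) (\<lambda>z. (cmod (f z))\<^sup>2)"
    using f analytic_in_imp_holo_on by (auto simp: A2_def)
  have cf: "continuous_on (ball \<omega> R) f" by (rule holo_on_imp_continuous_on[OF h])
  \<comment> \<open>An element of \<open>A2\<close> is controlled only on the open ball. Dilating by
    r < 1 makes it holomorphic on a ball of radius 1/r > 1; the change of variables costs r^(2n),
    which tends to 1.\<close>
  have ev: "r ^ (2 * ?n) * (cmod (\<Sum>i\<in>I. c i * f (\<omega> + (r * R) *\<^sub>R x i)))\<^sup>2 \<le> (A2_norm \<omega> R f)\<^sup>2 * q"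
    if r: "0 < r" "r < 1" for r
  proof -
    define g where "g z = f (\<omega> + (r * R) *\<^sub>R z)" for z
    have gh: "holo_on g (ball 0 (1 / r))" unfolding g_def[abs_def]
      by (rule holo_on_affine[OF h]) (use r R in \<open>auto simp: dist_norm field_simps\<close>)
    have rR: "r * R > 0" using r R by simp
    define k where "k z = indicator (ball \<omega> (r * R)) z * (cmod (f z))\<^sup>2" for z
    have sub: "ball \<omega> (r * R) \<subseteq> ball \<omega> R" using r R by (intro subset_ball) (simp add: mult_le_cancel_right1)
    have km: "k \<in> borel_measurable borel"
      unfolding k_def[abs_def] using borel_measurable_continuous_on_indicator[of "ball \<omega> (r * R)" "\<lambda>z. (cmod (f z))\<^sup>2"]
      by (simp add: continuous_intros continuous_on_subset[OF cf sub])
    have "Re (LINT z:ball 0 1|lborel. g z * cnj (g z)) = (LINT z|lborel. k (\<omega> + (r * R) *\<^sub>R z))"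
    proof -
      have "(LINT z:ball 0 1|lborel. g z * cnj (g z)) = of_real (LINT z:ball 0 1|lborel. (cmod (g z))\<^sup>2)"
        by (rule set_integral_mult_cnj)
      also have "(LINT z:ball 0 1|lborel. (cmod (g z))\<^sup>2) = (LINT z|lborel. k (\<omega> + (r * R) *\<^sub>R z))"
        unfolding set_lebesgue_integral_def k_def g_def
      proof (intro Bochner_Integration.integral_cong refl)
        fix z :: "complex^'n"
        have "\<omega> + (r * R) *\<^sub>R z \<in> ball \<omega> (r * R) \<longleftrightarrow> z \<in> ball 0 1"
          using rR mult_less_cancel_left_pos[OF rR, of "norm z" 1] by (simp add: dist_norm abs_of_pos)
        then show "indicator (ball 0 1) z *\<^sub>R (cmod (f (\<omega> + (r * R) *\<^sub>R z)))\<^sup>2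
            = indicator (ball \<omega> (r * R)) (\<omega> + (r * R) *\<^sub>R z) * (cmod (f (\<omega> + (r * R) *\<^sub>R z)))\<^sup>2"
          by (simp add: indicator_def)
      qed
      finally show ?thesis by simp
    qed
    then have "(r * R) ^ (2 * ?n) * Re (LINT z:ball 0 1|lborel. g z * cnj (g z)) = (LINT z|lborel. k z)"
      using integral_lborel_affine[OF km rR, of \<omega>] by (simp add: mult.commute)
    also have "\<dots> \<le> (LINT z:ball \<omega> R|lborel. (cmod (f z))\<^sup>2)"
      unfolding set_lebesgue_integral_def
    proof (rule integral_mono_AE')
      show "integrable lborel (\<lambda>z. indicator (ball \<omega> R) z *\<^sub>R (cmod (f z))\<^sup>2)"
        using int by (simp add: set_integrable_def)
      show "AE z in lborel. k z \<le> indicator (ball \<omega> R) z *\<^sub>R (cmod (f z))\<^sup>2"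
        using sub by (intro always_eventually allI) (auto simp: k_def indicator_def)
      show "AE z in lborel. 0 \<le> indicator (ball \<omega> R) z *\<^sub>R (cmod (f z))\<^sup>2" by simp
    qed
    finally have 1: "(r * R) ^ (2 * ?n) * Re (LINT z:ball 0 1|lborel. g z * cnj (g z)) \<le> (LINT z:ball \<omega> R|lborel. (cmod (f z))\<^sup>2)" .
    have "1 / r > 1" using r by simp
    note b = bergman_functional_bound[where x = x and c = c, OF gh this I x, folded q_def]
    \<comment> \<open>The kernel form is nonnegative because the bound just used also holds for the
      constant function 1, whose norm is positive.\<close>
    have q0: "0 \<le> q"
    proof -
      have ho: "holo_on (\<lambda>_::complex^'n. 1) (ball 0 2)"
        unfolding holo_on_def by (intro ballI exI[of _ "\<lambda>_. 0"]) simp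
      have "0 \<le> fact ?n / pi ^ ?n * Re (LINT z:ball (0::complex^'n) 1|lborel. 1 * cnj 1) * q"
        using order_trans[OF zero_le_power2 bergman_functional_bound[where x = x and c = c, OF ho _ I x, folded q_def]] by simp
      moreover have "Re (LINT z:ball (0::complex^'n) 1|lborel. 1 * cnj 1) > 0"
        using emeasure_lborel_ball_finite[of "0::complex^'n" 1]
        by (simp add: set_lebesgue_integral_def)
      then have "fact ?n / pi ^ ?n * Re (LINT z:ball (0::complex^'n) 1|lborel. 1 * cnj 1) > 0" by (intro mult_pos_pos) auto
      ultimately show ?thesis by (meson zero_le_mult_iff not_less)
    qed
    have "r ^ (2 * ?n) * (cmod (\<Sum>i\<in>I. c i * g (x i)))\<^sup>2 \<le> r ^ (2 * ?n) * (fact ?n / pi ^ ?n * Re (LINT z:ball 0 1|lborel. g z * cnj (g z)) * q)"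
      by (intro mult_left_mono b) (use r in auto)
    also have "\<dots> = fact ?n / pi ^ ?n / R ^ (2 * ?n) * ((r * R) ^ (2 * ?n) * Re (LINT z:ball 0 1|lborel. g z * cnj (g z))) * q"
      using R by (simp add: power_mult_distrib)
    also have "\<dots> \<le> fact ?n / pi ^ ?n / R ^ (2 * ?n) * (LINT z:ball \<omega> R|lborel. (cmod (f z))\<^sup>2) * q"
      using R q0 by (intro mult_left_mono mult_right_mono 1) auto
    finally show ?thesis unfolding A2_norm_square[OF R] g_def .
  qed
  have "((\<lambda>r. r ^ (2 * ?n) * (cmod (\<Sum>i\<in>I. c i * f (\<omega> + (r * R) *\<^sub>R x i)))\<^sup>2) \<longlongrightarrow> 1 ^ (2 * ?n) * (cmod (\<Sum>i\<in>I. c i * f (\<omega> + (1 * R) *\<^sub>R x i)))\<^sup>2) (at_left 1)"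
  proof (intro tendsto_intros)
    fix i assume "i \<in> I"
    then have "\<omega> + (1 * R) *\<^sub>R x i \<in> ball \<omega> R" using x[of i] R by (simp add: dist_norm)
    then have "isCont f (\<omega> + (1 * R) *\<^sub>R x i)"
      using cf continuous_on_eq_continuous_at open_ball by blast
    then show "((\<lambda>r. f (\<omega> + (r * R) *\<^sub>R x i)) \<longlongrightarrow> f (\<omega> + (1 * R) *\<^sub>R x i)) (at_left 1)"
      by (rule isCont_tendsto_compose) (intro tendsto_intros)
  qed
  moreover have "\<forall>\<^sub>F r in at_left (1::real). r ^ (2 * ?n) * (cmod (\<Sum>i\<in>I. c i * f (\<omega> + (r * R) *\<^sub>R x i)))\<^sup>2 \<le> (A2_norm \<omega> R f)\<^sup>2 * q"
    using eventually_at_left_real[of 0 "1::real"] by (rule eventually_mono) (use ev in auto)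
  ultimately have "1 ^ (2 * ?n) * (cmod (\<Sum>i\<in>I. c i * f (\<omega> + (1 * R) *\<^sub>R x i)))\<^sup>2 \<le> (A2_norm \<omega> R f)\<^sup>2 * q"
    by (intro tendsto_upperbound[where F = "at_left (1::real)"]) auto
  then show ?thesis by (simp add: q_def)
qed

lemma A2_system_functional_bound:
  fixes f :: "complex^'n \<Rightarrow> complex^'n" and x :: "'i \<Rightarrow> complex^'n"
  assumes f: "f \<in> A2_system \<omega> R" and R: "R > 0" and I: "finite I" and x: "\<And>i. i \<in> I \<Longrightarrow> norm (x i) < 1"
  shows "(norm (\<Sum>i\<in>I. c i *s f (\<omega> + R *\<^sub>R x i)))\<^sup>2
    \<le> (A2_system_norm \<omega> R f)\<^sup>2 * Re (\<Sum>i\<in>I. \<Sum>j\<in>I. c i * cnj (c j) * bergman_kernel (x j) (x i))"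
proof -
  define q where "q = Re (\<Sum>i\<in>I. \<Sum>j\<in>I. c i * cnj (c j) * bergman_kernel (x j) (x i))"
  have "(norm (\<Sum>i\<in>I. c i *s f (\<omega> + R *\<^sub>R x i)))\<^sup>2 = (\<Sum>l\<in>UNIV. (cmod (\<Sum>i\<in>I. c i * f (\<omega> + R *\<^sub>R x i) $ l))\<^sup>2)"
    by (simp add: norm_vec_def L2_set_def sum_nonneg)
  also have "\<dots> \<le> (\<Sum>l\<in>UNIV. (A2_norm \<omega> R (\<lambda>z. f z $ l))\<^sup>2 * q)"
    unfolding q_def using f
    by (intro sum_mono A2_functional_bound[where f = "\<lambda>z. f z $ _"] R I x) (auto simp: A2_system_def)
  also have "\<dots> = (A2_system_norm \<omega> R f)\<^sup>2 * q"
    by (simp add: A2_system_norm_def sum_nonneg sum_distrib_right)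
  finally show ?thesis by (simp add: q_def)
qed

section \<open>Projective coordinates around a point\<close>

definition defect :: "complex^'n \<Rightarrow> real"
  where "defect x = 1 - (norm x)\<^sup>2"

text \<open>Write z - x = y/m and z' - x = y'/m'. Clearing denominators in 1 - <z,z'> gives s m
  cnj(m') - <y,x> cnj(m') - m <x,y'> - <y,y'>. With m = 1 + <y,x>/s, and m' likewise, the terms of
  first order in y or y' cancel and s(1 - Q(y,y')) remains; this is also the origin of
  \<open>proj_form\<close>.\<close>

definition proj_factor :: "complex^'n \<Rightarrow> complex^'n \<Rightarrow> complex"
  where "proj_factor x y = 1 + herm y x / of_real (defect x)"

definition proj_point :: "complex^'n \<Rightarrow> complex^'n \<Rightarrow> complex^'n"
  where "proj_point x y = x + inverse (proj_factor x y) *s y"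

definition proj_form :: "complex^'n \<Rightarrow> complex^'n \<Rightarrow> complex^'n \<Rightarrow> complex"
  where "proj_form x y y' = (of_real (defect x) * herm y y' + herm y x * herm x y') / (of_real (defect x))\<^sup>2"

definition proj_kernel :: "complex^'n \<Rightarrow> complex^'n \<Rightarrow> complex^'n \<Rightarrow> complex"
  where "proj_kernel x y y' = inverse ((1 - proj_form x y y') ^ Suc CARD('n))"

lemma defect_pos: "norm x < 1 \<Longrightarrow> defect x > 0"
  by (simp add: defect_def abs_square_less_1)

lemma proj_form_cnj: "cnj (proj_form x y y') = proj_form x y' y"
  by (simp add: proj_form_def cnj_herm mult.commute)

lemma proj_kernel_cnj: "cnj (proj_kernel x y y') = proj_kernel x y' y"
  by (simp add: proj_kernel_def proj_form_cnj)

lemma proj_form_diff_left: "proj_form x (y - z) w = proj_form x y w - proj_form x z w"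
  and proj_form_diff_right: "proj_form x w (y - z) = proj_form x w y - proj_form x w z"
  and proj_form_scaleR_left: "proj_form x (r *\<^sub>R y) w = of_real r * proj_form x y w"
  and proj_form_scaleR_right: "proj_form x w (r *\<^sub>R y) = of_real r * proj_form x w y"
  and proj_form_zero_left [simp]: "proj_form x 0 w = 0"
  and proj_form_zero_right [simp]: "proj_form x w 0 = 0"
  by (simp_all add: proj_form_def herm_diff_left herm_diff_right herm_scaleR_left herm_scaleR_right
      scaleR_conv_of_real[where 'a = complex] diff_divide_distrib add_divide_distrib algebra_simps)

lemma herm_mult_cnj: "herm y x * herm x y = of_real ((cmod (herm y x))\<^sup>2)"
  unfolding complex_norm_square cnj_herm ..

lemma proj_form_self:
  "proj_form x y y = of_real ((defect x * (norm y)\<^sup>2 + (cmod (herm y x))\<^sup>2) / (defect x)\<^sup>2)"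
  unfolding proj_form_def herm_mult_cnj herm_self by simp

lemma proj_form_self_nonneg: "norm x < 1 \<Longrightarrow> 0 \<le> Re (proj_form x y y)"
  unfolding proj_form_self Re_complex_of_real using defect_pos[of x] by simp

text \<open>Since |<y,x>|^2 <= |y|^2 (1 - s), the numerator s|y|^2 + |<y,x>|^2 is at most |y|^2.
  Later smallness conditions are therefore imposed on |y|/s.\<close>

lemma proj_form_self_le:
  assumes "norm x < 1"
  shows "Re (proj_form x y y) \<le> (norm y / defect x)\<^sup>2"
proof -
  have "(cmod (herm y x))\<^sup>2 \<le> (norm y * norm x)\<^sup>2"
    by (intro power_mono norm_herm_le) simp
  then have "defect x * (norm y)\<^sup>2 + (cmod (herm y x))\<^sup>2 \<le> (norm y)\<^sup>2"
    by (simp add: defect_def power_mult_distrib algebra_simps)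
  then show ?thesis
    unfolding proj_form_self Re_complex_of_real power_divide using defect_pos[OF assms]
    by (intro divide_right_mono) auto
qed

lemma proj_form_Cauchy_Schwarz:
  assumes "norm x < 1"
  shows "(cmod (proj_form x y z))\<^sup>2 \<le> Re (proj_form x y y) * Re (proj_form x z z)"
proof -
  define s a b where "s = defect x" and "a = cmod (herm y x)" and "b = cmod (herm z x)"
  have s: "s > 0" using defect_pos[OF assms] by (simp add: s_def)
  have hb: "cmod (herm x z) = b" unfolding b_def by (metis cnj_herm complex_mod_cnj)
  have "cmod (of_real s * herm y z + herm y x * herm x z) \<le> s * (norm y * norm z) + a * b"
    using norm_herm_le[of y z] s 
    by (intro norm_triangle_le add_mono) (auto simp: norm_mult a_def hb)
  then have "(cmod (of_real s * herm y z + herm y x * herm x z))\<^sup>2 \<le> (s * (norm y * norm z) + a * b)\<^sup>2"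
    by (intro power_mono) auto
  also have "\<dots> \<le> (s * (norm y)\<^sup>2 + a\<^sup>2) * (s * (norm z)\<^sup>2 + b\<^sup>2)"
  proof -
    \<comment> \<open>Planar Cauchy-Schwarz for the vectors (sqrt s |y|, a) and (sqrt s |z|, b),
      with its defect written out as a square.\<close>
    have "(s * (norm y)\<^sup>2 + a\<^sup>2) * (s * (norm z)\<^sup>2 + b\<^sup>2) - (s * (norm y * norm z) + a * b)\<^sup>2 = s * (norm y * b - norm z * a)\<^sup>2"
      by (simp add: power2_eq_square algebra_simps)
    then show ?thesis using s by (smt (verit) mult_nonneg_nonneg zero_le_power2)
  qed
  finally have main: "(cmod (of_real s * herm y z + herm y x * herm x z))\<^sup>2 \<le> (s * (norm y)\<^sup>2 + a\<^sup>2) * (s * (norm z)\<^sup>2 + b\<^sup>2)" .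
  have "(cmod (proj_form x y z))\<^sup>2 = (cmod (of_real s * herm y z + herm y x * herm x z))\<^sup>2 / (s\<^sup>2)\<^sup>2"
    unfolding proj_form_def s_def[symmetric] norm_divide power_divide by (simp add: norm_power)
  also have "\<dots> \<le> ((s * (norm y)\<^sup>2 + a\<^sup>2) * (s * (norm z)\<^sup>2 + b\<^sup>2)) / (s\<^sup>2)\<^sup>2"
    by (rule divide_right_mono[OF main]) simp
  also have "\<dots> = Re (proj_form x y y) * Re (proj_form x z z)"
    unfolding proj_form_self Re_complex_of_real s_def[symmetric] a_def[symmetric] b_def[symmetric]
    by (simp add: power2_eq_square)
  finally show ?thesis .
qed

lemma proj_factor_nonzero:
  assumes "norm x < 1" "norm y < defect x"
  shows "proj_factor x y \<noteq> 0"
proof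
  assume "proj_factor x y = 0"
  then have "herm y x = - of_real (defect x)"
    using defect_pos[OF assms(1)] by (simp add: proj_factor_def add_eq_0_iff field_simps)
  then have "defect x = cmod (herm y x)" using defect_pos[OF assms(1)] by simp
  also have "\<dots> \<le> norm y * norm x" by (rule norm_herm_le)
  also have "\<dots> \<le> norm y" using assms(1) by (simp add: mult_left_le)
  finally show False using assms(2) by simp
qed

lemma one_minus_herm_proj_point:
  assumes "norm x < 1" "proj_factor x y \<noteq> 0" "proj_factor x y' \<noteq> 0"
  shows "(1 - herm (proj_point x y) (proj_point x y')) * (proj_factor x y * cnj (proj_factor x y'))
    = of_real (defect x) * (1 - proj_form x y y')"
proof -
  define s m m' where "s = complex_of_real (defect x)" and "m = proj_factor x y" and "m' = cnj (proj_factor x y')"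
  have s0: "s \<noteq> 0" using defect_pos[OF assms(1)] by (simp add: s_def)
  have mm: "m \<noteq> 0" "m' \<noteq> 0" using assms by (auto simp: m_def m'_def)
  have h1: "herm y x = s * (m - 1)" using s0 by (simp add: m_def proj_factor_def s_def)
  have h2: "herm x y' = s * (m' - 1)" using s0 by (simp add: m'_def proj_factor_def s_def cnj_herm)
  have xx: "herm x x = 1 - s" by (simp add: herm_self s_def defect_def)
  have H: "herm (proj_point x y) (proj_point x y') = (1 - s) + inverse m * (s * (m - 1)) + inverse m' * (s * (m' - 1)) + inverse m * inverse m' * herm y y'"
    by (simp add: proj_point_def herm_add_left herm_add_right herm_scale_left herm_scale_right xx h1 h2 m_def[symmetric] m'_def[symmetric] algebra_simps)
  have Q: "proj_form x y y' = herm y y' / s + (m - 1) * (m' - 1)"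
    unfolding proj_form_def s_def[symmetric] h1 h2 using s0 by (simp add: power2_eq_square add_divide_distrib)
  show ?thesis unfolding s_def[symmetric] m_def[symmetric] m'_def[symmetric] H Q
    using mm s0 by (simp add: field_simps)
qed

text \<open>On the diagonal the kernel identity reads (1 - |z|^2)|m|^2 = s(1 - Q(y,y)), and |y| < s
  makes Q(y,y) < 1.\<close>

lemma norm_proj_point:
  assumes x: "norm x < 1" and y: "norm y < defect x"
  shows "norm (proj_point x y) < 1"
proof -
  define m where "m = proj_factor x y"
  have m: "m \<noteq> 0" using proj_factor_nonzero[OF x y] by (simp add: m_def)
  have "norm y / defect x < 1" using y defect_pos[OF x] by simp
  then have "(norm y / defect x)\<^sup>2 < 1" using defect_pos[OF x] by (simp add: power_less_one_iff abs_square_less_1)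
  then have q: "Re (proj_form x y y) < 1" using proj_form_self_le[OF x, of y] by linarith
  have r: "proj_form x y y = of_real (Re (proj_form x y y))" unfolding proj_form_self by simp
  have "complex_of_real ((1 - (norm (proj_point x y))\<^sup>2) * (cmod m)\<^sup>2) = of_real (defect x * (1 - Re (proj_form x y y)))"
    using one_minus_herm_proj_point[OF x m[unfolded m_def] m[unfolded m_def]]
    unfolding m_def[symmetric] complex_norm_square[symmetric] herm_self
    by (subst (asm) r) (simp only: of_real_mult of_real_diff of_real_1)
  then have "(1 - (norm (proj_point x y))\<^sup>2) * (cmod m)\<^sup>2 = defect x * (1 - Re (proj_form x y y))"
    using of_real_eq_iff by blast
  also have "\<dots> > 0" using q defect_pos[OF x] by simp
  finally have "1 - (norm (proj_point x y))\<^sup>2 > 0" using m by (simp add: zero_less_mult_iff)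
  then show ?thesis by (simp add: abs_square_less_1)
qed

definition proj_system :: "complex^'n \<Rightarrow> real \<Rightarrow> (complex^'n \<Rightarrow> complex^'n) \<Rightarrow> complex^'n \<Rightarrow> complex^'n \<Rightarrow> complex^'n"
  where "proj_system \<omega> R f x y = inverse (proj_factor x y) ^ Suc CARD('n) *s f (\<omega> + R *\<^sub>R proj_point x y)"

lemma proj_system_functional_bound:
  fixes f :: "complex^'n \<Rightarrow> complex^'n" and y :: "'i \<Rightarrow> complex^'n"
  assumes f: "f \<in> A2_system \<omega> R" and R: "R > 0" and I: "finite I" 
    and x: "norm x < 1" and y: "\<And>i. i \<in> I \<Longrightarrow> norm (y i) < defect x"
  shows "(norm (\<Sum>i\<in>I. c i *s proj_system \<omega> R f x (y i)))\<^sup>2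
    \<le> (A2_system_norm \<omega> R f)\<^sup>2 / defect x ^ Suc CARD('n) * Re (\<Sum>i\<in>I. \<Sum>j\<in>I. c i * cnj (c j) * proj_kernel x (y i) (y j))"
proof -
  let ?N = "Suc CARD('n)"
  define m where "m i = proj_factor x (y i)" for i
  define d where "d i = c i * inverse (m i) ^ ?N" for i
  have m: "m i \<noteq> 0" if "i \<in> I" for i using proj_factor_nonzero[OF x y[OF that]] by (simp add: m_def)
  have s: "defect x > 0" by (rule defect_pos[OF x])
  have "(norm (\<Sum>i\<in>I. d i *s f (\<omega> + R *\<^sub>R proj_point x (y i))))\<^sup>2
    \<le> (A2_system_norm \<omega> R f)\<^sup>2 * Re (\<Sum>i\<in>I. \<Sum>j\<in>I. d i * cnj (d j) * bergman_kernel (proj_point x (y j)) (proj_point x (y i)))"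
    by (rule A2_system_functional_bound[where x = "\<lambda>i. proj_point x (y i)", OF f R I]) (rule norm_proj_point[OF x y])
  also have "(\<Sum>i\<in>I. \<Sum>j\<in>I. d i * cnj (d j) * bergman_kernel (proj_point x (y j)) (proj_point x (y i)))
     = (\<Sum>i\<in>I. \<Sum>j\<in>I. of_real (1 / defect x ^ ?N) * (c i * cnj (c j) * proj_kernel x (y i) (y j)))"
  proof (intro sum.cong refl)
    fix i j assume ij: "i \<in> I" "j \<in> I"
    define P where "P = 1 - herm (proj_point x (y i)) (proj_point x (y j))"
    have "P * (m i * cnj (m j)) = of_real (defect x) * (1 - proj_form x (y i) (y j))"
      using one_minus_herm_proj_point[OF x m[OF ij(1), unfolded m_def] m[OF ij(2), unfolded m_def]]
      by (simp add: P_def m_def)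
    then have "inverse ((P * (m i * cnj (m j))) ^ ?N) = inverse ((of_real (defect x) * (1 - proj_form x (y i) (y j))) ^ ?N)"
      by simp
    then have "inverse (m i) ^ ?N * cnj (inverse (m j) ^ ?N) * inverse (P ^ ?N) = of_real (1 / defect x ^ ?N) * proj_kernel x (y i) (y j)"
      unfolding power_mult_distrib proj_kernel_def by (simp add: power_inverse divide_inverse mult_ac)
    then show "d i * cnj (d j) * bergman_kernel (proj_point x (y j)) (proj_point x (y i))
        = of_real (1 / defect x ^ ?N) * (c i * cnj (c j) * proj_kernel x (y i) (y j))"
      unfolding d_def bergman_kernel_def P_def[symmetric] complex_cnj_mult by (simp only: mult_ac)
  qed
  also have "\<dots> = of_real (1 / defect x ^ ?N) * (\<Sum>i\<in>I. \<Sum>j\<in>I. c i * cnj (c j) * proj_kernel x (y i) (y j))"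
    by (simp only: sum_distrib_left)
  also have "Re \<dots> = 1 / defect x ^ ?N * Re (\<Sum>i\<in>I. \<Sum>j\<in>I. c i * cnj (c j) * proj_kernel x (y i) (y j))"
    by simp
  also have "(\<Sum>i\<in>I. d i *s f (\<omega> + R *\<^sub>R proj_point x (y i))) = (\<Sum>i\<in>I. c i *s proj_system \<omega> R f x (y i))"
    by (simp only: d_def proj_system_def m_def vector_smult_assoc)
  finally show ?thesis by simp
qed

section \<open>Functionals with a derivative\<close>

lemma A2_system_has_derivative:
  fixes f :: "complex^'n \<Rightarrow> complex^'n"
  assumes "f \<in> A2_system \<omega> R" "a \<in> ball \<omega> R"
  shows "(f has_derivative (\<lambda>v. D f a *v v)) (at a)"
proof -
  have "\<exists>l. ((\<lambda>z. f z $ i) has_derivative (\<lambda>v. \<Sum>j\<in>UNIV. l j * v $ j)) (at a)" for i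
    using assms analytic_in_imp_holo_on[of "\<lambda>z. f z $ i" "ball \<omega> R"]
    by (auto simp: A2_system_def A2_def holo_on_def)
  then obtain l where l: "\<And>i. ((\<lambda>z. f z $ i) has_derivative (\<lambda>v. \<Sum>j\<in>UNIV. l i j * v $ j)) (at a)"
    by metis
  have ax: "linear (\<lambda>c::complex. axis i c :: complex^'n)" for i
    by (rule linearI) (auto simp: vec_eq_iff axis_def)
  have vs: "(\<Sum>i\<in>UNIV. axis i (x $ i)) = x" for x :: "complex^'n"
    by (simp add: vec_eq_iff axis_def)
  have "((\<lambda>z. \<Sum>i\<in>UNIV. axis i (f z $ i)) has_derivative (\<lambda>v. \<Sum>i\<in>UNIV. axis i (\<Sum>j\<in>UNIV. l i j * v $ j))) (at a)"
    using diff_chain_at[OF l linear_imp_has_derivative[OF ax]] by (intro has_derivative_sum) (auto simp: o_def)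
  then have d: "(f has_derivative (\<lambda>v. \<Sum>i\<in>UNIV. axis i (\<Sum>j\<in>UNIV. l i j * v $ j))) (at a)"
    by (simp add: vs)
  have "frechet_derivative f (at a) = (\<lambda>v. \<Sum>i\<in>UNIV. axis i (\<Sum>j\<in>UNIV. l i j * v $ j))"
    using frechet_derivative_at[OF d] by simp
  then have "D f a $ i $ j = l i j" for i j
    by (simp add: D_def matrix_def axis_def if_distrib cong: if_cong)
  then have "D f a *v v = (\<Sum>i\<in>UNIV. axis i (\<Sum>j\<in>UNIV. l i j * v $ j))" for v
    by (simp add: vec_eq_iff matrix_vector_mult_def axis_def)
  then show ?thesis using d by simp
qed

lemma filterlim_of_real_at_right_0: "filterlim complex_of_real (at 0) (at_right 0)"
  unfolding filterlim_at
proof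
  show "\<forall>\<^sub>F t in at_right 0. complex_of_real t \<in> UNIV \<and> complex_of_real t \<noteq> 0"
    using eventually_at_right_less[of "0::real"] by (rule eventually_mono) auto
  show "(complex_of_real \<longlongrightarrow> 0) (at_right 0)"
  proof -
    have "((\<lambda>t. complex_of_real t) \<longlongrightarrow> of_real 0) (at_right 0)" by (intro tendsto_of_real tendsto_ident_at)
    then show ?thesis by simp
  qed
qed

lemma filterlim_square_at_right_0: "filterlim (\<lambda>t::real. t\<^sup>2) (at_right 0) (at_right 0)"
  unfolding filterlim_at
proof
  show "\<forall>\<^sub>F t in at_right 0. (t::real)\<^sup>2 \<in> {0<..} \<and> t\<^sup>2 \<noteq> 0"
    using eventually_at_right_less[of "0::real"] by (rule eventually_mono) auto
  have "((\<lambda>t::real. t\<^sup>2) \<longlongrightarrow> 0\<^sup>2) (at_right 0)" by (intro tendsto_intros)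
  then show "((\<lambda>t::real. t\<^sup>2) \<longlongrightarrow> 0) (at_right 0)" by simp
qed

lemma difference_quotient_at_right:
  assumes "(W has_field_derivative d) (at 0)"
  shows "((\<lambda>t. (W (complex_of_real t) - W 0) / of_real t) \<longlongrightarrow> d) (at_right 0)"
  using filterlim_compose[OF assms[unfolded DERIV_def] filterlim_of_real_at_right_0] by simp

text \<open>To first order y/m is y itself, which contributes R Df q; the multiplier m^-N
  contributes -N<q,x>/s times f by the product rule.\<close>

lemma proj_system_difference_quotient:
  fixes f :: "complex^'n \<Rightarrow> complex^'n"
  assumes f: "f \<in> A2_system \<omega> R" and R: "R > 0" and x: "norm x < 1"
  shows "((\<lambda>t. (1 / t) *\<^sub>R (proj_system \<omega> R f x (t *\<^sub>R q) - proj_system \<omega> R f x 0)) \<longlongrightarrow>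
     R *\<^sub>R (D f (\<omega> + R *\<^sub>R x) *v q) - (of_nat (Suc CARD('n)) * herm q x / of_real (defect x)) *s f (\<omega> + R *\<^sub>R x)) (at_right 0)"
proof (rule vec_tendstoI)
  fix i
  let ?N = "Suc CARD('n)"
  define a where "a = \<omega> + R *\<^sub>R x"
  define \<eta> where "\<eta> = herm q x / of_real (defect x)"
  define u where "u c = inverse (1 + c * \<eta>) * c" for c
  define W where "W c = inverse (1 + c * \<eta>) ^ ?N * f (a + R *\<^sub>R (u c *s q)) $ i" for c
  have a: "a \<in> ball \<omega> R" using x R by (simp add: a_def dist_norm)
  have fi: "((\<lambda>z. f z $ i) has_derivative (\<lambda>v. (D f a *v v) $ i)) (at a)"
    using bounded_linear.has_derivative[OF bounded_linear_vec_nth A2_system_has_derivative[OF f a]] .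
  have "(u has_field_derivative 1) (at 0)"
    unfolding u_def[abs_def] by (auto intro!: derivative_eq_intros)
  then have u: "(u has_derivative (\<lambda>c. 1 * c)) (at 0)" unfolding has_field_derivative_def .
  have "linear (\<lambda>c::complex. R *\<^sub>R (c *s q))" by (rule linearI) (auto simp: vec_eq_iff algebra_simps)
  from diff_chain_at[OF u linear_imp_has_derivative[OF this]]
  have "((\<lambda>c. a + R *\<^sub>R (u c *s q)) has_derivative (\<lambda>c. R *\<^sub>R (c *s q))) (at 0)"
    using has_derivative_add[OF has_derivative_const, of _ _ "at 0" a] by (simp add: o_def)
  from diff_chain_at[OF this, of "\<lambda>z. f z $ i"] fi
  have "((\<lambda>c. f (a + R *\<^sub>R (u c *s q)) $ i) has_derivative (\<lambda>c. (D f a *v (R *\<^sub>R (c *s q))) $ i)) (at 0)"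
    by (simp add: o_def u_def)
  moreover have "(D f a *v (R *\<^sub>R (c *s q))) $ i = (of_real R * (D f a *v q) $ i) * c" for c
    by (simp add: matrix_vector_mult_def sum_distrib_left sum_distrib_right scaleR_conv_of_real[where 'a = complex] mult_ac)
  ultimately have "((\<lambda>c. f (a + R *\<^sub>R (u c *s q)) $ i) has_field_derivative (of_real R * (D f a *v q) $ i)) (at 0)"
    unfolding has_field_derivative_def by simp
  moreover have "((\<lambda>c. inverse (1 + c * \<eta>) ^ ?N) has_field_derivative (- of_nat ?N * \<eta>)) (at 0)"
    by (auto intro!: derivative_eq_intros simp: algebra_simps)
  ultimately have "(W has_field_derivative (of_real R * (D f a *v q) $ i - of_nat ?N * \<eta> * f a $ i)) (at 0)"
    unfolding W_def[abs_def] by (auto intro!: derivative_eq_intros simp: u_def algebra_simps)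
  from difference_quotient_at_right[OF this]
  have lim: "((\<lambda>t. (W (complex_of_real t) - W 0) / of_real t) \<longlongrightarrow> of_real R * (D f a *v q) $ i - of_nat ?N * \<eta> * f a $ i) (at_right 0)" .
  have pW: "proj_system \<omega> R f x (t *\<^sub>R q) $ i = W (of_real t)" for t
  proof -
    have "proj_factor x (t *\<^sub>R q) = 1 + of_real t * \<eta>"
      by (simp add: proj_factor_def \<eta>_def herm_scaleR_left scaleR_conv_of_real[where 'a = complex])
    moreover have "\<omega> + R *\<^sub>R (x + inverse (1 + of_real t * \<eta>) *s (t *\<^sub>R q)) = a + R *\<^sub>R (u (of_real t) *s q)"
      by (simp add: a_def u_def vec_eq_iff scaleR_conv_of_real[where 'a = complex] algebra_simps)
    ultimately show ?thesis by (simp only: proj_system_def proj_point_def W_def vector_smult_component)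
  qed
  have pW0: "proj_system \<omega> R f x 0 $ i = W 0" using pW[of 0] by simp
  show "((\<lambda>t. ((1 / t) *\<^sub>R (proj_system \<omega> R f x (t *\<^sub>R q) - proj_system \<omega> R f x 0)) $ i) \<longlongrightarrow>
     (R *\<^sub>R (D f (\<omega> + R *\<^sub>R x) *v q) - (of_nat ?N * herm q x / of_real (defect x)) *s f (\<omega> + R *\<^sub>R x)) $ i) (at_right 0)"
    using lim by (simp add: pW pW0 a_def \<eta>_def scaleR_conv_of_real[where 'a = complex] divide_inverse mult_ac del: of_nat_Suc)
qed

lemma inverse_power_difference_quotient:
  "((\<lambda>t. (inverse ((1 - complex_of_real t * z) ^ N) - 1) / of_real t) \<longlongrightarrow> of_nat N * z) (at_right 0)"
proof -
  have "((\<lambda>c. inverse ((1 - c * z) ^ N)) has_field_derivative (of_nat N * z)) (at 0)"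
    by (auto intro!: derivative_eq_intros)
  from difference_quotient_at_right[OF this] show ?thesis by simp
qed

lemma proj_kernel_0 [simp]: "proj_kernel x y 0 = 1" "proj_kernel x 0 y = 1"
  by (simp_all add: proj_kernel_def)

text \<open>The functional is a limit, as t tends to 0 from the right, of combinations of four
  values: at y, z, tq and 0 with coefficients a, -a, -1/t and 1/t. The bound for finite combinations
  passes to the limit, because (K(y,tq) - 1)/t tends to N Q(y,q) and K(tq,tq) - 1 is of order t^2,
  as the factor 1/t^2 requires.\<close>

lemma proj_system_derivative_bound:
  fixes f :: "complex^'n \<Rightarrow> complex^'n" and a :: real
  assumes f: "f \<in> A2_system \<omega> R" and R: "R > 0" and x: "norm x < 1"
    and y: "norm y < defect x" and z: "norm z < defect x"
  defines "N \<equiv> Suc CARD('n)"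
  shows "(norm (a *\<^sub>R (proj_system \<omega> R f x y - proj_system \<omega> R f x z)
      - (R *\<^sub>R (D f (\<omega> + R *\<^sub>R x) *v q) - (of_nat N * herm q x / of_real (defect x)) *s f (\<omega> + R *\<^sub>R x))))\<^sup>2
    \<le> (A2_system_norm \<omega> R f)\<^sup>2 / defect x ^ N *
       (a\<^sup>2 * Re (proj_kernel x y y + proj_kernel x z z - 2 * proj_kernel x y z)
        - 2 * a * N * Re (proj_form x (y - z) q) + N * Re (proj_form x q q))"
proof -
  let ?G = "proj_system \<omega> R f x"
  let ?k = "proj_kernel x"
  let ?L = "(A2_system_norm \<omega> R f)\<^sup>2 / defect x ^ N"
  \<comment> \<open>The four-point kernel form, grouped into quotients with finite limits; the
    values K(w,0) = K(0,w) = 1 supply the subtracted ones.\<close>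
  define E where "E t = a\<^sup>2 * Re (?k y y + ?k z z - 2 * ?k y z)
      - 2 * a * Re ((?k y (t *\<^sub>R q) - 1) / of_real t - (?k z (t *\<^sub>R q) - 1) / of_real t)
      + Re ((?k (t *\<^sub>R q) (t *\<^sub>R q) - 1) / of_real (t\<^sup>2))" for t
  have s: "defect x > 0" by (rule defect_pos[OF x])
  have step: "(norm (a *\<^sub>R (?G y - ?G z) - (1 / t) *\<^sub>R (?G (t *\<^sub>R q) - ?G 0)))\<^sup>2 \<le> ?L * E t"
    if t: "0 < t" "t * norm q < defect x" for t
  proof -
    define c where "c = (\<lambda>i::nat. [of_real a, - of_real a, - of_real (1 / t), complex_of_real (1 / t)] ! i)"
    define p where "p = (\<lambda>i::nat. [y, z, t *\<^sub>R q, 0] ! i)"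
    have "(norm (\<Sum>i\<in>{0,1,2,3::nat}. c i *s ?G (p i)))\<^sup>2 \<le> ?L * Re (\<Sum>i\<in>{0,1,2,3::nat}. \<Sum>j\<in>{0,1,2,3::nat}. c i * cnj (c j) * ?k (p i) (p j))"
      unfolding N_def by (rule proj_system_functional_bound[OF f R _ x]) (use y z t s in \<open>auto simp: p_def\<close>)
    also have "(\<Sum>i\<in>{0,1,2,3::nat}. c i *s ?G (p i)) = a *\<^sub>R (?G y - ?G z) - (1 / t) *\<^sub>R (?G (t *\<^sub>R q) - ?G 0)"
      by (simp add: c_def p_def vec_eq_iff scaleR_conv_of_real[where 'a = complex] algebra_simps)
    also have "Re (\<Sum>i\<in>{0,1,2,3::nat}. \<Sum>j\<in>{0,1,2,3::nat}. c i * cnj (c j) * ?k (p i) (p j)) = E t"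
    proof -
      have r: "Re (?k z y) = Re (?k y z)" "Re (?k (t *\<^sub>R q) y) = Re (?k y (t *\<^sub>R q))" "Re (?k (t *\<^sub>R q) z) = Re (?k z (t *\<^sub>R q))"
        by (metis proj_kernel_cnj complex_cnj(1) cnj.sel(1))+
      have r': "Re (complex_of_real u * w) = u * Re w" for u w by simp
      have "(\<Sum>i\<in>{0,1,2,3::nat}. \<Sum>j\<in>{0,1,2,3::nat}. c i * cnj (c j) * ?k (p i) (p j))
         = of_real (a\<^sup>2) * (?k y y + ?k z z - ?k y z - ?k z y)
          - of_real (a / t) * (?k y (t *\<^sub>R q) + ?k (t *\<^sub>R q) y - ?k z (t *\<^sub>R q) - ?k (t *\<^sub>R q) z)
          + of_real (1 / t\<^sup>2) * (?k (t *\<^sub>R q) (t *\<^sub>R q) - 1)"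
        by (simp add: c_def p_def power2_eq_square algebra_simps)
      also have "Re \<dots> = E t"
        unfolding E_def minus_complex.sel plus_complex.sel r' r
        by (simp add: r Re_divide_of_real diff_divide_distrib algebra_simps del: of_real_power)
      finally show ?thesis .
    qed
    finally show ?thesis .
  qed
  have limE: "(E \<longlongrightarrow> a\<^sup>2 * Re (?k y y + ?k z z - 2 * ?k y z)
      - 2 * a * Re (of_nat N * proj_form x y q - of_nat N * proj_form x z q) + Re (of_nat N * proj_form x q q)) (at_right 0)"
  proof -
    have k: "?k w (t *\<^sub>R q) = inverse ((1 - of_real t * proj_form x w q) ^ N)" for w t
      by (simp add: proj_kernel_def proj_form_scaleR_right N_def)
    have kk: "?k (t *\<^sub>R q) (t *\<^sub>R q) = inverse ((1 - of_real (t\<^sup>2) * proj_form x q q) ^ N)" for t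
      by (simp add: proj_kernel_def proj_form_scaleR_right proj_form_scaleR_left N_def power2_eq_square mult.assoc)
    show ?thesis unfolding E_def[abs_def] unfolding kk unfolding k
      by (intro tendsto_intros inverse_power_difference_quotient
          filterlim_compose[OF inverse_power_difference_quotient filterlim_square_at_right_0])
  qed
  have ev: "\<forall>\<^sub>F t in at_right 0. (norm (a *\<^sub>R (?G y - ?G z) - (1 / t) *\<^sub>R (?G (t *\<^sub>R q) - ?G 0)))\<^sup>2 \<le> ?L * E t"
  proof -
    have "\<forall>\<^sub>F t in at_right 0. t \<in> {0<..<defect x / (norm q + 1)}"
      by (rule eventually_at_right_real) (use s in \<open>simp add: add_nonneg_pos\<close>)
    then show ?thesis
    proof (rule eventually_mono)
      fix t assume t: "t \<in> {0<..<defect x / (norm q + 1)}"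
      then have "t * (norm q + 1) < defect x" by (simp add: pos_less_divide_eq add_nonneg_pos)
      then show "(norm (a *\<^sub>R (?G y - ?G z) - (1 / t) *\<^sub>R (?G (t *\<^sub>R q) - ?G 0)))\<^sup>2 \<le> ?L * E t"
        using t by (intro step) (auto simp: algebra_simps)
    qed
  qed
  have "(norm (a *\<^sub>R (?G y - ?G z)
      - (R *\<^sub>R (D f (\<omega> + R *\<^sub>R x) *v q) - (of_nat N * herm q x / of_real (defect x)) *s f (\<omega> + R *\<^sub>R x))))\<^sup>2
    \<le> ?L * (a\<^sup>2 * Re (?k y y + ?k z z - 2 * ?k y z)
      - 2 * a * Re (of_nat N * proj_form x y q - of_nat N * proj_form x z q) + Re (of_nat N * proj_form x q q))"
    unfolding N_def
    by (rule tendsto_le[OF _ tendsto_mult[OF tendsto_const limE[unfolded N_def]] _ ev[unfolded N_def]])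
       (auto intro!: tendsto_power tendsto_norm tendsto_diff tendsto_const proj_system_difference_quotient[OF f R x] simp del: of_nat_Suc)
  then show ?thesis by (simp add: proj_form_diff_left algebra_simps)
qed

section \<open>Estimates of the kernel\<close>

lemma binomial_le_power: "((n + k) choose k) \<le> Suc n ^ k"
proof (induction k)
  case (Suc k)
  have "Suc k * ((n + Suc k) choose Suc k) = Suc (n + k) * ((n + k) choose k)"
    using Suc_times_binomial_eq[of "n + k" k] by (simp add: mult.commute)
  also have "\<dots> \<le> (Suc n * Suc k) * Suc n ^ k"
    by (intro mult_mono Suc) auto
  finally have "Suc k * ((n + Suc k) choose Suc k) \<le> Suc k * Suc n ^ Suc k"
    by (simp only: power_Suc mult_ac)
  then show ?case by (metis Suc_mult_le_cancel1)
qed simp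

lemma twice_Re_le_add:
  assumes "(cmod w)\<^sup>2 \<le> x * y" "0 \<le> x" "0 \<le> y"
  shows "2 * Re w \<le> x + y"
proof -
  have "(2 * cmod w)\<^sup>2 \<le> (x + y)\<^sup>2"
    using assms(1) zero_le_power2[of "x - y"] by (simp add: power2_eq_square algebra_simps)
  then have "2 * cmod w \<le> x + y" by (rule power2_le_imp_le) (use assms in simp)
  then show ?thesis using complex_Re_le_cmod[of w] by linarith
qed

text \<open>For vectors with \<open>a = \<parallel>u\<parallel>\<^sup>2\<close>, \<open>b = \<parallel>v\<parallel>\<^sup>2\<close>, \<open>c = \<langle>u,v\<rangle>\<close> the left-hand side is \<open>\<parallel>u\<^sup>\<otimes>\<^sup>k - v\<^sup>\<otimes>\<^sup>k\<parallel>\<^sup>2\<close>;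
  the induction splits \<open>u \<otimes> A - v \<otimes> B\<close> as \<open>(u - v) \<otimes> A + v \<otimes> (A - B)\<close>.\<close>

lemma tensor_power_difference_bound:
  fixes a b \<tau> :: real and c :: complex
  assumes a: "0 \<le> a" "a \<le> \<tau>" and b: "0 \<le> b" "b \<le> \<tau>" and c: "(cmod c)\<^sup>2 \<le> a * b"
  shows "a ^ Suc k + b ^ Suc k - 2 * Re (c ^ Suc k) \<le> (real (Suc k))\<^sup>2 * \<tau> ^ k * (a + b - 2 * Re c)"
proof (induction k)
  case 0 then show ?case by simp
next
  case (Suc k)
  define m where "m = Suc k"
  define e d where "e = a + b - 2 * Re c" and "d = a ^ m + b ^ m - 2 * Re (c ^ m)"
  have \<tau>: "0 \<le> \<tau>" using a by simp
  have cm: "(cmod c ^ m)\<^sup>2 \<le> a ^ m * b ^ m"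
    using power_mono[OF c, of m] by (simp add: power_mult_distrib flip: power_mult) (simp add: mult.commute)
  have e0: "0 \<le> e" using twice_Re_le_add[OF c a(1) b(1)] by (simp add: e_def)
  have d0: "0 \<le> d" using twice_Re_le_add[of "c ^ m" "a ^ m" "b ^ m"] cm a b by (simp add: d_def norm_power)
  have sq: "(cmod (w - of_real t))\<^sup>2 = (cmod w)\<^sup>2 - 2 * t * Re w + t\<^sup>2" for w t
    unfolding cmod_power2 by (simp add: power2_eq_square algebra_simps)
  have 1: "(cmod (c - of_real b))\<^sup>2 \<le> b * e"
    \<comment> \<open>With A and B the m-th tensor powers of u and v, this bound and the next are
      Cauchy-Schwarz for <u - v, v> and <A, B - A>, expressed through a, b and c alone.\<close>
    unfolding sq e_def using c by (simp add: power2_eq_square algebra_simps)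
  have 2: "(cmod (c ^ m - of_real (a ^ m)))\<^sup>2 \<le> a ^ m * d"
    unfolding sq d_def using cm by (simp add: norm_power power2_eq_square algebra_simps)
  have "a ^ Suc m + b ^ Suc m - 2 * Re (c ^ Suc m) = e * a ^ m + b * d + 2 * Re ((c - of_real b) * (of_real (a ^ m) - c ^ m))"
    by (simp add: e_def d_def algebra_simps flip: of_real_power)
  also have "Re ((c - of_real b) * (of_real (a ^ m) - c ^ m)) \<le> cmod (c - of_real b) * cmod (c ^ m - of_real (a ^ m))"
    by (metis complex_Re_le_cmod norm_minus_commute norm_mult)
  also have "\<dots> \<le> sqrt (b * e) * sqrt (a ^ m * d)"
    by (intro mult_mono real_le_rsqrt 1 2) (use b e0 in auto)
  also have "\<dots> = sqrt (e * a ^ m) * sqrt (b * d)"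
    unfolding real_sqrt_mult[symmetric] by (simp add: mult_ac)
  finally have "a ^ Suc m + b ^ Suc m - 2 * Re (c ^ Suc m) \<le> e * a ^ m + b * d + 2 * (sqrt (e * a ^ m) * sqrt (b * d))" by simp
  also have "\<dots> = (sqrt (e * a ^ m) + sqrt (b * d))\<^sup>2"
    using a b e0 d0 by (simp add: power2_sum)
  also have "\<dots> \<le> (sqrt (e * \<tau> ^ m) + real m * sqrt (e * \<tau> ^ m))\<^sup>2"
  proof (intro power_mono add_mono)
    show "sqrt (e * a ^ m) \<le> sqrt (e * \<tau> ^ m)" using a e0 by (intro real_sqrt_le_mono mult_left_mono power_mono) auto
    have "b * d \<le> \<tau> * ((real m)\<^sup>2 * \<tau> ^ k * e)"
      using Suc.IH b d0 \<tau> by (intro mult_mono) (auto simp: d_def e_def m_def)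
    also have "\<dots> = (real m)\<^sup>2 * (e * \<tau> ^ m)" by (simp add: m_def)
    finally have "sqrt (b * d) \<le> sqrt ((real m)\<^sup>2 * (e * \<tau> ^ m))" by (rule real_sqrt_le_mono)
    then show "sqrt (b * d) \<le> real m * sqrt (e * \<tau> ^ m)" by (simp add: real_sqrt_mult)
  qed (use a b e0 d0 in auto)
  also have "\<dots> = ((1 + real m) * sqrt (e * \<tau> ^ m))\<^sup>2" by (simp add: algebra_simps)
  also have "\<dots> = (real (Suc m))\<^sup>2 * \<tau> ^ m * e" using e0 \<tau> by (simp add: power_mult_distrib)
  finally show ?case by (simp only: m_def e_def)
qed

text \<open>Order 0 of the binomial series cancels and order 1 is the subtracted term. From order 2
  on, the tensor power bound combined with binom(n+k,k) <= N^k leaves a series in t =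
  N\<tau>.\<close>

lemma kernel_second_difference_bound:
  fixes a b \<tau> :: real and c :: complex
  assumes a: "0 \<le> a" "a \<le> \<tau>" and b: "0 \<le> b" "b \<le> \<tau>" and c: "(cmod c)\<^sup>2 \<le> a * b"
    and \<tau>: "real (Suc n) * \<tau> \<le> 1 / 9"
  defines "\<kappa> \<equiv> \<lambda>z::complex. inverse ((1 - z) ^ Suc n)"
  shows "Re (\<kappa> (of_real a) + \<kappa> (of_real b) - 2 * \<kappa> c) - real (Suc n) * (a + b - 2 * Re c)
    \<le> 16 / 3 * (real (Suc n))\<^sup>2 * \<tau> * (a + b - 2 * Re c)"
proof -
  define N where "N = real (Suc n)"
  define e where "e = a + b - 2 * Re c"
  define d where "d k = a ^ k + b ^ k - 2 * Re (c ^ k)" for k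
  have N: "N \<ge> 1" by (simp add: N_def)
  have \<tau>0: "0 \<le> \<tau>" using a by simp
  have "\<tau> \<le> N * \<tau>" using N \<tau>0 by (simp add: mult_le_cancel_right1)
  then have \<tau>1: "\<tau> < 1" using \<tau> by (simp add: N_def)
  have "(cmod c)\<^sup>2 \<le> \<tau>\<^sup>2" using c mult_mono[OF a(2) b(2) \<tau>0 b(1)] by (simp add: power2_eq_square)
  then have "cmod c \<le> \<tau>" using \<tau>0 by (rule power2_le_imp_le)
  then have lt: "norm (complex_of_real a) < 1" "norm (complex_of_real b) < 1" "norm c < 1" using a b \<tau>1 by auto
  have e0: "0 \<le> e" using twice_Re_le_add[OF c a(1) b(1)] by (simp add: e_def)
  have "(\<lambda>k. Re (of_nat ((n + k) choose k) * of_real a ^ k + of_nat ((n + k) choose k) * of_real b ^ k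
      - 2 * (of_nat ((n + k) choose k) * c ^ k))) sums Re (\<kappa> (of_real a) + \<kappa> (of_real b) - 2 * \<kappa> c)"
    unfolding \<kappa>_def by (intro sums_Re sums_diff sums_add sums_mult negative_binomial_sums lt)
  then have "(\<lambda>k. real ((n + k) choose k) * d k) sums Re (\<kappa> (of_real a) + \<kappa> (of_real b) - 2 * \<kappa> c)"
    by (simp add: d_def algebra_simps flip: of_real_power)
  then have "(\<lambda>k. real ((n + (k + 2)) choose (k + 2)) * d (k + 2)) sums
      (Re (\<kappa> (of_real a) + \<kappa> (of_real b) - 2 * \<kappa> c) - (\<Sum>k<2. real ((n + k) choose k) * d k))"
    by (rule sums_split_initial_segment)
  moreover have "(\<Sum>k<2. real ((n + k) choose k) * d k) = N * e"
    by (simp add: numeral_2_eq_2 d_def N_def e_def)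
  ultimately have s: "(\<lambda>k. real ((n + (k + 2)) choose (k + 2)) * d (k + 2)) sums
      (Re (\<kappa> (of_real a) + \<kappa> (of_real b) - 2 * \<kappa> c) - N * e)" by simp
  define t where "t = N * \<tau>"
  have t: "0 \<le> t" "t \<le> 1 / 9" using \<tau> \<tau>0 N by (auto simp: t_def N_def)
  \<comment> \<open>The ratio (k+3)^2/(k+2)^2 is at most 9/4, its value at k = 0. Together with t <=
    1/9 this leaves the ratio 1/4, and 4/(1 - 1/4) = 16/3 is the constant of the statement.\<close>
  have quad: "real (k + 2) ^ 2 \<le> 4 * (9 / 4) ^ k" for k
  proof (induction k)
    case (Suc k)
    have "9 / 4 * real (k + 2) ^ 2 - real (Suc k + 2) ^ 2 = 5 / 4 * real k ^ 2 + 3 * real k"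
      by (simp add: power2_eq_square field_simps)
    then have "real (Suc k + 2) ^ 2 \<le> 9 / 4 * real (k + 2) ^ 2"
      using zero_le_power2[of "real k"] by linarith
    then show ?case using Suc by simp
  qed simp
  have le: "real ((n + (k + 2)) choose (k + 2)) * d (k + 2) \<le> 4 * N * t * e * (1 / 4) ^ k" for k
  proof -
    have dk: "d (k + 2) \<le> (real (k + 2))\<^sup>2 * \<tau> ^ (k + 1) * e"
      using tensor_power_difference_bound[OF a b c, of "Suc k"] by (simp add: d_def e_def)
    have b0: "0 \<le> (real (k + 2))\<^sup>2 * \<tau> ^ (k + 1) * e" using \<tau>0 e0 by simp
    have "real ((n + (k + 2)) choose (k + 2)) \<le> N ^ (k + 2)"
      using binomial_le_power[of n "k + 2"] unfolding N_def by (metis of_nat_le_iff of_nat_power)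
    then have "real ((n + (k + 2)) choose (k + 2)) * d (k + 2) \<le> N ^ (k + 2) * ((real (k + 2))\<^sup>2 * \<tau> ^ (k + 1) * e)"
      using mult_left_mono[OF dk, of "real ((n + (k + 2)) choose (k + 2))"] mult_right_mono[OF _ b0] by (smt (verit) of_nat_0_le_iff)
    also have "\<dots> = N * t * e * ((real (k + 2))\<^sup>2 * t ^ k)"
      by (simp add: t_def power_mult_distrib)
    also have "\<dots> \<le> N * t * e * (4 * (1 / 4) ^ k)"
    proof (intro mult_left_mono)
      have "(real (k + 2))\<^sup>2 * t ^ k \<le> (4 * (9 / 4) ^ k) * (1 / 9) ^ k"
        using t by (intro mult_mono quad power_mono) auto
      also have "\<dots> = 4 * (1 / 4) ^ k" unfolding mult.assoc power_mult_distrib[symmetric] by simp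
      finally show "(real (k + 2))\<^sup>2 * t ^ k \<le> 4 * (1 / 4) ^ k" .
    qed (use N t e0 in simp)
    finally show ?thesis by simp
  qed
  have "(\<lambda>k. 4 * N * t * e * (1 / 4) ^ k) sums (4 * N * t * e * (1 / (1 - 1 / 4)))"
    by (intro sums_mult geometric_sums) simp
  from sums_le[OF le s this]
  have "Re (\<kappa> (of_real a) + \<kappa> (of_real b) - 2 * \<kappa> c) - N * e \<le> 4 * N * t * e * (1 / (1 - 1 / 4))" .
  also have "\<dots> = 16 / 3 * N\<^sup>2 * \<tau> * e" by (simp add: t_def power2_eq_square)
  finally show ?thesis by (simp only: e_def N_def)
qed

text \<open>From order 2 on the terms are at most t^2, t^3, ... with t = Na <= 1/9, whence the
  factor 1/(1 - 1/9) = 9/8.\<close>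

lemma kernel_remainder_bound:
  fixes a :: real
  assumes a: "0 \<le> a" "real (Suc n) * a \<le> 1 / 9"
  shows "Re (inverse ((1 - complex_of_real a) ^ Suc n)) - 1 - real (Suc n) * a \<le> 9 / 8 * (real (Suc n) * a)\<^sup>2"
proof -
  define t where "t = real (Suc n) * a"
  have t: "0 \<le> t" "t \<le> 1 / 9" using a by (auto simp: t_def)
  have "a \<le> t" using a by (simp add: t_def mult_le_cancel_right1)
  then have lt: "norm (complex_of_real a) < 1" using a t by simp
  have "(\<lambda>k. Re (of_nat ((n + k) choose k) * of_real a ^ k)) sums Re (inverse ((1 - complex_of_real a) ^ Suc n))"
    by (intro sums_Re negative_binomial_sums lt)
  then have "(\<lambda>k. real ((n + k) choose k) * a ^ k) sums Re (inverse ((1 - complex_of_real a) ^ Suc n))"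
    by (simp flip: of_real_power)
  from sums_split_initial_segment[OF this, of 2]
  have s: "(\<lambda>k. real ((n + (k + 2)) choose (k + 2)) * a ^ (k + 2)) sums (Re (inverse ((1 - complex_of_real a) ^ Suc n)) - 1 - t)"
    by (simp add: numeral_2_eq_2 t_def algebra_simps)
  have le: "real ((n + (k + 2)) choose (k + 2)) * a ^ (k + 2) \<le> t\<^sup>2 * (1 / 9) ^ k" for k
  proof -
    have "real ((n + (k + 2)) choose (k + 2)) \<le> real (Suc n) ^ (k + 2)"
      using binomial_le_power[of n "k + 2"] by (metis of_nat_le_iff of_nat_power)
    then have "real ((n + (k + 2)) choose (k + 2)) * a ^ (k + 2) \<le> real (Suc n) ^ (k + 2) * a ^ (k + 2)"
      using a by (intro mult_right_mono) auto
    also have "\<dots> = t ^ (k + 2)" by (simp only: t_def power_mult_distrib)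
    also have "\<dots> = t\<^sup>2 * t ^ k" by (simp only: power_add mult.commute)
    also have "\<dots> \<le> t\<^sup>2 * (1 / 9) ^ k" using t by (intro mult_left_mono power_mono) auto
    finally show ?thesis .
  qed
  have "(\<lambda>k. t\<^sup>2 * (1 / 9 :: real) ^ k) sums (t\<^sup>2 * (1 / (1 - 1 / 9)))"
    by (intro sums_mult geometric_sums) simp
  from sums_le[OF le s this] show ?thesis by (simp add: t_def)
qed

section \<open>The inverted system\<close>

lemma alpha_root_facts:
  fixes \<alpha> \<gamma> r :: real
  assumes \<alpha>: "0 \<le> \<alpha>" "\<alpha> < 2 * \<gamma> + 1 - sqrt ((2 * \<gamma> + 1)\<^sup>2 - 1)" and \<gamma>: "1 \<le> \<gamma>"
    and r: "r = (\<alpha> + 1 - sqrt ((\<alpha> + 1)\<^sup>2 - 4 * \<alpha> * (\<gamma> + 1))) / (2 * (\<gamma> + 1))"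
  shows "\<alpha> < 1 / 5" "0 \<le> r" "(\<gamma> + 1) * r\<^sup>2 - (\<alpha> + 1) * r + \<alpha> = 0"
proof -
  define X where "X = 2 * \<gamma> + 1"
  have X: "X \<ge> 3" using \<gamma> by (simp add: X_def)
  have "X\<^sup>2 - 1 \<ge> 0" using X by simp
  have lt: "sqrt (X\<^sup>2 - 1) < X - \<alpha>" using \<alpha> by (simp add: X_def)
  have "X\<^sup>2 - 1 = (sqrt (X\<^sup>2 - 1))\<^sup>2" using \<open>X\<^sup>2 - 1 \<ge> 0\<close> by simp
  also have "\<dots> < (X - \<alpha>)\<^sup>2" using lt \<open>X\<^sup>2 - 1 \<ge> 0\<close> by (intro power_strict_mono) auto
  finally have p: "\<alpha>\<^sup>2 - 2 * X * \<alpha> + 1 > 0" by (simp add: power2_eq_square algebra_simps)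
  have aX: "\<alpha> < X" using lt real_sqrt_ge_zero[OF \<open>X\<^sup>2 - 1 \<ge> 0\<close>] by linarith
  \<comment> \<open>1/5 is a rational bound above 3 - sqrt 8, the value of X - sqrt(X^2 - 1) at the
    extreme case X = 3. The convex polynomial \<alpha>^2 - 2X\<alpha> + 1 is negative on
    [1/5, X].\<close>
  show "\<alpha> < 1 / 5"
  proof (rule ccontr)
    assume "\<not> \<alpha> < 1 / 5"
    then have h: "(\<alpha> - 1 / 5) * (\<alpha> - X) \<le> 0" "(\<alpha> - 1 / 5) * (X - 1 / 5) \<ge> 0"
      using aX X by (auto intro: mult_nonneg_nonpos)
    have "\<alpha>\<^sup>2 - 2 * X * \<alpha> + 1 = (\<alpha> - 1 / 5) * (\<alpha> - X) - (\<alpha> - 1 / 5) * (X - 1 / 5) + (1 + 1 / 25 - 2 / 5 * X)"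
      by (simp add: power2_eq_square field_simps)
    then show False using p h X by linarith
  qed
  \<comment> \<open>This discriminant equals \<alpha>^2 - 2X\<alpha> + 1, so the hypothesis on
    \<alpha> is what makes the roots real; r is the smaller one.\<close>
  define d where "d = (\<alpha> + 1)\<^sup>2 - 4 * \<alpha> * (\<gamma> + 1)"
  have d: "d \<ge> 0" using p by (simp add: d_def X_def power2_eq_square algebra_simps)
  have "d \<le> (\<alpha> + 1)\<^sup>2" using \<alpha> \<gamma> by (simp add: d_def)
  then have "sqrt d \<le> \<alpha> + 1" using \<alpha> by (simp add: real_le_lsqrt)
  then show "0 \<le> r" using \<gamma> by (simp add: r d_def)
  have e: "2 * (\<gamma> + 1) * r = \<alpha> + 1 - sqrt d" using \<gamma> by (simp add: r d_def)
  then have "(\<alpha> + 1 - 2 * (\<gamma> + 1) * r)\<^sup>2 = d" using d by simp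
  then have "4 * (\<gamma> + 1) * ((\<gamma> + 1) * r\<^sup>2 - (\<alpha> + 1) * r + \<alpha>) = 0"
    by (simp add: d_def power2_eq_square algebra_simps)
  then show "(\<gamma> + 1) * r\<^sup>2 - (\<alpha> + 1) * r + \<alpha> = 0" using \<gamma> by simp
qed

text \<open>The quadratic equation amounts to (r - \<gamma>r^2 - \<alpha>)(1 - r) = \<gamma>r^3,
  hence \<alpha> <= r - \<gamma>r^2. The gap \<gamma>r^2 pays for the errors \<nu>r^2,
  (107/300)\<gamma>r^2 and \<nu>r^2/3, which together stay below (3/4)\<gamma>r^2.\<close>

lemma self_map_inequality:
  fixes \<alpha> \<gamma> r \<nu> N :: real
  assumes q: "(\<gamma> + 1) * r\<^sup>2 - (\<alpha> + 1) * r + \<alpha> = 0" and r: "0 \<le> r" "r < 1" and \<alpha>: "0 \<le> \<alpha>"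
    and \<nu>: "0 \<le> \<nu>" "\<nu> \<le> 29 / 100 * \<gamma>" and N: "3 \<le> N" and \<gamma>: "1 \<le> \<gamma>"
  shows "\<alpha> * (1 + \<nu> * r) + 107 / 100 * \<gamma> * r\<^sup>2 / N \<le> r - \<nu> * r\<^sup>2 / N"
proof -
  have "(r - \<gamma> * r\<^sup>2 - \<alpha>) * (1 - r) = \<gamma> * r ^ 3 + ((\<gamma> + 1) * r\<^sup>2 - (\<alpha> + 1) * r + \<alpha>) - 2 * ((\<gamma> + 1) * r\<^sup>2 - (\<alpha> + 1) * r + \<alpha>)"
    by (simp add: power2_eq_square power3_eq_cube algebra_simps)
  also have "\<dots> \<ge> 0" using q \<gamma> r by simp
  finally have a1: "\<alpha> \<le> r - \<gamma> * r\<^sup>2" using r by (simp add: zero_le_mult_iff)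
  moreover have "0 \<le> \<gamma> * r\<^sup>2" using \<gamma> by simp
  ultimately have a2: "\<alpha> \<le> r" by linarith
  have "\<alpha> * (\<nu> * r) \<le> r * (\<nu> * r)" using a2 \<nu> r by (intro mult_right_mono) auto
  then have 1: "\<alpha> * (1 + \<nu> * r) \<le> r - \<gamma> * r\<^sup>2 + \<nu> * r\<^sup>2"
    using a1 by (simp add: power2_eq_square algebra_simps)
  have 2: "107 / 100 * \<gamma> * r\<^sup>2 / N \<le> 107 / 100 * \<gamma> * r\<^sup>2 / 3"
    using N \<gamma> by (intro divide_left_mono) auto
  have 3: "\<nu> * r\<^sup>2 / N \<le> \<nu> * r\<^sup>2 / 3"
    using N \<nu> by (intro divide_left_mono) auto
  have "\<nu> * r\<^sup>2 \<le> 29 / 100 * \<gamma> * r\<^sup>2" using \<nu> by (intro mult_right_mono) auto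
  then show ?thesis using 1 2 3 \<open>0 \<le> \<gamma> * r\<^sup>2\<close> by linarith
qed

section \<open>Multiplication by the inverse Jacobian\<close>

lemma matrix_inv_mult_vec:
  fixes A :: "complex^'n^'n"
  assumes "invertible A"
  shows "matrix_inv A *v (A *v v) = v" "A *v (matrix_inv A *v v) = v"
proof -
  have "A ** matrix_inv A = mat 1 \<and> matrix_inv A ** A = mat 1"
    unfolding matrix_inv_def using assms unfolding invertible_def by (rule someI_ex)
  then show "matrix_inv A *v (A *v v) = v" "A *v (matrix_inv A *v v) = v"
    by (simp_all add: matrix_vector_mul_assoc)
qed

lemma bounded_linear_matrix_complex: "bounded_linear ((*v) (A :: complex^'n^'n))"
proof -
  have "linear ((*v) A)"
    by (rule linearI)
       (simp_all add: vec_eq_iff matrix_vector_mult_def scaleR_sum_right distrib_left sum.distrib)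
  then show ?thesis by (simp add: linear_conv_bounded_linear)
qed

lemma matrix_vector_mult_scale_complex: "(A :: complex^'n^'n) *v (c *s v) = c *s (A *v v)"
  by (simp add: vec_eq_iff matrix_vector_mult_def sum_distrib_left mult_ac)

lemma ex_herm_orthogonal:
  fixes x :: "complex^'n"
  assumes "CARD('n) \<ge> 2"
  shows "\<exists>q. q \<noteq> 0 \<and> herm q x = 0"
proof -
  have "\<not> (\<forall>i j :: 'n. i = j)"
  proof
    assume "\<forall>i j :: 'n. i = j"
    then have "(UNIV :: 'n set) = {undefined}" by auto
    then have "CARD('n) = 1" by (metis card_1_singleton_iff One_nat_def)
    then show False using assms by simp
  qed
  then obtain i j :: 'n where ij: "i \<noteq> j" by blast
  have hax: "herm (axis k c) x = c * cnj (x $ k)" for k c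
    by (simp add: herm_def axis_def if_distrib[of "\<lambda>u. u * _"] cong: if_cong)
  show ?thesis
  proof (cases "x $ i = 0")
    case True
    then have "axis i 1 \<noteq> (0 :: complex^'n) \<and> herm (axis i 1) x = 0" by (simp add: hax)
    then show ?thesis by blast
  next
    case False
    define q where "q = axis i (cnj (x $ j)) - axis j (cnj (x $ i))"
    have "q $ j = - cnj (x $ i)" using ij by (simp add: q_def axis_def)
    then have "q \<noteq> 0" using False by auto
    moreover have "herm q x = 0" by (simp add: q_def herm_diff_left hax)
    ultimately show ?thesis by blast
  qed
qed

lemma lambda_square:
  fixes x \<omega> :: "complex^'n"
  assumes "norm x < 1" "R > 0" "a = \<omega> + R *\<^sub>R x"
  shows "(lambda \<omega> R f a)\<^sup>2 = (A2_system_norm \<omega> R f)\<^sup>2 / defect x ^ Suc CARD('n)"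
proof -
  have n: "nu \<omega> R a = norm x" using assms by (simp add: nu_def)
  have s: "defect x > 0" by (rule defect_pos[OF assms(1)])
  have "(defect x powr ((real CARD('n) + 1) / 2))\<^sup>2 = defect x powr (real (Suc CARD('n)))"
    by (simp add: power2_eq_square powr_add[symmetric] add.commute)
  also have "\<dots> = defect x ^ Suc CARD('n)" using s by (simp only: powr_realpow)
  finally show ?thesis by (simp add: lambda_def n power_divide defect_def)
qed

text \<open>After replacing \<open>f\<close> by \<open>Df(x\<^sub>0)\<^sup>-\<^sup>1 f\<close> the derivative of the transformed system at \<open>0\<close> in the
  direction \<open>q\<close> is \<open>Rq - N\<langle>q,x\<rangle>/s \<cdot> Df(x\<^sub>0)\<^sup>-\<^sup>1f(x\<^sub>0)\<close>.\<close>

lemma inverted_system_derivative_bound: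
  fixes f :: "complex^'n \<Rightarrow> complex^'n" and a :: real
  assumes f: "f \<in> A2_system \<omega> R" and R: "R > 0" and x: "norm x < 1"
    and x0: "x0 = \<omega> + R *\<^sub>R x" and inv: "invertible (D f x0)"
    and y: "norm y < defect x" and z: "norm z < defect x"
  defines "N \<equiv> Suc CARD('n)" and "B \<equiv> matrix_inv (D f x0)"
  shows "(norm (a *\<^sub>R (B *v proj_system \<omega> R f x y - B *v proj_system \<omega> R f x z)
      - (R *\<^sub>R q - (of_nat N * herm q x / of_real (defect x)) *s (B *v f x0))))\<^sup>2
    \<le> (lambda \<omega> R f x0 * mu f x0)\<^sup>2 *
       (a\<^sup>2 * Re (proj_kernel x y y + proj_kernel x z z - 2 * proj_kernel x y z)
        - 2 * a * N * Re (proj_form x (y - z) q) + N * Re (proj_form x q q))"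
proof -
  interpret B: bounded_linear "(*v) B" by (rule bounded_linear_matrix_complex)
  define v where "v = a *\<^sub>R (proj_system \<omega> R f x y - proj_system \<omega> R f x z)
      - (R *\<^sub>R (D f x0 *v q) - (of_nat N * herm q x / of_real (defect x)) *s f x0)"
  have "B *v v = a *\<^sub>R (B *v proj_system \<omega> R f x y - B *v proj_system \<omega> R f x z)
      - (R *\<^sub>R q - (of_nat N * herm q x / of_real (defect x)) *s (B *v f x0))"
    unfolding v_def B.diff B.scaleR matrix_vector_mult_scale_complex
    using matrix_inv_mult_vec(1)[OF inv, of q] by (simp add: B_def)
  moreover have "norm (B *v v) \<le> mu f x0 * norm v"
    unfolding mu_def op_norm_def B_def by (rule onorm[OF bounded_linear_matrix_complex])
  ultimately have "(norm (a *\<^sub>R (B *v proj_system \<omega> R f x y - B *v proj_system \<omega> R f x z)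
      - (R *\<^sub>R q - (of_nat N * herm q x / of_real (defect x)) *s (B *v f x0))))\<^sup>2 \<le> (mu f x0 * norm v)\<^sup>2"
    by (metis norm_ge_zero power_mono)
  also have "\<dots> = (mu f x0)\<^sup>2 * (norm v)\<^sup>2" by (rule power_mult_distrib)
  also have "\<dots> \<le> (mu f x0)\<^sup>2 * ((lambda \<omega> R f x0)\<^sup>2 *
       (a\<^sup>2 * Re (proj_kernel x y y + proj_kernel x z z - 2 * proj_kernel x y z)
        - 2 * a * N * Re (proj_form x (y - z) q) + N * Re (proj_form x q q)))"
  proof (rule mult_left_mono)
    show "(norm v)\<^sup>2 \<le> (lambda \<omega> R f x0)\<^sup>2 *
       (a\<^sup>2 * Re (proj_kernel x y y + proj_kernel x z z - 2 * proj_kernel x y z)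
        - 2 * a * N * Re (proj_form x (y - z) q) + N * Re (proj_form x q q))"
      unfolding lambda_square[OF x R x0] v_def N_def unfolding x0
      by (rule proj_system_derivative_bound[OF f R x y z])
  qed simp
  finally show ?thesis by (simp only: power_mult_distrib mult_ac)
qed

section \<open>Existence and uniqueness of the root\<close>

lemma continuous_on_proj_system:
  fixes f :: "complex^'n \<Rightarrow> complex^'n"
  assumes f: "f \<in> A2_system \<omega> R" and R: "R > 0" and x: "norm x < 1" and S: "\<And>y. y \<in> S \<Longrightarrow> norm y < defect x"
  shows "continuous_on S (proj_system \<omega> R f x)"
proof -
  have cf: "continuous_on (ball \<omega> R) f"
    by (meson A2_system_has_derivative[OF f] continuous_at_imp_continuous_on has_derivative_continuous)
  have cfac: "continuous_on S (\<lambda>y. inverse (proj_factor x y))"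
    using S proj_factor_nonzero[OF x] unfolding proj_factor_def divide_inverse
    by (intro continuous_intros) auto
  have scale: "continuous_on S (\<lambda>y. g y *s h y)" if "continuous_on S g" "continuous_on S h" for g and h :: "complex^'n \<Rightarrow> complex^'n"
    unfolding vector_scalar_mult_def using that by (intro continuous_intros) auto
  have cp: "continuous_on S (proj_point x)"
    unfolding proj_point_def[abs_def] by (intro continuous_on_add continuous_on_const scale cfac continuous_on_id)
  have "continuous_on S (\<lambda>y. f (\<omega> + R *\<^sub>R proj_point x y))"
  proof (rule continuous_on_compose2[OF cf])
    show "continuous_on S (\<lambda>y. \<omega> + R *\<^sub>R proj_point x y)" by (intro continuous_intros cp)
    show "(\<lambda>y. \<omega> + R *\<^sub>R proj_point x y) ` S \<subseteq> ball \<omega> R"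
      using norm_proj_point[OF x S] R by (auto simp: dist_norm)
  qed
  then show ?thesis
    unfolding proj_system_def[abs_def] by (intro scale continuous_on_power cfac)
qed

lemma proj_system_eq_0_iff:
  assumes "norm x < 1" "norm y < defect x"
  shows "proj_system \<omega> R f x y = 0 \<longleftrightarrow> f (\<omega> + R *\<^sub>R proj_point x y) = 0"
  using proj_factor_nonzero[OF assms] by (simp add: proj_system_def vector_mul_eq_0 del: power_Suc)

lemma norm_diff_scale_ge: 
  "norm (R *\<^sub>R q - c *s (b :: complex^'n)) \<ge> \<bar>R\<bar> * norm q - cmod c * norm b"
  using norm_triangle_ineq2[of "R *\<^sub>R q" "c *s b"] by (simp add: norm_vector_scalar_mult)

theorem mainTheorem5:
  fixes \<omega> x\<^sub>0 :: "complex^'n"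
    and R\<^sub>\<omega> \<alpha> \<gamma> \<kappa> \<theta> :: real
    and f :: "complex^'n \<Rightarrow> complex^'n"
  assumes "CARD('n) \<ge> 2"
    and "R\<^sub>\<omega> > 0"
    and "x\<^sub>0 \<in> ball \<omega> R\<^sub>\<omega>"
    and "f \<in> A2_system \<omega> R\<^sub>\<omega>"
    and "invertible (D f x\<^sub>0)"
    and "\<alpha> = alpha \<omega> R\<^sub>\<omega> f x\<^sub>0"
    and "\<gamma> = gamma \<omega> R\<^sub>\<omega> f x\<^sub>0"
    and "\<kappa> = kappa \<omega> R\<^sub>\<omega> x\<^sub>0"
    and "\<alpha> < 2 * \<gamma> + 1 - sqrt ((2 * \<gamma> + 1)\<^sup>2 - 1)"
    and "\<theta> > 0"
    and "ball x\<^sub>0 \<theta> \<subseteq> ball \<omega> R\<^sub>\<omega>"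
    and "(\<alpha> + 1 - sqrt ((\<alpha> + 1)\<^sup>2 - 4 * \<alpha> * (\<gamma> + 1))) / (2 * (\<gamma> + 1)) < \<kappa> * \<theta>"
    and "\<kappa> * \<theta> < 1 / (\<gamma> + 1)"
  shows "\<exists>!z. z \<in> ball x\<^sub>0 \<theta> \<and> f z = 0"
proof -

  \<comment> \<open>Normalisation to the unit ball and the basic inequalities\<close>
  define R where "R = R\<^sub>\<omega>"
  have R: "R > 0" and f: "f \<in> A2_system \<omega> R" using assms by (auto simp: R_def)
  note inv = assms(5)
  define x where "x = (1 / R) *\<^sub>R (x\<^sub>0 - \<omega>)"
  have x0: "x\<^sub>0 = \<omega> + R *\<^sub>R x" using R by (simp add: x_def)
  have x: "norm x < 1" using assms(3) R by (simp add: x_def R_def dist_norm norm_minus_commute)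
  define s \<nu> where "s = defect x" and "\<nu> = norm x"
  have s: "0 < s" "s = 1 - \<nu>\<^sup>2" using defect_pos[OF x] by (auto simp: s_def \<nu>_def defect_def)
  have \<nu>: "0 \<le> \<nu>" "\<nu> < 1" using x by (auto simp: \<nu>_def)
  define N where "N = real (Suc CARD('n))"
  have N: "N \<ge> 3" using assms(1) by (simp add: N_def)
  have nu: "nu \<omega> R x\<^sub>0 = \<nu>" using R by (simp add: nu_def x0 \<nu>_def)
  have \<kappa>: "\<kappa> = max 1 (N / (R * s))"
    by (simp add: assms(8) kappa_def R_def[symmetric] nu s N_def add.commute)
  then have \<kappa>1: "\<kappa> \<ge> 1" "\<kappa> > 0" by auto
  \<comment> \<open>M converts units: for z = x_0 + Rp one has \<kappa>|z - x_0| = M |p|/s. The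
    second entry of the maximum defining \<kappa> is exactly M >= N.\<close>
  define M where "M = \<kappa> * R * s"
  have M: "M \<ge> N"
  proof -
    have "N / (R * s) \<le> \<kappa>" by (simp add: \<kappa>)
    then show ?thesis using R s by (simp add: M_def pos_divide_le_eq mult.assoc)
  qed
  define m where "m = lambda \<omega> R f x\<^sub>0 * mu f x\<^sub>0"
  define B where "B = matrix_inv (D f x\<^sub>0)"
  define b where "b = B *v f x\<^sub>0"
  define \<beta> where "\<beta> = norm b"
  have \<alpha>: "\<alpha> = \<beta> * \<kappa>" unfolding assms(6) alpha_def \<beta>_def b_def B_def beta_def assms(8) by simp
  have \<alpha>0: "0 \<le> \<alpha>" using \<kappa>1 by (simp add: \<alpha> \<beta>_def)
  have m0: "0 \<le> m"
    unfolding m_def mu_def op_norm_def lambda_def A2_system_norm_def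
    using onorm_pos_le[OF bounded_linear_matrix_complex]
    by (intro mult_nonneg_nonneg divide_nonneg_nonneg) (auto intro: sum_nonneg)
  have \<gamma>: "\<gamma> \<ge> 1" and m\<gamma>: "m * \<kappa> \<le> \<gamma>"
    unfolding assms(7,8) gamma_def m_def R_def by (auto simp: mult_ac)
  note key = inverted_system_derivative_bound[OF f R x x0 inv, folded B_def b_def m_def s_def N_def]

  define r where "r = (\<alpha> + 1 - sqrt ((\<alpha> + 1)\<^sup>2 - 4 * \<alpha> * (\<gamma> + 1))) / (2 * (\<gamma> + 1))"
  have r\<theta>: "r < \<kappa> * \<theta>" and \<theta>\<gamma>: "\<kappa> * \<theta> < 1 / (\<gamma> + 1)" using assms(12,13) by (simp_all add: r_def)
  note root = alpha_root_facts[OF \<alpha>0 assms(9) \<gamma> r_def]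

  have \<gamma>s: "N \<le> \<gamma>\<^sup>2 * s"
  proof -
    \<comment> \<open>Orthogonality removes the term with b from the derivative and gives Q(q,q) =
      |q|^2/s instead of the general bound |q|^2/s^2; a = 0 in \<open>key\<close> isolates the
      derivative. Multiplying by \<kappa>^2 s and using M >= N turns the result into N^2 <=
      \<gamma>^2 s N.\<close>
    obtain q where q: "q \<noteq> 0" "herm q x = 0" using ex_herm_orthogonal[OF assms(1)] by blast
    have "(R * norm q)\<^sup>2 \<le> m\<^sup>2 * (N * Re (proj_form x q q))"
      using key[of 0 0 0 q] R s by (simp add: q abs_of_pos)
    also have "Re (proj_form x q q) = (norm q)\<^sup>2 / s"
      unfolding proj_form_self Re_complex_of_real q using s by (simp add: s_def power2_eq_square)
    finally have "R\<^sup>2 * s * (norm q)\<^sup>2 \<le> m\<^sup>2 * N * (norm q)\<^sup>2"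
      using s by (simp add: power_mult_distrib pos_le_divide_eq mult_ac)
    then have "R\<^sup>2 * s \<le> m\<^sup>2 * N" using q by simp
    then have "\<kappa>\<^sup>2 * s * (R\<^sup>2 * s) \<le> \<kappa>\<^sup>2 * s * (m\<^sup>2 * N)" using s by (intro mult_left_mono) auto
    then have "M\<^sup>2 \<le> (m * \<kappa>)\<^sup>2 * s * N" by (simp add: M_def power2_eq_square mult_ac)
    also have "\<dots> \<le> \<gamma>\<^sup>2 * s * N"
      using m\<gamma> m0 \<kappa>1 s N by (intro mult_right_mono power_mono) auto
    finally have "M\<^sup>2 \<le> \<gamma>\<^sup>2 * s * N" .
    moreover have "N * N \<le> M\<^sup>2" using mult_mono[OF M M] N M by (simp add: power2_eq_square)
    ultimately have "N * N \<le> (\<gamma>\<^sup>2 * s) * N" by linarith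
    then show ?thesis using N by simp
  qed
  have \<gamma>N: "N \<le> \<gamma>\<^sup>2"
    using \<gamma>s s mult_left_mono[of s 1 "\<gamma>\<^sup>2"] by simp
  \<comment> \<open>From 4\<nu>^2(1 - \<nu>^2) <= 1 and 3 <= N <= \<gamma>^2 s follows 12\<nu>^2 <=
    \<gamma>^2, and 29/100 exceeds 1/sqrt 12.\<close>
  have \<nu>\<gamma>: "\<nu> \<le> 29 / 100 * \<gamma>"
  proof -
    have "4 * \<nu>\<^sup>2 * s \<le> 1" using zero_le_power2[of "2 * \<nu>\<^sup>2 - 1"]
      unfolding s by (simp add: power2_eq_square algebra_simps)
    then have "12 * \<nu>\<^sup>2 * s \<le> \<gamma>\<^sup>2 * s" using \<gamma>s N by linarith
    then have "12 * \<nu>\<^sup>2 \<le> \<gamma>\<^sup>2" using s by simp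
    then have "\<nu>\<^sup>2 \<le> 841 / 10000 * \<gamma>\<^sup>2" using zero_le_power2[of \<gamma>] by linarith
    then have "\<nu>\<^sup>2 \<le> (29 / 100 * \<gamma>)\<^sup>2" by (simp add: power_mult_distrib power2_eq_square)
    then show ?thesis using \<gamma> by (intro power2_le_imp_le[of \<nu>]) auto
  qed
  have N\<beta>: "N * \<beta> / s \<le> \<alpha> * R"
  proof -
    have "N * \<beta> \<le> M * \<beta>" using M by (intro mult_right_mono) (auto simp: \<beta>_def)
    then show ?thesis using s(1) by (simp add: \<alpha> M_def pos_divide_le_eq mult_ac)
  qed

  \<comment> \<open>Uniqueness of the root\<close>
  have uniq: "z\<^sub>1 = z\<^sub>2" if z1: "z\<^sub>1 \<in> ball x\<^sub>0 \<theta>" "f z\<^sub>1 = 0" and z2: "z\<^sub>2 \<in> ball x\<^sub>0 \<theta>" "f z\<^sub>2 = 0" for z\<^sub>1 z\<^sub>2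
  proof -
    \<comment> \<open>The coordinates are inverted by y = p/(1 - \<eta>), which enlarges v = |p|/s
      to at most v/(1 - v). The summand 1 in 1/(\<gamma>+1) pays for this: vN(\<gamma>+1) < 1 and v
      <= vN give v/(1 - v) <= 1/(N\<gamma>).\<close>
    have lift: "\<exists>y. norm y / s \<le> 1 / (N * \<gamma>) \<and> z = \<omega> + R *\<^sub>R proj_point x y" if z: "z \<in> ball x\<^sub>0 \<theta>" for z
    proof -
      define p where "p = (1 / R) *\<^sub>R (z - x\<^sub>0)"
      have zp: "z = \<omega> + R *\<^sub>R (x + p)" using R x0 by (simp add: p_def algebra_simps)
      define v where "v = norm p / s"
      have "\<kappa> * norm (z - x\<^sub>0) < \<kappa> * \<theta>" using z \<kappa>1 by (simp add: dist_norm norm_minus_commute)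
      then have "\<kappa> * norm (z - x\<^sub>0) < 1 / (\<gamma> + 1)" using \<theta>\<gamma> by simp
      moreover have "\<kappa> * norm (z - x\<^sub>0) = M * v" using R s(1) by (simp add: M_def v_def p_def)
      moreover have "N * v \<le> M * v" using M s(1) by (intro mult_right_mono) (auto simp: v_def)
      ultimately have Nv: "N * v < 1 / (\<gamma> + 1)" by linarith
      then have v: "0 \<le> v" "v * (N * (\<gamma> + 1)) < 1" using s(1) \<gamma> by (auto simp: v_def pos_less_divide_eq mult_ac)
      have "1 \<le> N * (\<gamma> + 1)" using mult_mono[of 1 N 1 "\<gamma> + 1"] N \<gamma> by simp
      then have "v * 1 \<le> v * (N * (\<gamma> + 1))" using v by (intro mult_left_mono)
      then have v1: "v < 1" using v by simp
      define \<eta> where "\<eta> = herm p x / of_real s"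
      have "cmod \<eta> \<le> v"
      proof -
        have "cmod (herm p x) \<le> norm p * 1"
          by (rule order_trans[OF norm_herm_le]) (use x in \<open>intro mult_left_mono, auto\<close>)
        then show ?thesis using s(1) by (simp add: \<eta>_def v_def norm_divide divide_right_mono)
      qed
      then have \<eta>: "1 - v \<le> cmod (1 - \<eta>)" using norm_triangle_ineq2[of 1 \<eta>] by simp
      then have \<eta>0: "1 - \<eta> \<noteq> 0" using v1 by auto
      define y where "y = inverse (1 - \<eta>) *s p"
      have "proj_factor x y = inverse (1 - \<eta>)"
        using \<eta>0 s(1) by (simp add: proj_factor_def y_def herm_scale_left s_def[symmetric] \<eta>_def[symmetric] field_simps)
           (simp add: \<eta>_def)
      then have "proj_point x y = x + p"
        using \<eta>0 by (simp add: proj_point_def y_def vector_smult_assoc)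
      moreover have "norm y / s \<le> 1 / (N * \<gamma>)"
      proof -
        have "norm y / s = v / cmod (1 - \<eta>)"
          by (simp add: y_def norm_vector_scalar_mult norm_inverse v_def divide_inverse)
        also have "\<dots> \<le> v / (1 - v)" using \<eta> v v1 by (intro divide_left_mono mult_pos_pos) auto
        also have "\<dots> \<le> 1 / (N * \<gamma>)"
        proof -
          have "v * (N * (\<gamma> + 1)) = v * (N * \<gamma>) + v * N" by (simp add: algebra_simps)
          moreover have "v \<le> v * N" using v N by (simp add: mult_le_cancel_left1)
          ultimately have "v * (N * \<gamma>) \<le> 1 - v" using v by linarith
          then show ?thesis using v1 N \<gamma> by (simp add: field_simps)
        qed
        finally show ?thesis .
      qed
      ultimately show ?thesis using zp by auto
    qed
    obtain y z where y: "norm y / s \<le> 1 / (N * \<gamma>)" "z\<^sub>1 = \<omega> + R *\<^sub>R proj_point x y"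
      and z: "norm z / s \<le> 1 / (N * \<gamma>)" "z\<^sub>2 = \<omega> + R *\<^sub>R proj_point x z"
      using lift z1 z2 by metis
    have "3 \<le> N * \<gamma>" using mult_mono[of 3 N 1 \<gamma>] N \<gamma> by simp
    then have N\<gamma>1: "1 / (N * \<gamma>) < 1" by simp
    have lt: "norm w < s" if "norm w / s \<le> 1 / (N * \<gamma>)" for w :: "complex^'n"
    proof -
      have "norm w / s < 1" using that N\<gamma>1 by linarith
      then show ?thesis using s(1) by (simp add: pos_divide_less_eq)
    qed
    note y1 = lt[OF y(1)] and z1' = lt[OF z(1)]
    have Gy: "proj_system \<omega> R f x y = 0" and Gz: "proj_system \<omega> R f x z = 0"
      using proj_system_eq_0_iff[OF x] y1 z1' y z z1 z2 by (auto simp: s_def)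
    define q where "q = y - z"
    define \<tau> where "\<tau> = (1 / (N * \<gamma>))\<^sup>2"
    define e where "e = Re (proj_form x q q)"
    have le\<tau>: "Re (proj_form x w w) \<le> \<tau>" if "norm w / s \<le> 1 / (N * \<gamma>)" for w
      using proj_form_self_le[OF x, of w] power_mono[OF that, of 2] s(1) by (simp add: \<tau>_def s_def)
    have real: "of_real (Re (proj_form x w w)) = proj_form x w w" for w unfolding proj_form_self by simp
    have ec: "e = Re (proj_form x y y) + Re (proj_form x z z) - 2 * Re (proj_form x y z)"
    proof -
      have "Re (proj_form x z y) = Re (proj_form x y z)" by (metis proj_form_cnj complex_cnj(1) cnj.sel(1))
      then show ?thesis by (simp add: e_def q_def proj_form_diff_left proj_form_diff_right)
    qed
    have N\<tau>: "N * \<tau> \<le> 1 / 9"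
    proof -
      have "9 \<le> N * \<gamma>\<^sup>2" using mult_mono[OF N order_trans[OF N \<gamma>N]] N by simp
      then have "1 / (N * \<gamma>\<^sup>2) \<le> 1 / 9" by (intro divide_left_mono) auto
      moreover have "N * \<tau> = 1 / (N * \<gamma>\<^sup>2)" using N by (simp add: \<tau>_def power2_eq_square)
      ultimately show ?thesis by simp
    qed
    have "Re (proj_kernel x y y + proj_kernel x z z - 2 * proj_kernel x y z) - N * e \<le> 16 / 3 * N\<^sup>2 * \<tau> * e"
      using kernel_second_difference_bound[OF proj_form_self_nonneg[OF x] le\<tau>[OF y(1)] proj_form_self_nonneg[OF x] le\<tau>[OF z(1)]
          proj_form_Cauchy_Schwarz[OF x] N\<tau>[unfolded N_def]]
      unfolding real by (simp only: proj_kernel_def N_def ec)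
    \<comment> \<open>With q = y - z the two Q-terms of \<open>key\<close> combine to -N Q(q,q), the
      linear part of the second difference. Both values of the transformed system vanish, so the
      left-hand side is the bare derivative at 0 in the direction q.\<close>
    moreover have "(norm (R *\<^sub>R q - (of_real N * herm q x / of_real s) *s b))\<^sup>2
        \<le> m\<^sup>2 * (Re (proj_kernel x y y + proj_kernel x z z - 2 * proj_kernel x y z) - N * e)"
      using key[of y z 1 q] y1 z1' unfolding Gy Gz
      by (simp add: q_def[symmetric] e_def[symmetric] N_def norm_minus_commute algebra_simps)
    ultimately have "(norm (R *\<^sub>R q - (of_real N * herm q x / of_real s) *s b))\<^sup>2 \<le> m\<^sup>2 * (16 / 3 * N\<^sup>2 * \<tau> * e)"
      by (smt (verit) mult_left_mono zero_le_power2)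
    also have "\<dots> \<le> m\<^sup>2 * (16 / 3 * N\<^sup>2 * \<tau> * (norm q / s)\<^sup>2)"
      using proj_form_self_le[OF x, of q] by (intro mult_left_mono) (auto simp: e_def s_def \<tau>_def)
    also have "\<dots> = 16 / 3 * (m * norm q / (\<gamma> * s))\<^sup>2"
      using N by (simp add: \<tau>_def power_mult_distrib power_divide)
    finally have up: "(norm (R *\<^sub>R q - (of_real N * herm q x / of_real s) *s b))\<^sup>2 \<le> 16 / 3 * (m * norm q / (\<gamma> * s))\<^sup>2" .
    have "R * norm q - cmod (of_real N * herm q x / of_real s) * \<beta> \<le> norm (R *\<^sub>R q - (of_real N * herm q x / of_real s) *s b)"
      using norm_diff_scale_ge[of R q _ b] R by (simp add: \<beta>_def)
    moreover have "cmod (of_real N * herm q x / of_real s) * \<beta> \<le> \<alpha> * R * norm q"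
    proof -
      have "cmod (herm q x) \<le> norm q * 1"
        by (rule order_trans[OF norm_herm_le]) (use x in \<open>intro mult_left_mono, auto\<close>)
      then have "cmod (of_real N * herm q x / of_real s) * \<beta> \<le> N * norm q / s * \<beta>"
        using N s(1) by (intro mult_right_mono) (auto simp: norm_mult norm_divide \<beta>_def divide_right_mono)
      also have "\<dots> = (N * \<beta> / s) * norm q" by simp
      also have "\<dots> \<le> \<alpha> * R * norm q" using N\<beta> by (intro mult_right_mono) auto
      finally show ?thesis .
    qed
    \<comment> \<open>The rank-one term is at most \<alpha>R|q|, and \<alpha> < 1/5 keeps four
      fifths of R|q|.\<close>
    ultimately have "R * (4 / 5) * norm q \<le> norm (R *\<^sub>R q - (of_real N * herm q x / of_real s) *s b)"
    proof -
      assume a: "R * norm q - cmod (of_real N * herm q x / of_real s) * \<beta> \<le> norm (R *\<^sub>R q - (of_real N * herm q x / of_real s) *s b)"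
        "cmod (of_real N * herm q x / of_real s) * \<beta> \<le> \<alpha> * R * norm q"
      have "\<alpha> * (R * norm q) \<le> 1 / 5 * (R * norm q)" using root(1) R by (intro mult_right_mono) auto
      then show ?thesis using a by (simp add: mult.assoc)
    qed
    then have "(R * (4 / 5) * norm q)\<^sup>2 \<le> 16 / 3 * (m * norm q / (\<gamma> * s))\<^sup>2"
      using up R by (meson order_trans power_mono mult_nonneg_nonneg norm_ge_zero less_imp_le zero_le_divide_iff zero_le_numeral)
    then have "(\<kappa> * s)\<^sup>2 * (R * (4 / 5) * norm q)\<^sup>2 \<le> (\<kappa> * s)\<^sup>2 * (16 / 3 * (m * norm q / (\<gamma> * s))\<^sup>2)"
      by (intro mult_left_mono) auto
    then have "16 / 25 * M\<^sup>2 * (norm q)\<^sup>2 \<le> 16 / 3 * ((m * \<kappa>) / \<gamma>)\<^sup>2 * (norm q)\<^sup>2"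
      using s(1) by (simp add: M_def power2_eq_square mult_ac)
    also have "\<dots> \<le> 16 / 3 * 1 * (norm q)\<^sup>2"
      using m\<gamma> m0 \<kappa>1 \<gamma> by (intro mult_right_mono mult_left_mono power_le_one) auto
    finally have c: "16 / 25 * M\<^sup>2 * (norm q)\<^sup>2 \<le> 16 / 3 * (norm q)\<^sup>2" by simp
    \<comment> \<open>The margin that forces q = 0: (16/25) * 9 = 5.76 exceeds 16/3.\<close>
    have "9 \<le> M\<^sup>2" using power_mono[of 3 M 2] M N by simp
    then have "16 / 25 * 9 * (norm q)\<^sup>2 \<le> 16 / 25 * M\<^sup>2 * (norm q)\<^sup>2" by (intro mult_right_mono mult_left_mono) auto
    then have "(norm q)\<^sup>2 \<le> 0" using c by linarith
    then have "q = 0" by simp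
    then show ?thesis using y z by (simp add: q_def)
  qed

  \<comment> \<open>Existence of a root by a fixed point\<close>
  have ex: "\<exists>z. z \<in> ball x\<^sub>0 \<theta> \<and> f z = 0"
  proof -
    have r1: "r < 1 / (\<gamma> + 1)" using r\<theta> \<theta>\<gamma> by simp
    also have "\<dots> \<le> 1 / 2" using \<gamma> by (intro divide_left_mono) auto
    finally have r2: "r < 1 / 2" .
    \<comment> \<open>The root must satisfy |z - x_0| <= Rs\<rho> = r/\<kappa> < \<theta>. Returning
      from y to z divides by a factor of modulus at least 1 - \<nu>\<sigma>, and
      \<open>\<sigma>\<close> solves \<sigma>/(1 - \<nu>\<sigma>) = \<rho>.\<close>
    define \<rho> where "\<rho> = r / M"
    define \<sigma> where "\<sigma> = \<rho> / (1 + \<nu> * \<rho>)"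
    have Mpos: "M > 0" using M N by simp
    have \<rho>: "0 \<le> \<rho>" "\<rho> \<le> r / N" using root(2) M N by (auto simp: \<rho>_def divide_left_mono)
    have "r / N \<le> (1 / 2) / 3" using r2 N root(2) by (intro frac_le) auto
    then have \<rho>6: "\<rho> \<le> 1 / 6" using \<rho> by linarith
    have \<nu>\<rho>: "0 \<le> \<nu> * \<rho>" using \<nu> \<rho> by simp
    have "\<rho> / (1 + \<nu> * \<rho>) \<le> \<rho> / 1" using \<rho>(1) \<nu>\<rho> by (intro divide_left_mono) auto
    then have \<sigma>: "0 \<le> \<sigma>" "\<sigma> \<le> \<rho>" using \<rho> \<nu>\<rho> by (auto simp: \<sigma>_def)
    define K where "K = cball (0 :: complex^'n) (s * \<sigma>)"
    have Ks: "norm y < s" "norm y / s \<le> \<sigma>" if "y \<in> K" for y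
    proof -
      have n: "norm y \<le> s * \<sigma>" using that by (simp add: K_def)
      also have "\<dots> \<le> s * (1 / 6)" using \<sigma> \<rho>6 s(1) by (intro mult_left_mono) auto
      finally show "norm y < s" using s(1) by simp
      show "norm y / s \<le> \<sigma>" using n s(1) by (simp add: pos_divide_le_eq mult.commute)
    qed
    define G where "G y = B *v proj_system \<omega> R f x y" for y
    have G0: "G 0 = b"
      by (simp add: G_def b_def x0 proj_system_def proj_factor_def proj_point_def)
    \<comment> \<open>Only the scalar part R of the derivative is inverted; the rank-one part stays
      in the error, where it costs at most \<nu>r\<beta> before division by R.\<close>
    define \<Phi> where "\<Phi> y = y - (1 / R) *\<^sub>R G y" for y
    have "continuous_on K (\<lambda>y. B *v proj_system \<omega> R f x y)"
      by (rule bounded_linear.continuous_on[OF bounded_linear_matrix_complex])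
         (rule continuous_on_proj_system[OF f R x], use Ks in \<open>simp add: s_def\<close>)
    then have cont: "continuous_on K \<Phi>" unfolding \<Phi>_def[abs_def] G_def by (intro continuous_intros)
    have self: "\<Phi> y \<in> K" if y: "y \<in> K" for y
    proof -
      define \<zeta> where "\<zeta> = of_real N * herm y x / complex_of_real s"
      define E where "E = G y - G 0 - (R *\<^sub>R y - \<zeta> *s b)"
      define t where "t = Re (proj_form x y y)"
      have "t \<le> (norm y / s)\<^sup>2" using proj_form_self_le[OF x, of y] by (simp add: t_def s_def)
      also have "\<dots> \<le> \<sigma>\<^sup>2" using Ks(2)[OF y] s(1) by (intro power_mono) auto
      finally have t\<sigma>: "t \<le> \<sigma>\<^sup>2" .
      have t0: "0 \<le> t" unfolding t_def by (rule proj_form_self_nonneg[OF x])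
      have "\<sigma> \<le> r / N" using \<sigma>(2) \<rho>(2) by linarith
      then have N\<sigma>: "N * \<sigma> \<le> r" using N by (simp add: pos_le_divide_eq mult.commute)
      have "N * t \<le> N * \<sigma>\<^sup>2" using t\<sigma> N by (intro mult_left_mono) auto
      also have "\<dots> = (N * \<sigma>) * \<sigma>" by (simp add: power2_eq_square)
      also have "\<dots> \<le> (1 / 2) * (1 / 6)" using N\<sigma> r2 \<sigma> \<rho>6 root(2) by (intro mult_mono) auto
      finally have Nt: "N * t \<le> 1 / 9" by simp
      have real: "of_real t = proj_form x y y" unfolding t_def proj_form_self by simp
      have "(norm E)\<^sup>2 \<le> m\<^sup>2 * (Re (proj_kernel x y y) - 1 - N * t)"
        using key[of y 0 1 y] Ks(1)[OF y] s(1) unfolding E_def G_def \<zeta>_def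
        by (simp add: N_def t_def algebra_simps)
      also have "\<dots> \<le> m\<^sup>2 * (9 / 8 * (N * t)\<^sup>2)"
        using kernel_remainder_bound[OF t0 Nt[unfolded N_def]] unfolding real
        by (intro mult_left_mono) (auto simp: proj_kernel_def N_def)
      \<comment> \<open>A rational square above the constant of the remainder bound: 1.07^2 = 1.1449
        > 9/8.\<close>
      also have "\<dots> \<le> m\<^sup>2 * ((107 / 100)\<^sup>2 * (N * \<sigma>\<^sup>2)\<^sup>2)"
        using N t0 t\<sigma> by (intro mult_left_mono mult_mono power_mono) (auto simp: power2_eq_square)
      also have "\<dots> = (m * (107 / 100 * (N * \<sigma>\<^sup>2)))\<^sup>2" by (simp only: power_mult_distrib)
      finally have E: "norm E \<le> m * (107 / 100 * (N * \<sigma>\<^sup>2))"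
        by (rule power2_le_imp_le) (use m0 N in simp)
      have "\<Phi> y = - (1 / R) *\<^sub>R (b - \<zeta> *s b + E)"
        using R by (simp add: \<Phi>_def E_def G0 algebra_simps)
      then have "norm (\<Phi> y) = 1 / R * norm (b - \<zeta> *s b + E)" using R by simp
      also have "norm (b - \<zeta> *s b + E) \<le> \<beta> + cmod \<zeta> * \<beta> + norm E"
        using norm_triangle_ineq[of "b - \<zeta> *s b" E] norm_triangle_ineq4[of b "\<zeta> *s b"]
        by (simp add: \<beta>_def norm_vector_scalar_mult)
      also have "cmod \<zeta> \<le> \<nu> * r"
      proof -
        have "cmod (herm y x) \<le> norm y * \<nu>" unfolding \<nu>_def by (rule norm_herm_le)
        then have "cmod \<zeta> \<le> N * (norm y * \<nu>) / s"
          using N s(1) by (simp add: \<zeta>_def norm_mult norm_divide divide_right_mono)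
        also have "\<dots> = N * \<nu> * (norm y / s)" by simp
        also have "\<dots> \<le> N * \<nu> * \<sigma>" using Ks(2)[OF y] N \<nu> by (intro mult_left_mono) auto
        also have "\<dots> = \<nu> * (N * \<sigma>)" by simp
        also have "\<dots> \<le> \<nu> * r" using N\<sigma> \<nu> by (intro mult_left_mono) auto
        finally show ?thesis .
      qed
      \<comment> \<open>Multiplied by \<kappa>, the left side becomes an expression in \<alpha>,
        \<gamma> and r, since \<beta>\<kappa> = \<alpha>, m\<kappa> <= \<gamma> and N\<sigma> <= r;
        the right side becomes M\<sigma>. The reserve \<nu>r^2/N of the scalar inequality covers the
        shrinking from \<rho> to \<sigma>: r(1 - \<nu>\<rho>) <= r/(1 + \<nu>\<rho>) =
        M\<sigma>.\<close>
      also have "\<beta> + \<nu> * r * \<beta> + norm E \<le> R * (s * \<sigma>)"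
      proof -
        have "\<kappa> * (\<beta> + \<nu> * r * \<beta> + norm E) \<le> \<kappa> * (\<beta> + \<nu> * r * \<beta> + m * (107 / 100 * (N * \<sigma>\<^sup>2)))"
          using E \<kappa>1 by (intro mult_left_mono add_left_mono) auto
        also have "\<dots> = \<alpha> * (1 + \<nu> * r) + 107 / 100 * (m * \<kappa>) * (N * \<sigma>\<^sup>2)"
          by (simp add: \<alpha> algebra_simps)
        also have "\<dots> \<le> \<alpha> * (1 + \<nu> * r) + 107 / 100 * \<gamma> * (r\<^sup>2 / N)"
        proof -
          have "N * \<sigma>\<^sup>2 = (N * \<sigma>)\<^sup>2 / N" using N by (simp add: power2_eq_square)
          also have "\<dots> \<le> r\<^sup>2 / N" using N\<sigma> \<sigma> N by (intro divide_right_mono power_mono) auto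
          finally show ?thesis using m\<gamma> m0 \<kappa>1 N \<gamma> by (intro add_left_mono mult_mono) auto
        qed
        also have "\<dots> \<le> r - \<nu> * r\<^sup>2 / N"
          using self_map_inequality[OF root(3,2) _ \<alpha>0 \<nu>(1) \<nu>\<gamma> N \<gamma>] r2 by simp
        also have "\<dots> \<le> M * \<sigma>"
        proof -
          have "r - \<nu> * r\<^sup>2 / N \<le> r - \<nu> * \<rho> * r"
          proof -
            have "\<nu> * r * \<rho> \<le> \<nu> * r * (r / N)" using \<rho> \<nu> root(2) by (intro mult_left_mono) auto
            then show ?thesis by (simp add: power2_eq_square mult_ac)
          qed
          also have "\<dots> = r * (1 - \<nu> * \<rho>)" by (simp add: algebra_simps)
          also have "\<dots> \<le> r * (1 / (1 + \<nu> * \<rho>))"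
          proof -
            have "(1 - \<nu> * \<rho>) * (1 + \<nu> * \<rho>) = 1 - (\<nu> * \<rho>)\<^sup>2" by (simp add: power2_eq_square algebra_simps)
            then have "1 - \<nu> * \<rho> \<le> 1 / (1 + \<nu> * \<rho>)" using \<nu>\<rho> by (simp add: pos_le_divide_eq)
            then show ?thesis using root(2) by (intro mult_left_mono)
          qed
          also have "\<dots> = M * \<sigma>" using Mpos by (simp add: \<sigma>_def \<rho>_def)
          finally show ?thesis .
        qed
        also have "\<dots> = \<kappa> * (R * (s * \<sigma>))" by (simp add: M_def)
        finally show ?thesis using \<kappa>1 by simp
      qed
      finally have "norm (\<Phi> y) \<le> s * \<sigma>"
        using R \<beta>_def by (simp add: pos_divide_le_eq mult_ac mult_right_mono)
      then show ?thesis by (simp add: K_def)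
    qed
    \<comment> \<open>If r = 0, then \<alpha> = 0, x_0 is itself a root and K is the single point 0;
      Brouwer's theorem for nonempty compact convex sets covers this case as well.\<close>
    obtain y where y: "y \<in> K" "\<Phi> y = y"
    proof (rule brouwer[of K \<Phi>])
      show "compact K" "convex K" by (auto simp: K_def)
      show "K \<noteq> {}" using mult_nonneg_nonneg[OF less_imp_le[OF s(1)] \<sigma>(1)] by (simp add: K_def)
    qed (use cont self in auto)
    have "G y = 0" using y(2) R by (simp add: \<Phi>_def)
    then have "proj_system \<omega> R f x y = 0"
      using matrix_inv_mult_vec(2)[OF inv, of "proj_system \<omega> R f x y"] by (simp add: G_def B_def)
    then have fz: "f (\<omega> + R *\<^sub>R proj_point x y) = 0"
      using proj_system_eq_0_iff[OF x] Ks(1)[OF y(1)] by (simp add: s_def)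
    have "norm (R *\<^sub>R (inverse (proj_factor x y) *s y)) \<le> r / \<kappa>"
    proof -
      define v where "v = norm y / s"
      have v: "0 \<le> v" "v \<le> \<sigma>" using Ks(2)[OF y(1)] s(1) by (auto simp: v_def)
      have "cmod (herm y x / of_real s) \<le> \<nu> * v"
        using norm_herm_le[of y x] s(1) by (simp add: norm_divide v_def \<nu>_def divide_right_mono mult.commute)
      also have "\<nu> * v \<le> \<nu> * \<sigma>" using v \<nu> by (intro mult_left_mono) auto
      finally have "1 - \<nu> * \<sigma> \<le> cmod (proj_factor x y)"
        using norm_triangle_ineq2[of 1 "- (herm y x / of_real s)"] by (simp add: proj_factor_def s_def)
      then have le: "1 / (1 + \<nu> * \<rho>) \<le> cmod (proj_factor x y)" using \<nu>\<rho> by (simp add: \<sigma>_def field_simps)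
      have pos: "1 / (1 + \<nu> * \<rho>) > 0" using \<nu>\<rho> by simp
      have "norm (R *\<^sub>R (inverse (proj_factor x y) *s y)) = R * (norm y / cmod (proj_factor x y))"
        using R by (simp add: norm_vector_scalar_mult norm_inverse divide_inverse)
      also have "\<dots> \<le> R * (norm y / (1 / (1 + \<nu> * \<rho>)))"
        by (intro mult_left_mono divide_left_mono le mult_pos_pos pos less_le_trans[OF pos le]) (use R in auto)
      also have "\<dots> \<le> R * ((s * \<sigma>) / (1 / (1 + \<nu> * \<rho>)))"
        using y(1) R pos by (intro mult_left_mono divide_right_mono) (auto simp: K_def)
      also have "\<dots> = R * s * \<rho>" using \<nu>\<rho> by (simp add: \<sigma>_def)
      also have "\<dots> = r / \<kappa>" using R s(1) \<kappa>1 by (simp add: \<rho>_def M_def)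
      finally show ?thesis .
    qed
    also have "r / \<kappa> < \<theta>" using r\<theta> \<kappa>1 by (simp add: pos_divide_less_eq mult.commute)
    finally have "\<omega> + R *\<^sub>R proj_point x y \<in> ball x\<^sub>0 \<theta>"
      by (simp add: x0 proj_point_def dist_norm scaleR_add_right)
    then show ?thesis using fz by blast
  qed
  show ?thesis using ex uniq by blast
qed

end
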